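(* Let $M\subset\mathbb{R}^4$ be a non-degenerate surface, and let $H$, $\eta$, $G_1$, $G_2$ be the quantities associated with its affine normal plane bundle and a $g$-orthonormal local tangent frame $\{X_1,X_2\}$, as defined in the context. Then $M$ is Lagrangian with respect to a parallel symplectic form if and only if either (a) $\operatorname{rank}(H)=1$ and the equations $d\eta(X_1)+\epsilon G_1=0$, $d\eta(X_2)-G_2=0$ hold, or (b) $\operatorname{rank}(H)=0$.
   Context: $\mathbb{R}^4$ carries its standard flat connection $D$ and a parallel volume form $[\cdot,\cdot,\cdot,\cdot]$. A symplectic form $\Omega$ on $\mathbb{R}^4$ is parallel if $D\Omega=0$; $M$ is Lagrangian with respect to $\Omega$ if $\Omega$ vanishes on the tangent planes of $M$. Affine metric. For a local tangent frame $u=\{X_1,X_2\}$ of $M$ set $G_u(Y,Z)=\frac12([X_1,X_2,D_YX_1,D_ZX_2]+[X_1,X_2,D_ZX_1,D_YX_2])$ and $\Delta(u)=G_u(X_1,X_1)G_u(X_2,X_2)-G_u(X_1,X_2)^2$. $M$ is non-degenerate if $\Delta(u)\neq0$ (a condition independent of $u$); then $g=\Delta(u)^{-1/3}G_u$ is independent of $u$ and is called the affine metric. Put $\epsilon=1$ if $g$ is definite and $\epsilon=-1$ if $g$ is indefinite. A $g$-orthonormal local frame is one with $g(X_1,X_1)=\epsilon$, $g(X_1,X_2)=0$, $g(X_2,X_2)=1$. Transversal bundles. For a transversal plane bundle $\sigma$ and tangent fields $X,Y$, write $D_XY=\nabla_XY+h(X,Y)$ with $\nabla_XY$ tangent to $M$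 and $h(X,Y)\in\sigma$; for a local basis $\{\xi_1,\xi_2\}$ of $\sigma$ write $h=h^1\xi_1+h^2\xi_2$. For each $g$-orthonormal local frame $\{X_1,X_2\}$ there is a unique local basis $\{\xi_1,\xi_2\}$ of $\sigma$ with $[X_1,X_2,\xi_1,\xi_2]=1$, $h^1(X_1,X_1)=1$, $h^1(X_1,X_2)=0$, $h^1(X_2,X_2)=-\epsilon$, $h^2(X_1,X_1)=0$, $h^2(X_1,X_2)=1$, $h^2(X_2,X_2)=0$; this basis is used throughout. Write $\nabla_{X_i}X_j=\Gamma_{ij}^1X_1+\Gamma_{ij}^2X_2$, $D_X\xi_i=-S_iX+\tau_i^1(X)\xi_1+\tau_i^2(X)\xi_2$ with $S_iX$ tangent, and $S_iX_j=\lambda_{ij}^1X_1+\lambda_{ij}^2X_2$. Affine normal plane bundle: the unique transversal plane bundle $\sigma$ such that, with $\nabla(g)(X,Y,Z)=(\nabla_Xg)(Y,Z)$ and a $g$-orthonormal local frame, $\epsilon\nabla(g)(X_1,X_1,X_1)+\nabla(g)(X_1,X_2,X_2)=0$, $\epsilon\nabla(g)(X_2,X_1,X_1)+\nabla(g)(X_2,X_2,X_2)=0$, $\nabla(g)(X_2,X_1,X_1)+\nabla(g)(X_1,X_2,X_1)=0$, $\nabla(g)(X_1,X_2,X_2)+\nabla(g)(X_2,X_1,X_2)=0$. All quantities below are computed with this $\sigma$. Matrices. $L=(L_{ij})$ is the $2\times2$ matrix with $L_{11}=\lambda_{11}^1-\lambda_{21}^2$, $L_{12}=-\epsilon\lambda_{11}^2-\lambda_{21}^1$,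 $L_{21}=\lambda_{12}^1-\lambda_{22}^2$, $L_{22}=-\epsilon\lambda_{12}^2-\lambda_{22}^1$. The cubic forms are $C^i(X,Y,Z)=(\nabla_Xh^i)(Y,Z)+\tau_1^i(X)h^1(Y,Z)+\tau_2^i(X)h^2(Y,Z)$, $i=1,2$, and $F=(F_{ij})$ is the $2\times2$ matrix with $F_{i1}=3C^i(X_1,X_1,X_2)-\epsilon C^i(X_2,X_2,X_2)$, $F_{i2}=\epsilon C^i(X_1,X_1,X_1)-3C^i(X_1,X_2,X_2)$. $H$ is the matrix whose rows are the two rows of $L$ followed by the two rows of $F$, so that $[A,B]^t\in\ker H$ means $L[A,B]^t=0$ and $F[A,B]^t=0$. The rank of $H$ is independent of the choice of the $g$-orthonormal frame. $G_1=\Gamma_{22}^2-\epsilon\Gamma_{11}^2+\tau_1^1(X_2)-\epsilon\tau_1^2(X_1)$ and $G_2=\Gamma_{11}^1-\epsilon\Gamma_{22}^1-\tau_2^2(X_1)+\tau_1^2(X_2)$. The function $\eta$. When $\operatorname{rank}(H)=1$, let $[A,B]^t$ be a column vector in the kernel of $H$ and put $\eta=\tan^{-1}(B/A)$ if $\epsilon=1$ and $\eta=\tanh^{-1}(B/A)$ if $\epsilon=-1$. The validity of the equations for $\eta$ in (a) is independent of the choice of the local frame.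
   Formalization: M is assumed connected and rank(H) constant on M, since the equivalence fails without either; where tanh^{-1}(B/A) is undefined because |B|>|A|, η is read as coth^{-1}(B/A), which has the same differential, and where A=0 with ε=1 it is read as an angle. *)

theory Defs
  imports "HOL-Analysis.Analysis"
begin

section \<open>Smooth surfaces in four-space\<close>

type_synonym r4 = "real ^ 4"

primrec Ck_on :: "nat \<Rightarrow> 'a::euclidean_space set \<Rightarrow> ('a \<Rightarrow> 'b::euclidean_space) \<Rightarrow> bool" where
  "Ck_on 0 S f \<longleftrightarrow> continuous_on S f"
| "Ck_on (Suc k) S f \<longleftrightarrow>
     (\<exists>f'. (\<forall>x\<in>S. (f has_derivative f' x) (at x)) \<and> (\<forall>v. Ck_on k S (\<lambda>x. f' x v)))"

definition smooth_on :: "'a::euclidean_space set \<Rightarrow> ('a \<Rightarrow> 'b::euclidean_space) \<Rightarrow> bool" where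
  "smooth_on S f \<longleftrightarrow> (\<forall>k. Ck_on k S f)"

text \<open>Smoothness of a map on an arbitrary subset of a Euclidean space, in the usual sense of
  local smooth extensions to open sets of the ambient space.\<close>

definition smooth_along :: "'a::euclidean_space set \<Rightarrow> ('a \<Rightarrow> 'b::euclidean_space) \<Rightarrow> bool" where
  "smooth_along U f \<longleftrightarrow>
     (\<forall>p\<in>U. \<exists>W F. open W \<and> p \<in> W \<and> smooth_on W F \<and> (\<forall>q\<in>U \<inter> W. F q = f q))"

text \<open>An embedded two-dimensional submanifold: locally \<open>\<phi>\<close> is a diffeomorphism from an open
  subset of the plane, and \<open>\<psi>\<close> is a smooth ambient extension of its inverse.\<close>

definition smooth_surface :: "r4 set \<Rightarrow> bool" where
  "smooth_surface M \<longleftrightarrow>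
     (\<forall>p\<in>M. \<exists>W (V :: (real ^ 2) set) \<phi> \<psi>.
        open W \<and> p \<in> W \<and> open V \<and> smooth_on V \<phi> \<and> smooth_on W \<psi> \<and>
        \<phi> ` V = M \<inter> W \<and> (\<forall>u\<in>V. \<psi> (\<phi> u) = u))"

definition tangent_space :: "r4 set \<Rightarrow> r4 \<Rightarrow> r4 set" where
  "tangent_space M p =
     {v. \<exists>c :: real \<Rightarrow> r4. c 0 = p \<and> (c has_vector_derivative v) (at 0) \<and>
           (\<exists>e>0. \<forall>t. \<bar>t\<bar> < e \<longrightarrow> c t \<in> M)}"

text \<open>The flat derivative \<open>D\<^sub>v f\<close> at \<open>p\<close> of a map defined along \<open>M\<close>. Derivatives within \<open>M\<close>
  are not unique as linear maps on the ambient space, but their restriction to the tangent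
  space is, and only tangent \<open>v\<close> are used.\<close>

definition D :: "r4 set \<Rightarrow> (r4 \<Rightarrow> 'b::euclidean_space) \<Rightarrow> r4 \<Rightarrow> r4 \<Rightarrow> 'b" where
  "D M f p v = frechet_derivative f (at p within M) v"

section \<open>Parallel forms\<close>

text \<open>Forms are fields on \<open>\<real>\<^sup>4\<close> whose first argument is the base point. Being \<open>D\<close>-parallel
  means that the values on constant vector fields have vanishing derivative. For multilinear
  maps, vanishing on equal adjacent arguments is enough to be alternating.\<close>

definition parallel_volume_form :: "(r4 \<Rightarrow> r4 \<Rightarrow> r4 \<Rightarrow> r4 \<Rightarrow> r4 \<Rightarrow> real) \<Rightarrow> bool" where
  "parallel_volume_form vol \<longleftrightarrow>
     (\<forall>p a b c. linear (\<lambda>x. vol p x a b c) \<and> linear (\<lambda>x. vol p a x b c) \<and>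
                linear (\<lambda>x. vol p a b x c) \<and> linear (\<lambda>x. vol p a b c x)) \<and>
     (\<forall>p a b c. vol p a a b c = 0 \<and> vol p b a a c = 0 \<and> vol p b c a a = 0) \<and>
     (\<forall>p. \<exists>a b c d. vol p a b c d \<noteq> 0) \<and>
     (\<forall>p a b c d. ((\<lambda>q. vol q a b c d) has_derivative (\<lambda>_. 0)) (at p))"

definition parallel_symplectic_form :: "(r4 \<Rightarrow> r4 \<Rightarrow> r4 \<Rightarrow> real) \<Rightarrow> bool" where
  "parallel_symplectic_form \<Omega> \<longleftrightarrow>
     (\<forall>p. bilinear (\<Omega> p)) \<and> (\<forall>p v. \<Omega> p v v = 0) \<and>
     (\<forall>p v. v \<noteq> 0 \<longrightarrow> (\<exists>w. \<Omega> p v w \<noteq> 0)) \<and>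
     (\<forall>p v w. ((\<lambda>q. \<Omega> q v w) has_derivative (\<lambda>_. 0)) (at p))"

definition lagrangian :: "r4 set \<Rightarrow> (r4 \<Rightarrow> r4 \<Rightarrow> r4 \<Rightarrow> real) \<Rightarrow> bool" where
  "lagrangian M \<Omega> \<longleftrightarrow>
     (\<forall>p\<in>M. \<forall>v\<in>tangent_space M p. \<forall>w\<in>tangent_space M p. \<Omega> p v w = 0)"

section \<open>The affine metric\<close>

text \<open>Frames are indexed by the two-element type \<open>2\<close>, so that \<open>X 1\<close> and \<open>X 2\<close> are the two
  vector fields. The domain \<open>U\<close> is a relatively open subset of \<open>M\<close>.\<close>

definition tangent_frame :: "r4 set \<Rightarrow> r4 set \<Rightarrow> (2 \<Rightarrow> r4 \<Rightarrow> r4) \<Rightarrow> bool" where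
  "tangent_frame M U X \<longleftrightarrow>
     openin (top_of_set M) U \<and> (\<forall>i. smooth_along U (X i)) \<and>
     (\<forall>p\<in>U. (\<forall>i. X i p \<in> tangent_space M p) \<and> X 1 p \<noteq> X 2 p \<and> independent {X 1 p, X 2 p})"

definition G_frame ::
  "(r4 \<Rightarrow> r4 \<Rightarrow> r4 \<Rightarrow> r4 \<Rightarrow> r4 \<Rightarrow> real) \<Rightarrow> r4 set \<Rightarrow> (2 \<Rightarrow> r4 \<Rightarrow> r4) \<Rightarrow> r4 \<Rightarrow> r4 \<Rightarrow> r4 \<Rightarrow> real" where
  "G_frame vol M X p y z =
     (vol p (X 1 p) (X 2 p) (D M (X 1) p y) (D M (X 2) p z) +
      vol p (X 1 p) (X 2 p) (D M (X 1) p z) (D M (X 2) p y)) / 2"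

definition Delta_frame ::
  "(r4 \<Rightarrow> r4 \<Rightarrow> r4 \<Rightarrow> r4 \<Rightarrow> r4 \<Rightarrow> real) \<Rightarrow> r4 set \<Rightarrow> (2 \<Rightarrow> r4 \<Rightarrow> r4) \<Rightarrow> r4 \<Rightarrow> real" where
  "Delta_frame vol M X p =
     G_frame vol M X p (X 1 p) (X 1 p) * G_frame vol M X p (X 2 p) (X 2 p)
       - (G_frame vol M X p (X 1 p) (X 2 p))\<^sup>2"

definition nondegenerate :: "(r4 \<Rightarrow> r4 \<Rightarrow> r4 \<Rightarrow> r4 \<Rightarrow> r4 \<Rightarrow> real) \<Rightarrow> r4 set \<Rightarrow> bool" where
  "nondegenerate vol M \<longleftrightarrow>
     (\<forall>U X. tangent_frame M U X \<longrightarrow> (\<forall>p\<in>U. Delta_frame vol M X p \<noteq> 0))"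

text \<open>The common value of \<open>\<Delta>(u)\<^sup>-\<^sup>1\<^sup>/\<^sup>3 G\<^sub>u\<close> over all local frames \<open>u\<close> around \<open>p\<close>; note that
  \<^term>\<open>root 3\<close> is the real cube root also for negative arguments.\<close>

definition affine_metric ::
  "(r4 \<Rightarrow> r4 \<Rightarrow> r4 \<Rightarrow> r4 \<Rightarrow> r4 \<Rightarrow> real) \<Rightarrow> r4 set \<Rightarrow> r4 \<Rightarrow> r4 \<Rightarrow> r4 \<Rightarrow> real" where
  "affine_metric vol M p y z =
     (THE c. \<forall>U X. tangent_frame M U X \<and> p \<in> U \<longrightarrow>
               c = G_frame vol M X p y z / root 3 (Delta_frame vol M X p))"

text \<open>\<open>\<epsilon>\<close> is defined pointwise; it is constant on a connected non-degenerate surface.\<close>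

definition metric_sign ::
  "(r4 \<Rightarrow> r4 \<Rightarrow> r4 \<Rightarrow> r4 \<Rightarrow> r4 \<Rightarrow> real) \<Rightarrow> r4 set \<Rightarrow> r4 \<Rightarrow> real" where
  "metric_sign vol M p =
     (if (\<forall>v\<in>tangent_space M p. v \<noteq> 0 \<longrightarrow> affine_metric vol M p v v > 0) \<or>
         (\<forall>v\<in>tangent_space M p. v \<noteq> 0 \<longrightarrow> affine_metric vol M p v v < 0)
      then 1 else - 1)"

definition orthonormal_frame ::
  "(r4 \<Rightarrow> r4 \<Rightarrow> r4 \<Rightarrow> r4 \<Rightarrow> r4 \<Rightarrow> real) \<Rightarrow> r4 set \<Rightarrow> r4 set \<Rightarrow> (2 \<Rightarrow> r4 \<Rightarrow> r4) \<Rightarrow> bool" where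
  "orthonormal_frame vol M U X \<longleftrightarrow>
     tangent_frame M U X \<and>
     (\<forall>p\<in>U. affine_metric vol M p (X 1 p) (X 1 p) = metric_sign vol M p \<and>
             affine_metric vol M p (X 1 p) (X 2 p) = 0 \<and>
             affine_metric vol M p (X 2 p) (X 2 p) = 1)"

section \<open>Transversal plane bundles\<close>

definition transversal_bundle :: "r4 set \<Rightarrow> (r4 \<Rightarrow> r4 set) \<Rightarrow> bool" where
  "transversal_bundle M \<sigma> \<longleftrightarrow>
     (\<forall>p\<in>M. subspace (\<sigma> p) \<and> dim (\<sigma> p) = 2 \<and> tangent_space M p \<inter> \<sigma> p = {0}) \<and>
     (\<forall>p\<in>M. \<exists>U (\<xi> :: 2 \<Rightarrow> r4 \<Rightarrow> r4). openin (top_of_set M) U \<and> p \<in> U \<and>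
        (\<forall>i. smooth_along U (\<xi> i)) \<and> (\<forall>q\<in>U. \<sigma> q = span {\<xi> 1 q, \<xi> 2 q}))"

definition tangent_part :: "r4 set \<Rightarrow> (r4 \<Rightarrow> r4 set) \<Rightarrow> r4 \<Rightarrow> r4 \<Rightarrow> r4" where
  "tangent_part M \<sigma> p v = (THE w. w \<in> tangent_space M p \<and> v - w \<in> \<sigma> p)"

definition transversal_part :: "r4 set \<Rightarrow> (r4 \<Rightarrow> r4 set) \<Rightarrow> r4 \<Rightarrow> r4 \<Rightarrow> r4" where
  "transversal_part M \<sigma> p v = v - tangent_part M \<sigma> p v"

definition conn :: "r4 set \<Rightarrow> (r4 \<Rightarrow> r4 set) \<Rightarrow> (r4 \<Rightarrow> r4) \<Rightarrow> (r4 \<Rightarrow> r4) \<Rightarrow> r4 \<Rightarrow> r4" where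
  "conn M \<sigma> Y Z p = tangent_part M \<sigma> p (D M Z p (Y p))"

definition h_form :: "r4 set \<Rightarrow> (r4 \<Rightarrow> r4 set) \<Rightarrow> (r4 \<Rightarrow> r4) \<Rightarrow> (r4 \<Rightarrow> r4) \<Rightarrow> r4 \<Rightarrow> r4" where
  "h_form M \<sigma> Y Z p = transversal_part M \<sigma> p (D M Z p (Y p))"

definition nabla_g ::
  "(r4 \<Rightarrow> r4 \<Rightarrow> r4 \<Rightarrow> r4 \<Rightarrow> r4 \<Rightarrow> real) \<Rightarrow> r4 set \<Rightarrow> (r4 \<Rightarrow> r4 set) \<Rightarrow>
    (r4 \<Rightarrow> r4) \<Rightarrow> (r4 \<Rightarrow> r4) \<Rightarrow> (r4 \<Rightarrow> r4) \<Rightarrow> r4 \<Rightarrow> real" where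
  "nabla_g vol M \<sigma> X Y Z p =
     D M (\<lambda>q. affine_metric vol M q (Y q) (Z q)) p (X p)
       - affine_metric vol M p (conn M \<sigma> X Y p) (Z p)
       - affine_metric vol M p (Y p) (conn M \<sigma> X Z p)"

definition affine_normal_bundle ::
  "(r4 \<Rightarrow> r4 \<Rightarrow> r4 \<Rightarrow> r4 \<Rightarrow> r4 \<Rightarrow> real) \<Rightarrow> r4 set \<Rightarrow> (r4 \<Rightarrow> r4 set) \<Rightarrow> bool" where
  "affine_normal_bundle vol M \<sigma> \<longleftrightarrow>
     transversal_bundle M \<sigma> \<and>
     (\<forall>U X. orthonormal_frame vol M U X \<longrightarrow> (\<forall>p\<in>U.
        let \<epsilon> = metric_sign vol M p;
            Dg = (\<lambda>i j k. nabla_g vol M \<sigma> (X i) (X j) (X k) p)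
        in \<epsilon> * Dg 1 1 1 + Dg 1 2 2 = 0 \<and>
           \<epsilon> * Dg 2 1 1 + Dg 2 2 2 = 0 \<and>
           Dg 2 1 1 + Dg 1 2 1 = 0 \<and>
           Dg 1 2 2 + Dg 2 1 2 = 0))"

section \<open>Invariants in an adapted frame\<close>

definition h_coeff ::
  "r4 set \<Rightarrow> (r4 \<Rightarrow> r4 set) \<Rightarrow> (2 \<Rightarrow> r4 \<Rightarrow> r4) \<Rightarrow> 2 \<Rightarrow> (r4 \<Rightarrow> r4) \<Rightarrow> (r4 \<Rightarrow> r4) \<Rightarrow> r4 \<Rightarrow> real" where
  "h_coeff M \<sigma> \<xi> k Y Z p = representation {\<xi> 1 p, \<xi> 2 p} (h_form M \<sigma> Y Z p) (\<xi> k p)"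

text \<open>A \<open>g\<close>-orthonormal local frame \<open>X\<close> on \<open>U\<close> together with the basis \<open>\<xi>\<close> of \<open>\<sigma>\<close> that it
  determines.\<close>

definition adapted_frame ::
  "(r4 \<Rightarrow> r4 \<Rightarrow> r4 \<Rightarrow> r4 \<Rightarrow> r4 \<Rightarrow> real) \<Rightarrow> r4 set \<Rightarrow> (r4 \<Rightarrow> r4 set) \<Rightarrow> r4 set \<Rightarrow>
    (2 \<Rightarrow> r4 \<Rightarrow> r4) \<Rightarrow> (2 \<Rightarrow> r4 \<Rightarrow> r4) \<Rightarrow> bool" where
  "adapted_frame vol M \<sigma> U X \<xi> \<longleftrightarrow>
     orthonormal_frame vol M U X \<and> (\<forall>i. smooth_along U (\<xi> i)) \<and>
     (\<forall>p\<in>U. span {\<xi> 1 p, \<xi> 2 p} = \<sigma> p \<and>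
        vol p (X 1 p) (X 2 p) (\<xi> 1 p) (\<xi> 2 p) = 1 \<and>
        h_coeff M \<sigma> \<xi> 1 (X 1) (X 1) p = 1 \<and>
        h_coeff M \<sigma> \<xi> 1 (X 1) (X 2) p = 0 \<and>
        h_coeff M \<sigma> \<xi> 1 (X 2) (X 2) p = - metric_sign vol M p \<and>
        h_coeff M \<sigma> \<xi> 2 (X 1) (X 1) p = 0 \<and>
        h_coeff M \<sigma> \<xi> 2 (X 1) (X 2) p = 1 \<and>
        h_coeff M \<sigma> \<xi> 2 (X 2) (X 2) p = 0)"

text \<open>\<open>Gam M \<sigma> X i j k\<close> is \<open>\<Gamma>\<^sub>i\<^sub>j\<^sup>k\<close>, \<open>tau M \<sigma> \<xi> i k Y\<close> is \<open>\<tau>\<^sub>i\<^sup>k(Y)\<close> and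
  \<open>lam M \<sigma> X \<xi> i j k\<close> is \<open>\<lambda>\<^sub>i\<^sub>j\<^sup>k\<close>.\<close>

definition Gam ::
  "r4 set \<Rightarrow> (r4 \<Rightarrow> r4 set) \<Rightarrow> (2 \<Rightarrow> r4 \<Rightarrow> r4) \<Rightarrow> 2 \<Rightarrow> 2 \<Rightarrow> 2 \<Rightarrow> r4 \<Rightarrow> real" where
  "Gam M \<sigma> X i j k p = representation {X 1 p, X 2 p} (conn M \<sigma> (X i) (X j) p) (X k p)"

definition shape ::
  "r4 set \<Rightarrow> (r4 \<Rightarrow> r4 set) \<Rightarrow> (2 \<Rightarrow> r4 \<Rightarrow> r4) \<Rightarrow> 2 \<Rightarrow> (r4 \<Rightarrow> r4) \<Rightarrow> r4 \<Rightarrow> r4" where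
  "shape M \<sigma> \<xi> i Y p = - tangent_part M \<sigma> p (D M (\<xi> i) p (Y p))"

definition tau ::
  "r4 set \<Rightarrow> (r4 \<Rightarrow> r4 set) \<Rightarrow> (2 \<Rightarrow> r4 \<Rightarrow> r4) \<Rightarrow> 2 \<Rightarrow> 2 \<Rightarrow> (r4 \<Rightarrow> r4) \<Rightarrow> r4 \<Rightarrow> real" where
  "tau M \<sigma> \<xi> i k Y p =
     representation {\<xi> 1 p, \<xi> 2 p} (transversal_part M \<sigma> p (D M (\<xi> i) p (Y p))) (\<xi> k p)"

definition lam ::
  "r4 set \<Rightarrow> (r4 \<Rightarrow> r4 set) \<Rightarrow> (2 \<Rightarrow> r4 \<Rightarrow> r4) \<Rightarrow> (2 \<Rightarrow> r4 \<Rightarrow> r4) \<Rightarrow> 2 \<Rightarrow> 2 \<Rightarrow> 2 \<Rightarrow> r4 \<Rightarrow> real" where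
  "lam M \<sigma> X \<xi> i j k p = representation {X 1 p, X 2 p} (shape M \<sigma> \<xi> i (X j) p) (X k p)"

definition nabla_h ::
  "r4 set \<Rightarrow> (r4 \<Rightarrow> r4 set) \<Rightarrow> (2 \<Rightarrow> r4 \<Rightarrow> r4) \<Rightarrow> 2 \<Rightarrow>
    (r4 \<Rightarrow> r4) \<Rightarrow> (r4 \<Rightarrow> r4) \<Rightarrow> (r4 \<Rightarrow> r4) \<Rightarrow> r4 \<Rightarrow> real" where
  "nabla_h M \<sigma> \<xi> i X Y Z p =
     D M (h_coeff M \<sigma> \<xi> i Y Z) p (X p)
       - h_coeff M \<sigma> \<xi> i (conn M \<sigma> X Y) Z p
       - h_coeff M \<sigma> \<xi> i Y (conn M \<sigma> X Z) p"

definition cubic ::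
  "r4 set \<Rightarrow> (r4 \<Rightarrow> r4 set) \<Rightarrow> (2 \<Rightarrow> r4 \<Rightarrow> r4) \<Rightarrow> 2 \<Rightarrow>
    (r4 \<Rightarrow> r4) \<Rightarrow> (r4 \<Rightarrow> r4) \<Rightarrow> (r4 \<Rightarrow> r4) \<Rightarrow> r4 \<Rightarrow> real" where
  "cubic M \<sigma> \<xi> i X Y Z p =
     nabla_h M \<sigma> \<xi> i X Y Z p
       + tau M \<sigma> \<xi> 1 i X p * h_coeff M \<sigma> \<xi> 1 Y Z p
       + tau M \<sigma> \<xi> 2 i X p * h_coeff M \<sigma> \<xi> 2 Y Z p"

definition L_mat ::
  "(r4 \<Rightarrow> r4 \<Rightarrow> r4 \<Rightarrow> r4 \<Rightarrow> r4 \<Rightarrow> real) \<Rightarrow> r4 set \<Rightarrow> (r4 \<Rightarrow> r4 set) \<Rightarrow>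
    (2 \<Rightarrow> r4 \<Rightarrow> r4) \<Rightarrow> (2 \<Rightarrow> r4 \<Rightarrow> r4) \<Rightarrow> r4 \<Rightarrow> real ^ 2 ^ 2" where
  "L_mat vol M \<sigma> X \<xi> p =
     (let \<epsilon> = metric_sign vol M p; l = (\<lambda>i j k. lam M \<sigma> X \<xi> i j k p)
      in vector [vector [l 1 1 1 - l 2 1 2, - \<epsilon> * l 1 1 2 - l 2 1 1],
                 vector [l 1 2 1 - l 2 2 2, - \<epsilon> * l 1 2 2 - l 2 2 1]])"

definition F_mat ::
  "(r4 \<Rightarrow> r4 \<Rightarrow> r4 \<Rightarrow> r4 \<Rightarrow> r4 \<Rightarrow> real) \<Rightarrow> r4 set \<Rightarrow> (r4 \<Rightarrow> r4 set) \<Rightarrow>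
    (2 \<Rightarrow> r4 \<Rightarrow> r4) \<Rightarrow> (2 \<Rightarrow> r4 \<Rightarrow> r4) \<Rightarrow> r4 \<Rightarrow> real ^ 2 ^ 2" where
  "F_mat vol M \<sigma> X \<xi> p =
     (let \<epsilon> = metric_sign vol M p;
          C = (\<lambda>i j k l. cubic M \<sigma> \<xi> i (X j) (X k) (X l) p)
      in \<chi> i. vector [3 * C i 1 1 2 - \<epsilon> * C i 2 2 2, \<epsilon> * C i 1 1 1 - 3 * C i 1 2 2])"

definition H_mat ::
  "(r4 \<Rightarrow> r4 \<Rightarrow> r4 \<Rightarrow> r4 \<Rightarrow> r4 \<Rightarrow> real) \<Rightarrow> r4 set \<Rightarrow> (r4 \<Rightarrow> r4 set) \<Rightarrow>
    (2 \<Rightarrow> r4 \<Rightarrow> r4) \<Rightarrow> (2 \<Rightarrow> r4 \<Rightarrow> r4) \<Rightarrow> r4 \<Rightarrow> real ^ 2 ^ 4" where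
  "H_mat vol M \<sigma> X \<xi> p =
     vector [L_mat vol M \<sigma> X \<xi> p $ 1, L_mat vol M \<sigma> X \<xi> p $ 2,
             F_mat vol M \<sigma> X \<xi> p $ 1, F_mat vol M \<sigma> X \<xi> p $ 2]"

definition G1 ::
  "(r4 \<Rightarrow> r4 \<Rightarrow> r4 \<Rightarrow> r4 \<Rightarrow> r4 \<Rightarrow> real) \<Rightarrow> r4 set \<Rightarrow> (r4 \<Rightarrow> r4 set) \<Rightarrow>
    (2 \<Rightarrow> r4 \<Rightarrow> r4) \<Rightarrow> (2 \<Rightarrow> r4 \<Rightarrow> r4) \<Rightarrow> r4 \<Rightarrow> real" where
  "G1 vol M \<sigma> X \<xi> p =
     Gam M \<sigma> X 2 2 2 p - metric_sign vol M p * Gam M \<sigma> X 1 1 2 p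
       + tau M \<sigma> \<xi> 1 1 (X 2) p - metric_sign vol M p * tau M \<sigma> \<xi> 1 2 (X 1) p"

definition G2 ::
  "(r4 \<Rightarrow> r4 \<Rightarrow> r4 \<Rightarrow> r4 \<Rightarrow> r4 \<Rightarrow> real) \<Rightarrow> r4 set \<Rightarrow> (r4 \<Rightarrow> r4 set) \<Rightarrow>
    (2 \<Rightarrow> r4 \<Rightarrow> r4) \<Rightarrow> (2 \<Rightarrow> r4 \<Rightarrow> r4) \<Rightarrow> r4 \<Rightarrow> real" where
  "G2 vol M \<sigma> X \<xi> p =
     Gam M \<sigma> X 1 1 1 p - metric_sign vol M p * Gam M \<sigma> X 2 2 1 p
       - tau M \<sigma> \<xi> 2 2 (X 1) p + tau M \<sigma> \<xi> 1 2 (X 2) p"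

text \<open>\<open>is_eta \<epsilon> A B t\<close> says that \<open>t\<close> is a value of \<open>tan\<^sup>-\<^sup>1(B/A)\<close> (for \<open>\<epsilon> = 1\<close>) or of
  \<open>tanh\<^sup>-\<^sup>1(B/A)\<close> (for \<open>\<epsilon> = -1\<close>), where \<open>(A, B) \<noteq> (0, 0)\<close>. Denominators are cleared, so that
  an angle also exists where \<open>A = 0\<close>. In the hyperbolic case the equation \<open>tanh t = B/A\<close> is
  solvable only if \<open>\<bar>B\<bar> < \<bar>A\<bar>\<close>; if \<open>\<bar>A\<bar> < \<bar>B\<bar>\<close>, the second disjunct takes the other real
  branch \<open>coth\<^sup>-\<^sup>1(B/A)\<close>, which has the same differential and differs from the complex
  \<open>tanh\<^sup>-\<^sup>1(B/A)\<close> by an imaginary constant. No value exists if \<open>\<bar>A\<bar> = \<bar>B\<bar>\<close>.\<close>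

definition is_eta :: "real \<Rightarrow> real \<Rightarrow> real \<Rightarrow> real \<Rightarrow> bool" where
  "is_eta \<epsilon> A B t \<longleftrightarrow>
     (if \<epsilon> = 1 then A * sin t = B * cos t
      else A * sinh t = B * cosh t \<or> A * cosh t = B * sinh t)"

text \<open>Only the differential of \<open>\<eta>\<close> matters, and where \<open>H\<close> has rank one the line \<open>ker H\<close>
  determines a differentiable \<open>\<eta>\<close> up to a locally constant summand; hence a local choice of
  \<open>\<eta>\<close> near each point of \<open>U\<close>.\<close>

definition eta_equations ::
  "(r4 \<Rightarrow> r4 \<Rightarrow> r4 \<Rightarrow> r4 \<Rightarrow> r4 \<Rightarrow> real) \<Rightarrow> r4 set \<Rightarrow> (r4 \<Rightarrow> r4 set) \<Rightarrow> r4 set \<Rightarrow>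
    (2 \<Rightarrow> r4 \<Rightarrow> r4) \<Rightarrow> (2 \<Rightarrow> r4 \<Rightarrow> r4) \<Rightarrow> bool" where
  "eta_equations vol M \<sigma> U X \<xi> \<longleftrightarrow>
     (\<forall>p\<in>U. \<exists>V A B \<eta>. openin (top_of_set M) V \<and> p \<in> V \<and> V \<subseteq> U \<and>
        (\<forall>q\<in>V. (A q, B q) \<noteq> (0, 0) \<and>
           H_mat vol M \<sigma> X \<xi> q *v vector [A q, B q] = 0 \<and>
           is_eta (metric_sign vol M q) (A q) (B q) (\<eta> q) \<and>
           \<eta> differentiable (at q within M) \<and>
           D M \<eta> q (X 1 q) + metric_sign vol M q * G1 vol M \<sigma> X \<xi> q = 0 \<and>
           D M \<eta> q (X 2 q) - G2 vol M \<sigma> X \<xi> q = 0))"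

end

theory Submission
  imports Defs
begin

text \<open>
  A parallel form is a constant form \<open>\<omega>\<close>. Differentiating \<open>\<omega>(X\<^sub>1, X\<^sub>2) = 0\<close> twice along \<open>M\<close> and using
  the equations of the affine normal plane bundle together with the Codazzi equations gives
  \<open>\<omega>(\<xi>\<^sub>1, \<xi>\<^sub>2) = 0\<close>, \<open>A = \<omega>(X\<^sub>2, \<xi>\<^sub>1) = \<omega>(X\<^sub>1, \<xi>\<^sub>2)\<close>, \<open>B = \<omega>(X\<^sub>1, \<xi>\<^sub>1) = -\<epsilon> \<omega>(X\<^sub>2, \<xi>\<^sub>2)\<close> and
  \<open>F [A, B]\<^sup>t = 0\<close>; one more derivative gives \<open>L [A, B]\<^sup>t = 0\<close>. So \<open>H\<close> has a kernel, and the formulas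
  for \<open>dA\<close> and \<open>dB\<close> yield the equations for \<open>\<eta>\<close>.

  Conversely, along a curve in \<open>M\<close> let \<open>(a, b)\<close> be a constant multiple of \<open>(cos \<eta>, sin \<eta>)\<close>,
  \<open>(cosh \<eta>, sinh \<eta>)\<close> or \<open>(sinh \<eta>, cosh \<eta>)\<close>, where \<open>d\<eta>\<close> is as in (a) and \<open>H [a, b]\<^sup>t = 0\<close>. The matrix that
  these functions prescribe satisfies the same linear differential equation as the matrix of any
  constant form in the moving frame. Hence a constant form that fits at one point fits along the
  curve and vanishes on the tangent planes. If \<open>H = 0\<close> then \<open>\<eta>\<close> is only needed along the curve, where
  it is an integral, so that no integrability condition has to be checked. The points near which
  the form vanishes on the tangent planes are open and closed in the connected set \<open>M\<close>.
\<close>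

section \<open>Symmetry of second derivatives and linear differential equations\<close>

lemma second_difference_bound:
  fixes f :: "'a::real_normed_vector \<Rightarrow> 'b::real_inner"
  assumes S: "open S" "x \<in> S"
    and f': "\<And>y. y \<in> S \<Longrightarrow> (f has_derivative f' y) (at y)"
    and f'': "((\<lambda>y. f' y v) has_derivative g) (at x)"
    and e: "e > 0"
  shows "\<exists>d>0. \<forall>t. 0 < t \<and> t < d \<longrightarrow>
    norm (f (x + t *\<^sub>R v + t *\<^sub>R w) - f (x + t *\<^sub>R v) - f (x + t *\<^sub>R w) + f x - (t * t) *\<^sub>R g w)
      \<le> e * (t * t)"
proof -
  define K where "K = 2 * norm v + norm w + 1"
  have K: "K > 0" by (simp add: K_def add_nonneg_pos)
  obtain r where r: "r > 0" "ball x r \<subseteq> S"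
    using S open_contains_ball by blast
  have bl: "bounded_linear g"
    using f'' has_derivative_bounded_linear by blast
  obtain d0 where d0: "d0 > 0"
    "\<And>y. norm (y - x) < d0 \<Longrightarrow> norm (f' y v - f' x v - g (y - x)) \<le> (e / (2 * K)) * norm (y - x)"
    using f'' e K unfolding has_derivative_at_alt
    by (metis divide_pos_pos mult_pos_pos zero_less_numeral)
  define d where "d = min r d0 / K"
  have "d > 0" using r d0 K by (simp add: d_def)
  moreover have "norm (f (x + t *\<^sub>R v + t *\<^sub>R w) - f (x + t *\<^sub>R v) - f (x + t *\<^sub>R w) + f x - (t * t) *\<^sub>R g w)
      \<le> e * (t * t)" if t: "0 < t" "t < d" for t
  proof -
    have tK: "t * K < r" "t * K < d0"
      using t K by (auto simp: d_def pos_less_divide_eq)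
    have near: "norm (s * t) * norm v + b * t * norm w \<le> t * K"
      if "0 \<le> s" "s \<le> 1" "b = 0 \<or> b = 1" for s b
    proof -
      have "norm (s * t) \<le> t" using that t by (simp add: mult_left_le_one_le)
      then have 1: "norm (s * t) * norm v \<le> t * norm v" by (simp add: mult_right_mono)
      have "b * t * norm w \<le> t * norm w" using that t by auto
      with 1 have "norm (s * t) * norm v + b * t * norm w \<le> t * (norm v + norm w)"
        by (simp add: distrib_left)
      also have "\<dots> \<le> t * K" using t by (intro mult_left_mono) (auto simp: K_def)
      finally show ?thesis .
    qed
    have nrm: "norm ((s * t) *\<^sub>R v + (b * t) *\<^sub>R w) \<le> t * K"
      if "0 \<le> s" "s \<le> 1" "b = 0 \<or> b = 1" for s b
      using near[OF that] that t norm_triangle_ineq[of "(s * t) *\<^sub>R v" "(b * t) *\<^sub>R w"] by auto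
    define F where "F s = f (x + (s * t) *\<^sub>R v + t *\<^sub>R w) - f (x + (s * t) *\<^sub>R v) - s *\<^sub>R ((t * t) *\<^sub>R g w)" for s
    define F' where "F' s = t *\<^sub>R f' (x + (s * t) *\<^sub>R v + t *\<^sub>R w) v - t *\<^sub>R f' (x + (s * t) *\<^sub>R v) v
      - (t * t) *\<^sub>R g w" for s
    have inS: "x + (s * t) *\<^sub>R v + (b * t) *\<^sub>R w \<in> S" if "0 \<le> s" "s \<le> 1" "b = 0 \<or> b = 1" for s b
      using nrm[OF that] tK r(2) by (auto simp: subset_iff dist_norm add.assoc norm_minus_commute)
    have der: "(F has_derivative (\<lambda>h. h *\<^sub>R F' s)) (at s)" if s: "0 \<le> s" "s \<le> 1" for s
    proof -
      have 1: "((\<lambda>s. f (x + (s * t) *\<^sub>R v + t *\<^sub>R w)) has_derivative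
          (\<lambda>h. f' (x + (s * t) *\<^sub>R v + t *\<^sub>R w) ((h * t) *\<^sub>R v))) (at s)"
        using inS[OF s, of 1]
        by (intro has_derivative_compose[where g = f, OF _ f']) (auto intro!: derivative_eq_intros)
      have 2: "((\<lambda>s. f (x + (s * t) *\<^sub>R v)) has_derivative
          (\<lambda>h. f' (x + (s * t) *\<^sub>R v) ((h * t) *\<^sub>R v))) (at s)"
        using inS[OF s, of 0]
        by (intro has_derivative_compose[where g = f, OF _ f']) (auto intro!: derivative_eq_intros)
      have l: "f' y (c *\<^sub>R u) = c *\<^sub>R f' y u" if "y \<in> S" for y c u
        using f'[OF that] has_derivative_linear linear_scale by blast
      have 3: "((\<lambda>s. s *\<^sub>R ((t * t) *\<^sub>R g w)) has_derivative (\<lambda>h. h *\<^sub>R ((t * t) *\<^sub>R g w))) (at s)"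
        by (auto intro!: derivative_eq_intros)
      show ?thesis
        unfolding F_def
        apply (rule has_derivative_eq_rhs[OF has_derivative_diff[OF has_derivative_diff[OF 1 2] 3]])
        using inS[OF s, of 0] inS[OF s, of 1]
        by (auto simp: F'_def l algebra_simps)
    qed
    have "continuous_on {0..1} F"
      using der by (meson atLeastAtMost_iff has_derivative_at_withinI has_derivative_continuous_on)
    then obtain s where s: "s \<in> {0<..<1}" "norm (F 1 - F 0) \<le> norm ((1 - 0) *\<^sub>R F' s)"
      using mvt_general[of 0 1 F "\<lambda>s h. h *\<^sub>R F' s"] der by auto
    let ?y1 = "x + (s * t) *\<^sub>R v + t *\<^sub>R w" and ?y0 = "x + (s * t) *\<^sub>R v"
    have n1: "norm (?y1 - x) \<le> t * K" using nrm[of s 1] s by (auto simp: add.assoc)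
    have n0: "norm (?y0 - x) \<le> t * K" using nrm[of s 0] s by auto
    have eK: "0 \<le> e / (2 * K)" using e K by simp
    have b1: "norm (f' ?y1 v - f' x v - g (?y1 - x)) \<le> (e / (2 * K)) * (t * K)"
      by (rule order_trans[OF d0(2)[OF le_less_trans[OF n1 tK(2)]] mult_left_mono[OF n1 eK]])
    have b0: "norm (f' ?y0 v - f' x v - g (?y0 - x)) \<le> (e / (2 * K)) * (t * K)"
      by (rule order_trans[OF d0(2)[OF le_less_trans[OF n0 tK(2)]] mult_left_mono[OF n0 eK]])
    have "g (?y1 - x) - g (?y0 - x) = t *\<^sub>R g w"
      using bl by (simp add: linear_simps)
    then have eq: "f' ?y1 v - f' ?y0 v - t *\<^sub>R g w
        = (f' ?y1 v - f' x v - g (?y1 - x)) - (f' ?y0 v - f' x v - g (?y0 - x))"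
      by (simp add: algebra_simps)
    have "norm (f' ?y1 v - f' ?y0 v - t *\<^sub>R g w) \<le> (e / (2 * K)) * (t * K) + (e / (2 * K)) * (t * K)"
      unfolding eq by (rule order_trans[OF norm_triangle_ineq4 add_mono[OF b1 b0]])
    also have "\<dots> = e * t" using K by (simp add: field_simps)
    finally have *: "norm (f' ?y1 v - f' ?y0 v - t *\<^sub>R g w) \<le> e * t" .
    have "F' s = t *\<^sub>R (f' ?y1 v - f' ?y0 v - t *\<^sub>R g w)"
      by (simp add: F'_def algebra_simps)
    then have "norm (F' s) \<le> e * (t * t)"
      using * t by (simp add: mult.left_commute)
    moreover have "F 1 - F 0 = f (x + t *\<^sub>R v + t *\<^sub>R w) - f (x + t *\<^sub>R v) - f (x + t *\<^sub>R w) + f x - (t * t) *\<^sub>R g w"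
      by (simp add: F_def)
    ultimately show ?thesis using s by simp
  qed
  ultimately show ?thesis by blast
qed

theorem second_derivative_symmetric:
  fixes f :: "'a::real_normed_vector \<Rightarrow> 'b::real_inner"
  assumes S: "open S" "x \<in> S"
    and f': "\<And>y. y \<in> S \<Longrightarrow> (f has_derivative f' y) (at y)"
    and f'': "\<And>v. ((\<lambda>y. f' y v) has_derivative f'' v) (at x)"
  shows "f'' v w = f'' w v"
proof -
  have "norm (f'' v w - f'' w v) \<le> 2 * e" if e: "e > 0" for e
  proof -
    obtain d1 where d1: "d1 > 0" "\<And>t. 0 < t \<Longrightarrow> t < d1 \<Longrightarrow>
      norm (f (x + t *\<^sub>R v + t *\<^sub>R w) - f (x + t *\<^sub>R v) - f (x + t *\<^sub>R w) + f x - (t * t) *\<^sub>R f'' v w)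
      \<le> e * (t * t)"
      using second_difference_bound[OF S f' f'' e, of v w] by auto
    obtain d2 where d2: "d2 > 0" "\<And>t. 0 < t \<Longrightarrow> t < d2 \<Longrightarrow>
      norm (f (x + t *\<^sub>R w + t *\<^sub>R v) - f (x + t *\<^sub>R w) - f (x + t *\<^sub>R v) + f x - (t * t) *\<^sub>R f'' w v)
      \<le> e * (t * t)"
      using second_difference_bound[OF S f' f'' e, of w v] by auto
    define t where "t = min d1 d2 / 2"
    have t: "0 < t" "t < d1" "t < d2" using d1 d2 by (auto simp: t_def)
    let ?a = "f (x + t *\<^sub>R v + t *\<^sub>R w) - f (x + t *\<^sub>R v) - f (x + t *\<^sub>R w) + f x"
    have 1: "norm (?a - (t * t) *\<^sub>R f'' v w) \<le> e * (t * t)" using d1 t by blast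
    have "x + t *\<^sub>R w + t *\<^sub>R v = x + t *\<^sub>R v + t *\<^sub>R w" by (simp add: algebra_simps)
    with d2(2)[OF t(1,3)] have 2: "norm (?a - (t * t) *\<^sub>R f'' w v) \<le> e * (t * t)"
      by (simp add: algebra_simps)
    have "(t * t) *\<^sub>R (f'' v w - f'' w v) = (?a - (t * t) *\<^sub>R f'' w v) - (?a - (t * t) *\<^sub>R f'' v w)"
      by (simp add: algebra_simps)
    then have "norm ((t * t) *\<^sub>R (f'' v w - f'' w v)) \<le> 2 * e * (t * t)"
      using order_trans[OF norm_triangle_ineq4 add_mono[OF 2 1]] by simp
    then have "(t * t) * norm (f'' v w - f'' w v) \<le> (t * t) * (2 * e)"
      by (simp add: mult.commute)
    then show ?thesis using t by simp
  qed
  note bound = this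
  have "norm (f'' v w - f'' w v) \<le> 0"
  proof (rule field_le_epsilon)
    fix e :: real assume "e > 0"
    then show "norm (f'' v w - f'' w v) \<le> 0 + e" using bound[of "e / 2"] by simp
  qed
  then show ?thesis by simp
qed

lemma linear_growth_zero:
  fixes y :: "real \<Rightarrow> 'a::real_inner"
  assumes y: "\<And>t. t \<in> {0..1} \<Longrightarrow> (y has_vector_derivative y' t) (at t within {0..1})"
    and b: "\<And>t. t \<in> {0..1} \<Longrightarrow> norm (y' t) \<le> K * norm (y t)"
    and y0: "y 0 = 0" and t: "t \<in> {0..1}"
  shows "y t = 0"
proof -
  define z where "z s = exp (- 2 * K * s) * (y s \<bullet> y s)" for s
  define z' where "z' s = exp (- 2 * K * s) * (2 * (y s \<bullet> y' s) - 2 * K * (y s \<bullet> y s))" for s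
  have zd: "(z has_real_derivative z' s) (at s within {0..1})" if "s \<in> {0..1}" for s
  proof -
    have 1: "((\<lambda>s. y s \<bullet> y s) has_vector_derivative (y s \<bullet> y' s + y' s \<bullet> y s)) (at s within {0..1})"
      by (rule bounded_bilinear.has_vector_derivative[OF bounded_bilinear_inner y[OF that] y[OF that]])
    then have 2: "((\<lambda>s. y s \<bullet> y s) has_real_derivative (2 * (y s \<bullet> y' s))) (at s within {0..1})"
      by (simp add: has_real_derivative_iff_has_vector_derivative inner_commute)
    show ?thesis
      unfolding z_def z'_def
      by (rule derivative_eq_intros 2 refl | simp add: algebra_simps)+
  qed
  have "z t \<le> z 0"
  proof (cases "t = 0")
    case False
    show ?thesis
    proof (rule DERIV_nonpos_imp_decreasing_open[of 0 t z])
      show "continuous_on {0..t} z"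
        by (rule continuous_on_subset[OF DERIV_continuous_on[OF zd]]) (use t in auto)
      fix s assume s: "0 < s" "s < t"
      then have s': "s \<in> {0..1}" using t by auto
      have "(z has_real_derivative z' s) (at s)"
        using zd[OF s'] at_within_interior[of s "{0..1::real}"] s t by simp
      moreover have "y s \<bullet> y' s \<le> K * (y s \<bullet> y s)"
        using b[OF s'] norm_cauchy_schwarz[of "y s" "y' s"] mult_left_mono[OF b[OF s'], of "norm (y s)"]
        by (simp add: power2_norm_eq_inner[symmetric] power2_eq_square mult_ac)
      then have "z' s \<le> 0" by (simp add: z'_def mult_nonneg_nonpos)
      ultimately show "\<exists>y. (z has_real_derivative y) (at s) \<and> y \<le> 0" by blast
    qed (use t False in auto)
  qed auto
  then have "exp (- 2 * K * t) * (y t \<bullet> y t) \<le> 0" by (simp add: z_def y0)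
  then have "y t \<bullet> y t \<le> 0" by (simp add: mult_le_0_iff)
  then show ?thesis by (metis inner_ge_zero inner_eq_zero_iff order_antisym)
qed

section \<open>Calculus along a surface\<close>

lemma linear_Basis_expansion:
  fixes f :: "'a::euclidean_space \<Rightarrow> 'b::real_vector"
  assumes "linear f"
  shows "f x = (\<Sum>b\<in>Basis. (x \<bullet> b) *\<^sub>R f b)"
  by (metis (no_types, lifting) assms euclidean_representation linear_scale linear_sum sum.cong)

lemma smooth_on_twice_derivative:
  assumes "smooth_on S f"
  obtains f' f'' where "\<And>x. x \<in> S \<Longrightarrow> (f has_derivative f' x) (at x)"
    and "\<And>x v. x \<in> S \<Longrightarrow> ((\<lambda>x. f' x v) has_derivative f'' v x) (at x)"
proof -
  have "Ck_on (Suc (Suc 0)) S f" using assms smooth_on_def by blast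
  then obtain f' where f': "\<forall>x\<in>S. (f has_derivative f' x) (at x)"
    "\<forall>v. \<exists>g. \<forall>x\<in>S. ((\<lambda>x. f' x v) has_derivative g x) (at x)"
    unfolding Ck_on.simps by metis
  from f'(2) obtain f'' where "\<forall>v. \<forall>x\<in>S. ((\<lambda>x. f' x v) has_derivative f'' v x) (at x)"
    by metis
  with f'(1) that show ?thesis by blast
qed

lemma second_derivative_bilinear:
  fixes f :: "'a::euclidean_space \<Rightarrow> 'b::euclidean_space"
  assumes S: "open S" "x \<in> S"
    and f': "\<And>y. y \<in> S \<Longrightarrow> (f has_derivative f' y) (at y)"
    and f'': "\<And>v. ((\<lambda>y. f' y v) has_derivative f'' v) (at x)"
  shows "bilinear f''"
  unfolding bilinear_def
  using second_derivative_symmetric[OF S f' f''] has_derivative_linear[OF f'']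
  by (metis (full_types) ext)

lemma has_derivative_apply_field:
  fixes f :: "'a::euclidean_space \<Rightarrow> 'b::euclidean_space"
  assumes S: "open S" "x \<in> S"
    and f': "\<And>y. y \<in> S \<Longrightarrow> (f has_derivative f' y) (at y)"
    and f'': "\<And>v. ((\<lambda>y. f' y v) has_derivative f'' v) (at x)"
    and Y: "(Y has_derivative Y') (at x within M)" and x: "x \<in> M"
  shows "((\<lambda>y. f' y (Y y)) has_derivative (\<lambda>w. f'' (Y x) w + f' x (Y' w))) (at x within M)"
proof -
  have 1: "((\<lambda>y. \<Sum>b\<in>Basis. (Y y \<bullet> b) *\<^sub>R f' y b) has_derivative
      (\<lambda>w. \<Sum>b\<in>Basis. (Y x \<bullet> b) *\<^sub>R f'' b w + (Y' w \<bullet> b) *\<^sub>R f' x b)) (at x within M)"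
    by (rule has_derivative_sum, rule has_derivative_scaleR[OF has_derivative_inner_left[OF Y]
        has_derivative_at_withinI[OF f'']])
  have bl: "linear (\<lambda>v. f'' v w)" for w
    using second_derivative_bilinear[OF S f' f''] by (simp add: bilinear_def)
  have lin: "linear (f' y)" if "y \<in> S" for y using f'[OF that] has_derivative_linear by blast
  have "(\<lambda>w. \<Sum>b\<in>Basis. (Y x \<bullet> b) *\<^sub>R f'' b w + (Y' w \<bullet> b) *\<^sub>R f' x b)
      = (\<lambda>w. f'' (Y x) w + f' x (Y' w))"
    by (simp add: sum.distrib linear_Basis_expansion[OF bl, symmetric]
        linear_Basis_expansion[OF lin[OF S(2)], symmetric])
  with 1 have 2: "((\<lambda>y. \<Sum>b\<in>Basis. (Y y \<bullet> b) *\<^sub>R f' y b) has_derivative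
      (\<lambda>w. f'' (Y x) w + f' x (Y' w))) (at x within M)" by simp
  obtain d where d: "d > 0" "ball x d \<subseteq> S" using S open_contains_ball by blast
  show ?thesis
  proof (rule has_derivative_transform_within[OF 2 d(1) x])
    fix y assume "dist y x < d"
    then have "y \<in> S" using d by (auto simp: dist_commute)
    then show "(\<Sum>b\<in>Basis. (Y y \<bullet> b) *\<^sub>R f' y b) = f' y (Y y)"
      by (rule linear_Basis_expansion[OF lin, symmetric])
  qed
qed

lemma has_derivative_cong_within_open:
  assumes "(f has_derivative f') (at p within M)" "open W" "p \<in> W" "p \<in> M"
    and "\<And>q. q \<in> M \<Longrightarrow> q \<in> W \<Longrightarrow> f q = g q"
  shows "(g has_derivative f') (at p within M)"
proof -
  obtain d where d: "d > 0" "ball p d \<subseteq> W" using assms(2,3) open_contains_ball by blast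
  show ?thesis
    by (rule has_derivative_transform_within[OF assms(1) d(1) assms(4)])
      (use d assms(5) in \<open>auto simp: dist_commute subset_iff\<close>)
qed

lemma tangent_derivative_unique:
  fixes f :: "r4 \<Rightarrow> 'b::euclidean_space"
  assumes f: "(f has_derivative f') (at p within M)" and g: "(f has_derivative g) (at p within M)"
    and v: "v \<in> tangent_space M p"
  shows "f' v = g v"
proof -
  obtain c e where c: "c 0 = p" "(c has_vector_derivative v) (at 0)" "e > 0"
    "\<And>t. \<bar>t\<bar> < e \<Longrightarrow> c t \<in> M"
    using v unfolding tangent_space_def by blast
  have cv: "(c has_vector_derivative v) (at 0 within {-e<..<e})"
    by (rule has_vector_derivative_at_within[OF c(2)])
  have sub: "c ` {-e<..<e} \<subseteq> M" using c(4) by auto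
  have "((f \<circ> c) has_vector_derivative h v) (at 0)" if "(f has_derivative h) (at p within M)" for h
  proof -
    have "(f has_derivative h) (at (c 0) within c ` {-e<..<e})"
      using has_derivative_subset[OF that sub] c(1) by simp
    then have "((f \<circ> c) has_vector_derivative h v) (at 0 within {-e<..<e})"
      by (rule vector_derivative_diff_chain_within[OF cv])
    then show ?thesis using at_within_open[of 0 "{-e<..<e}"] c(3) by simp
  qed
  from this[OF f] this[OF g] show ?thesis by (rule vector_derivative_unique_at)
qed

lemma D_has_derivative:
  "f differentiable (at p within M) \<Longrightarrow> (f has_derivative D M f p) (at p within M)"
  using frechet_derivative_works[of f "at p within M"] by (simp add: D_def[abs_def])

lemma D_eq:
  assumes "(f has_derivative f') (at p within M)" "v \<in> tangent_space M p"
  shows "D M f p v = f' v"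
  using tangent_derivative_unique[OF D_has_derivative assms(1,2)] assms(1)
  unfolding differentiable_def by blast

lemma D_linear: "f differentiable (at p within M) \<Longrightarrow> linear (D M f p)"
  using D_has_derivative has_derivative_linear by blast

lemma smooth_along_extension:
  fixes f :: "r4 \<Rightarrow> 'b::euclidean_space"
  assumes U: "openin (top_of_set M) U" and f: "smooth_along U f" and p: "p \<in> U"
  obtains W F F' F'' where "open W" "p \<in> W" "M \<inter> W \<subseteq> U"
    and "\<And>q. q \<in> M \<Longrightarrow> q \<in> W \<Longrightarrow> F q = f q"
    and "\<And>q. q \<in> W \<Longrightarrow> (F has_derivative F' q) (at q)"
    and "\<And>q v. q \<in> W \<Longrightarrow> ((\<lambda>q. F' q v) has_derivative F'' v q) (at q)"
proof -
  obtain W F where W: "open W" "p \<in> W" "smooth_on W F" "\<forall>q\<in>U \<inter> W. F q = f q"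
    using f p unfolding smooth_along_def by blast
  obtain Q where Q: "open Q" "U = M \<inter> Q" using U openin_open by blast
  obtain F' F'' where F: "\<And>q. q \<in> W \<Longrightarrow> (F has_derivative F' q) (at q)"
    "\<And>q v. q \<in> W \<Longrightarrow> ((\<lambda>q. F' q v) has_derivative F'' v q) (at q)"
    by (rule smooth_on_twice_derivative[OF W(3)]) (rule that)
  show ?thesis
    by (rule that[of "W \<inter> Q" F F' F'']) (use W Q F p in auto)
qed

lemma openin_surface_subset: "openin (top_of_set M) U \<Longrightarrow> p \<in> U \<Longrightarrow> p \<in> M"
  using openin_imp_subset by blast

lemma smooth_along_differentiable:
  fixes f :: "r4 \<Rightarrow> 'b::euclidean_space"
  assumes "openin (top_of_set M) U" "smooth_along U f" "p \<in> U"
  shows "f differentiable (at p within M)"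
proof -
  obtain W F F' F'' where W: "open W" "p \<in> W" "M \<inter> W \<subseteq> U"
    "\<And>q. q \<in> M \<Longrightarrow> q \<in> W \<Longrightarrow> F q = f q"
    "\<And>q. q \<in> W \<Longrightarrow> (F has_derivative F' q) (at q)"
    "\<And>q v. q \<in> W \<Longrightarrow> ((\<lambda>q. F' q v) has_derivative F'' v q) (at q)"
    by (rule smooth_along_extension[OF assms]) (rule that)
  have "(f has_derivative F' p) (at p within M)"
    by (rule has_derivative_cong_within_open[OF has_derivative_at_withinI[OF W(5)[OF W(2)]] W(1,2)
        openin_surface_subset[OF assms(1,3)] W(4)])
  then show ?thesis unfolding differentiable_def by blast
qed

lemma D_along_field:
  fixes f :: "r4 \<Rightarrow> 'b::euclidean_space"
  assumes U: "openin (top_of_set M) U" and f: "smooth_along U f" and p: "p \<in> U"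
  obtains A B where "linear A" "bilinear B" "\<And>v w. B v w = B w v"
    and "\<And>v. v \<in> tangent_space M p \<Longrightarrow> D M f p v = A v"
    and "\<And>Y. (\<And>q. q \<in> U \<Longrightarrow> Y q \<in> tangent_space M q) \<Longrightarrow> Y differentiable (at p within M) \<Longrightarrow>
        ((\<lambda>q. D M f q (Y q)) has_derivative (\<lambda>w. B (Y p) w + A (D M Y p w))) (at p within M)"
proof -
  obtain W F F' F'' where W: "open W" "p \<in> W" "M \<inter> W \<subseteq> U"
    and Ff: "\<And>q. q \<in> M \<Longrightarrow> q \<in> W \<Longrightarrow> F q = f q"
    and F': "\<And>q. q \<in> W \<Longrightarrow> (F has_derivative F' q) (at q)"
    and F'': "\<And>q v. q \<in> W \<Longrightarrow> ((\<lambda>q. F' q v) has_derivative F'' v q) (at q)"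
    by (rule smooth_along_extension[OF assms]) (rule that)
  have pM: "p \<in> M" using U p openin_surface_subset by blast
  have der: "(f has_derivative F' q) (at q within M)" if "q \<in> M" "q \<in> W" for q
    by (rule has_derivative_cong_within_open[OF has_derivative_at_withinI[OF F'[OF that(2)]] W(1) that(2,1) Ff])
  show ?thesis
  proof (rule that[of "F' p" "\<lambda>v. F'' v p"])
    show "linear (F' p)" using F' W(2) has_derivative_linear by blast
    show "bilinear (\<lambda>v. F'' v p)"
      by (rule second_derivative_bilinear[OF W(1,2) F' F''[OF W(2)]])
    show "F'' v p w = F'' w p v" for v w
      by (rule second_derivative_symmetric[OF W(1,2) F' F''[OF W(2)]])
    show "D M f p v = F' p v" if "v \<in> tangent_space M p" for v
      by (rule D_eq[OF der[OF pM W(2)] that])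
    fix Y assume Y: "\<And>q. q \<in> U \<Longrightarrow> Y q \<in> tangent_space M q" "Y differentiable (at p within M)"
    show "((\<lambda>q. D M f q (Y q)) has_derivative (\<lambda>w. F'' (Y p) p w + F' p (D M Y p w))) (at p within M)"
    proof (rule has_derivative_cong_within_open[OF _ W(1,2) pM])
      show "((\<lambda>q. F' q (Y q)) has_derivative (\<lambda>w. F'' (Y p) p w + F' p (D M Y p w))) (at p within M)"
        by (rule has_derivative_apply_field[OF W(1,2) F' F''[OF W(2)] D_has_derivative[OF Y(2)] pM])
      show "F' q (Y q) = D M f q (Y q)" if "q \<in> M" "q \<in> W" for q
        using D_eq[OF der[OF that]] Y(1) W(3) that by fastforce
    qed
  qed
qed

section \<open>Charts, retractions and the second fundamental form\<close>

lemma tangent_space_chart: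
  fixes \<phi> :: "real^2 \<Rightarrow> r4"
  assumes o: "open W" "open V" and im: "\<phi> ` V = M \<inter> W" and inv: "\<And>u. u \<in> V \<Longrightarrow> \<psi> (\<phi> u) = u"
    and \<phi>': "\<And>u. u \<in> V \<Longrightarrow> (\<phi> has_derivative \<phi>' u) (at u)"
    and \<psi>': "\<And>q. q \<in> W \<Longrightarrow> (\<psi> has_derivative \<psi>' q) (at q)"
    and u: "u \<in> V"
  shows "tangent_space M (\<phi> u) = range (\<phi>' u)" and "inj (\<phi>' u)"
proof -
  have \<phi>u: "\<phi> u \<in> W" "\<phi> u \<in> M" using im u by auto
  have "((\<psi> \<circ> \<phi>) has_derivative (\<psi>' (\<phi> u) \<circ> \<phi>' u)) (at u)"
    by (rule diff_chain_at[OF \<phi>'[OF u] \<psi>'[OF \<phi>u(1)]])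
  then have "((\<lambda>u. u) has_derivative (\<psi>' (\<phi> u) \<circ> \<phi>' u)) (at u)"
    by (rule has_derivative_transform_within_open[OF _ o(2) u]) (simp add: inv)
  then have "\<psi>' (\<phi> u) \<circ> \<phi>' u = (\<lambda>x. x)"
    using has_derivative_ident has_derivative_unique by blast
  then show "inj (\<phi>' u)" by (metis inj_on_id2 inj_on_imageI2)
  show "tangent_space M (\<phi> u) = range (\<phi>' u)"
  proof (intro equalityI subsetI)
    fix v assume "v \<in> tangent_space M (\<phi> u)"
    then obtain c e where c: "c 0 = \<phi> u" "(c has_vector_derivative v) (at 0)" "e > 0"
      "\<And>t. \<bar>t\<bar> < e \<Longrightarrow> c t \<in> M"
      unfolding tangent_space_def by blast
    obtain \<rho> where \<rho>: "\<rho> > 0" "ball (c 0) \<rho> \<subseteq> W"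
      using o(1) \<phi>u(1) c(1) open_contains_ball by metis
    have "continuous (at 0) c" using c(2) has_vector_derivative_continuous by blast
    then obtain d where d0: "d > 0" "\<And>t. dist t 0 < d \<Longrightarrow> dist (c t) (c 0) < \<rho>"
      using \<rho>(1) unfolding continuous_at_eps_delta by blast
    then have d: "d > 0" "\<And>t. \<bar>t\<bar> < d \<Longrightarrow> c t \<in> W"
      using \<rho>(2) by (auto simp: subset_iff dist_commute)
    have "((\<psi> \<circ> c) has_vector_derivative \<psi>' (\<phi> u) v) (at 0)"
      by (rule vector_derivative_diff_chain_within[OF c(2)])
        (use has_derivative_at_withinI[OF \<psi>'[OF \<phi>u(1)]] c(1) in simp)
    then have "((\<phi> \<circ> (\<psi> \<circ> c)) has_vector_derivative \<phi>' u (\<psi>' (\<phi> u) v)) (at 0)"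
      by (rule vector_derivative_diff_chain_within)
        (use has_derivative_at_withinI[OF \<phi>'[OF u]] c(1) inv[OF u] in simp)
    then have "(c has_vector_derivative \<phi>' u (\<psi>' (\<phi> u) v)) (at 0)"
    proof (rule has_vector_derivative_transform_within_open[of _ _ _ "ball 0 (min d e)"])
      fix t :: real assume "t \<in> ball 0 (min d e)"
      then have "c t \<in> M \<inter> W" using d c by (auto simp: dist_real_def)
      then obtain u' where "u' \<in> V" "c t = \<phi> u'" using im by blast
      then show "(\<phi> \<circ> (\<psi> \<circ> c)) t = c t" using inv by simp
    qed (use c d in auto)
    then have "v = \<phi>' u (\<psi>' (\<phi> u) v)" using c(2) vector_derivative_unique_at by blast
    then show "v \<in> range (\<phi>' u)" by blast
  next
    fix v assume "v \<in> range (\<phi>' u)"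
    then obtain w where w: "v = \<phi>' u w" by blast
    obtain r where r: "r > 0" "ball u r \<subseteq> V" using o(2) u open_contains_ball by blast
    have 1: "((\<lambda>t. u + t *\<^sub>R w) has_vector_derivative w) (at 0)"
      by (auto intro!: derivative_eq_intros)
    have "((\<phi> \<circ> (\<lambda>t. u + t *\<^sub>R w)) has_vector_derivative v) (at 0)"
      unfolding w by (rule vector_derivative_diff_chain_within[OF 1])
        (use has_derivative_at_withinI[OF \<phi>'[OF u]] in simp)
    moreover have "\<phi> (u + t *\<^sub>R w) \<in> M" if "\<bar>t\<bar> < r / (norm w + 1)" for t
    proof -
      have "\<bar>t\<bar> * norm w \<le> \<bar>t\<bar> * (norm w + 1)" by (simp add: mult_left_mono)
      also have "\<dots> < r" using that by (simp add: pos_less_divide_eq add_nonneg_pos)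
      finally have "u + t *\<^sub>R w \<in> ball u r" by (simp add: dist_norm)
      then show ?thesis using r im by blast
    qed
    moreover have "r / (norm w + 1) > 0" using r by (simp add: add_nonneg_pos)
    ultimately show "v \<in> tangent_space M (\<phi> u)"
      unfolding tangent_space_def by (auto intro!: exI[of _ "\<phi> \<circ> (\<lambda>t. u + t *\<^sub>R w)"])
  qed
qed

lemma surface_chart:
  assumes "smooth_surface M" "p \<in> M"
  obtains W V and \<phi> :: "real^2 \<Rightarrow> r4" and \<psi> \<phi>' \<phi>'' \<psi>' \<psi>''
  where "open W" "p \<in> W" "open V" "\<phi> ` V = M \<inter> W" "\<And>u. u \<in> V \<Longrightarrow> \<psi> (\<phi> u) = u"
    "\<And>u. u \<in> V \<Longrightarrow> (\<phi> has_derivative \<phi>' u) (at u)"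
    "\<And>u v. u \<in> V \<Longrightarrow> ((\<lambda>u. \<phi>' u v) has_derivative \<phi>'' v u) (at u)"
    "\<And>q. q \<in> W \<Longrightarrow> (\<psi> has_derivative \<psi>' q) (at q)"
    "\<And>q v. q \<in> W \<Longrightarrow> ((\<lambda>q. \<psi>' q v) has_derivative \<psi>'' v q) (at q)"
    "\<And>u. u \<in> V \<Longrightarrow> tangent_space M (\<phi> u) = range (\<phi>' u)" "\<And>u. u \<in> V \<Longrightarrow> inj (\<phi>' u)"
proof -
  from assms have "\<exists>W (V :: (real^2) set) \<phi> \<psi>. open W \<and> p \<in> W \<and> open V \<and> smooth_on V \<phi> \<and>
      smooth_on W \<psi> \<and> \<phi> ` V = M \<inter> W \<and> (\<forall>u\<in>V. \<psi> (\<phi> u) = u)"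
    unfolding smooth_surface_def by (rule bspec)
  then obtain W V and \<phi> :: "real^2 \<Rightarrow> r4" and \<psi> where *: "open W" "p \<in> W" "open V"
    "smooth_on V \<phi>" "smooth_on W \<psi>" "\<phi> ` V = M \<inter> W" "\<forall>u\<in>V. \<psi> (\<phi> u) = u"
    by (elim exE conjE) (rule that)
  obtain \<phi>' \<phi>'' where \<phi>: "\<And>u. u \<in> V \<Longrightarrow> (\<phi> has_derivative \<phi>' u) (at u)"
    "\<And>u v. u \<in> V \<Longrightarrow> ((\<lambda>u. \<phi>' u v) has_derivative \<phi>'' v u) (at u)"
    by (rule smooth_on_twice_derivative[OF *(4)]) (rule that)
  obtain \<psi>' \<psi>'' where \<psi>: "\<And>q. q \<in> W \<Longrightarrow> (\<psi> has_derivative \<psi>' q) (at q)"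
    "\<And>q v. q \<in> W \<Longrightarrow> ((\<lambda>q. \<psi>' q v) has_derivative \<psi>'' v q) (at q)"
    by (rule smooth_on_twice_derivative[OF *(5)]) (rule that)
  have inv: "\<And>u. u \<in> V \<Longrightarrow> \<psi> (\<phi> u) = u" using *(7) by blast
  show ?thesis
    by (rule that[OF *(1-3,6) inv \<phi> \<psi> tangent_space_chart[OF *(1,3,6) inv \<phi>(1) \<psi>(1)]])
qed

lemma tangent_space_plane:
  assumes "smooth_surface M" "p \<in> M"
  shows "subspace (tangent_space M p)" and "dim (tangent_space M p) = 2"
proof -
  obtain W V and \<phi> :: "real^2 \<Rightarrow> r4" and \<psi> \<phi>' \<phi>'' \<psi>' \<psi>''
    where c: "open W" "p \<in> W" "open V" "\<phi> ` V = M \<inter> W" "\<And>u. u \<in> V \<Longrightarrow> \<psi> (\<phi> u) = u"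
    "\<And>u. u \<in> V \<Longrightarrow> (\<phi> has_derivative \<phi>' u) (at u)"
    "\<And>u v. u \<in> V \<Longrightarrow> ((\<lambda>u. \<phi>' u v) has_derivative \<phi>'' v u) (at u)"
    "\<And>q. q \<in> W \<Longrightarrow> (\<psi> has_derivative \<psi>' q) (at q)"
    "\<And>q v. q \<in> W \<Longrightarrow> ((\<lambda>q. \<psi>' q v) has_derivative \<psi>'' v q) (at q)"
    "\<And>u. u \<in> V \<Longrightarrow> tangent_space M (\<phi> u) = range (\<phi>' u)" "\<And>u. u \<in> V \<Longrightarrow> inj (\<phi>' u)"
    by (rule surface_chart[OF assms]) (rule that)
  obtain u where u: "u \<in> V" "p = \<phi> u" using c(2,4) assms(2) by blast
  have l: "linear (\<phi>' u)" using c(6)[OF u(1)] has_derivative_linear by blast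
  show "subspace (tangent_space M p)"
    using c(10)[OF u(1)] u(2) l linear_subspace_image subspace_UNIV by metis
  show "dim (tangent_space M p) = 2"
    using c(10)[OF u(1)] u(2) dim_image_eq[OF l, of UNIV] c(11)[OF u(1)] by simp
qed

lemma second_fundamental_form:
  assumes "smooth_surface M" "p \<in> M"
  obtains B where "bilinear B" "\<And>v w. B v w = B w v"
    and "\<And>U Y v. openin (top_of_set M) U \<Longrightarrow> p \<in> U \<Longrightarrow> (\<And>q. q \<in> U \<Longrightarrow> Y q \<in> tangent_space M q) \<Longrightarrow>
      Y differentiable (at p within M) \<Longrightarrow> v \<in> tangent_space M p \<Longrightarrow>
      D M Y p v - B v (Y p) \<in> tangent_space M p"
proof -
  obtain W V and \<phi> :: "real^2 \<Rightarrow> r4" and \<psi> \<phi>' \<phi>'' \<psi>' \<psi>''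
    where c: "open W" "p \<in> W" "open V" "\<phi> ` V = M \<inter> W" "\<And>u. u \<in> V \<Longrightarrow> \<psi> (\<phi> u) = u"
    and \<phi>: "\<And>u. u \<in> V \<Longrightarrow> (\<phi> has_derivative \<phi>' u) (at u)"
    "\<And>u v. u \<in> V \<Longrightarrow> ((\<lambda>u. \<phi>' u v) has_derivative \<phi>'' v u) (at u)"
    and \<psi>: "\<And>q. q \<in> W \<Longrightarrow> (\<psi> has_derivative \<psi>' q) (at q)"
    "\<And>q v. q \<in> W \<Longrightarrow> ((\<lambda>q. \<psi>' q v) has_derivative \<psi>'' v q) (at q)"
    and T: "\<And>u. u \<in> V \<Longrightarrow> tangent_space M (\<phi> u) = range (\<phi>' u)" "\<And>u. u \<in> V \<Longrightarrow> inj (\<phi>' u)"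
    by (rule surface_chart[OF assms]) (rule that)
  define W1 where "W1 = W \<inter> \<psi> -` V"
  have "continuous_on W \<psi>"
    by (rule has_derivative_continuous_on[OF has_derivative_at_withinI[OF \<psi>(1)]])
  then have W1: "open W1"
    unfolding W1_def using c(1,3) continuous_on_open_vimage by (metis Int_commute)
  have ch: "\<psi> q \<in> V \<and> \<phi> (\<psi> q) = q" if "q \<in> M" "q \<in> W" for q
  proof -
    have "q \<in> \<phi> ` V" using that c(4) by blast
    then show ?thesis using c(5) by auto
  qed
  have pW: "p \<in> W1" using ch assms(2) c(2) by (simp add: W1_def)
  define r where "r = \<phi> \<circ> \<psi>"
  define r' where "r' q v = \<phi>' (\<psi> q) (\<psi>' q v)" for q v
  define B where "B v w = \<phi>'' (\<psi>' p v) (\<psi> p) (\<psi>' p w) + \<phi>' (\<psi> p) (\<psi>'' v p w)" for v w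
  have r1: "(r has_derivative r' q) (at q)" if "q \<in> W1" for q
    unfolding r_def r'_def comp_def
    by (rule has_derivative_compose[OF \<psi>(1) \<phi>(1)]) (use that in \<open>auto simp: W1_def\<close>)
  have r2: "((\<lambda>q. r' q v) has_derivative B v) (at p)" for v
  proof -
    have pV: "\<psi> p \<in> V" using pW by (simp add: W1_def)
    have lin: "linear (\<phi>' u)" if "u \<in> V" for u using \<phi>(1)[OF that] has_derivative_linear by blast
    have bil: "linear (\<lambda>v. \<phi>'' v (\<psi> p) w)" for w
      using second_derivative_bilinear[OF c(3) pV \<phi>(1) \<phi>(2)[OF pV]] by (simp add: bilinear_def)
    have 1: "((\<lambda>q. \<Sum>b\<in>Basis. (\<psi>' q v \<bullet> b) *\<^sub>R \<phi>' (\<psi> q) b) has_derivative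
       (\<lambda>w. \<Sum>b\<in>Basis. (\<psi>' p v \<bullet> b) *\<^sub>R \<phi>'' b (\<psi> p) (\<psi>' p w) + (\<psi>'' v p w \<bullet> b) *\<^sub>R \<phi>' (\<psi> p) b)) (at p)"
      by (rule has_derivative_sum, rule has_derivative_scaleR[OF has_derivative_inner_left[OF \<psi>(2)[OF c(2)]]
          has_derivative_compose[OF \<psi>(1)[OF c(2)] \<phi>(2)[OF pV]]])
    have "((\<lambda>q. r' q v) has_derivative
       (\<lambda>w. \<Sum>b\<in>Basis. (\<psi>' p v \<bullet> b) *\<^sub>R \<phi>'' b (\<psi> p) (\<psi>' p w) + (\<psi>'' v p w \<bullet> b) *\<^sub>R \<phi>' (\<psi> p) b)) (at p)"
      by (rule has_derivative_transform_within_open[OF 1 W1 pW])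
        (simp add: W1_def r'_def linear_Basis_expansion[OF lin, symmetric])
    moreover have "(\<lambda>w. \<Sum>b\<in>Basis. (\<psi>' p v \<bullet> b) *\<^sub>R \<phi>'' b (\<psi> p) (\<psi>' p w) + (\<psi>'' v p w \<bullet> b) *\<^sub>R \<phi>' (\<psi> p) b)
        = B v"
      by (simp add: sum.distrib B_def fun_eq_iff linear_Basis_expansion[OF bil, symmetric]
          linear_Basis_expansion[OF lin[OF pV], symmetric])
    ultimately show ?thesis by simp
  qed
  have rT: "r' q v \<in> tangent_space M q" if "q \<in> M" "q \<in> W" for q v
    using T(1)[of "\<psi> q"] ch[OF that] by (auto simp: r'_def)
  have rid: "r' q v = v" if q: "q \<in> M" "q \<in> W1" and v: "v \<in> tangent_space M q" for q v
  proof -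
    have "((\<lambda>q. q) has_derivative r' q) (at q within M)"
      by (rule has_derivative_cong_within_open[OF has_derivative_at_withinI[OF r1[OF q(2)]] W1 q(2,1)])
        (use ch in \<open>auto simp: r_def W1_def\<close>)
    then show ?thesis using tangent_derivative_unique[OF _ has_derivative_ident v] by blast
  qed
  show ?thesis
  proof (rule that[of B])
    show "bilinear B" by (rule second_derivative_bilinear[OF W1 pW r1 r2])
    show sym: "B v w = B w v" for v w by (rule second_derivative_symmetric[OF W1 pW r1 r2])
    fix U Y v
    assume U: "openin (top_of_set M) U" "p \<in> U" and Y: "\<And>q. q \<in> U \<Longrightarrow> Y q \<in> tangent_space M q"
      "Y differentiable (at p within M)" and v: "v \<in> tangent_space M p"
    obtain Q where Q: "open Q" "U = M \<inter> Q" using U openin_open by blast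
    have "((\<lambda>q. r' q (Y q)) has_derivative (\<lambda>w. B (Y p) w + r' p (D M Y p w))) (at p within M)"
      by (rule has_derivative_apply_field[OF W1 pW r1 r2 D_has_derivative[OF Y(2)] assms(2)])
    then have "(Y has_derivative (\<lambda>w. B (Y p) w + r' p (D M Y p w))) (at p within M)"
      by (rule has_derivative_cong_within_open[OF _ open_Int[OF W1 Q(1)] _ assms(2)])
        (use pW U Q Y(1) rid in auto)
    from D_eq[OF this v] have "D M Y p v - B v (Y p) = r' p (D M Y p v)"
      unfolding sym[of v "Y p"] by (metis add_diff_cancel_left')
    then show "D M Y p v - B v (Y p) \<in> tangent_space M p" using rT assms(2) c(2) by simp
  qed
qed

lemma surface_local_curves:
  assumes "smooth_surface M" "p \<in> M" and "open Q" "p \<in> Q"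
  obtains N where "open N" "p \<in> N" "N \<subseteq> Q"
    and "\<And>q q'. q \<in> M \<inter> N \<Longrightarrow> q' \<in> M \<inter> N \<Longrightarrow>
      \<exists>c c'. c 0 = q \<and> c 1 = q' \<and> continuous_on {0..1} c' \<and>
        (\<forall>t\<in>{0..1::real}. c t \<in> M \<inter> N \<and> c' t \<in> tangent_space M (c t) \<and>
           (c has_vector_derivative c' t) (at t within {0..1}))"
proof -
  obtain W V and \<phi> :: "real^2 \<Rightarrow> r4" and \<psi> \<phi>' \<phi>'' \<psi>' \<psi>''
    where c: "open W" "p \<in> W" "open V" "\<phi> ` V = M \<inter> W" "\<And>u. u \<in> V \<Longrightarrow> \<psi> (\<phi> u) = u"
    and \<phi>: "\<And>u. u \<in> V \<Longrightarrow> (\<phi> has_derivative \<phi>' u) (at u)"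
    "\<And>u v. u \<in> V \<Longrightarrow> ((\<lambda>u. \<phi>' u v) has_derivative \<phi>'' v u) (at u)"
    and \<psi>: "\<And>q. q \<in> W \<Longrightarrow> (\<psi> has_derivative \<psi>' q) (at q)"
    "\<And>q v. q \<in> W \<Longrightarrow> ((\<lambda>q. \<psi>' q v) has_derivative \<psi>'' v q) (at q)"
    and T: "\<And>u. u \<in> V \<Longrightarrow> tangent_space M (\<phi> u) = range (\<phi>' u)" "\<And>u. u \<in> V \<Longrightarrow> inj (\<phi>' u)"
    by (rule surface_chart[OF assms(1,2)]) (rule that)
  have ch: "\<psi> q \<in> V \<and> \<phi> (\<psi> q) = q" if "q \<in> M" "q \<in> W" for q
  proof -
    have "q \<in> \<phi> ` V" using that c(4) by blast
    then show ?thesis using c(5) by auto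
  qed
  have "continuous_on W \<psi>"
    by (rule has_derivative_continuous_on[OF has_derivative_at_withinI[OF \<psi>(1)]])
  have c\<phi>: "continuous_on V \<phi>"
    by (rule has_derivative_continuous_on[OF has_derivative_at_withinI[OF \<phi>(1)]])
  have "open (\<phi> -` Q \<inter> V)" using c\<phi> c(3) assms(3) continuous_on_open_vimage by blast
  moreover have "\<psi> p \<in> \<phi> -` Q \<inter> V" using ch[OF assms(2) c(2)] assms(4) by simp
  ultimately obtain r where r: "r > 0" "ball (\<psi> p) r \<subseteq> \<phi> -` Q \<inter> V"
    using open_contains_ball by blast
  define N where "N = (\<psi> -` ball (\<psi> p) r \<inter> W) \<inter> Q"
  have "open (\<psi> -` ball (\<psi> p) r \<inter> W)"
    using \<open>continuous_on W \<psi>\<close> c(1) continuous_on_open_vimage open_ball by blast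
  then have oN: "open N" unfolding N_def using assms(3) by blast
  show ?thesis
  proof (rule that[OF oN])
    show "p \<in> N" using r(1) c(2) assms(4) by (simp add: N_def)
    show "N \<subseteq> Q" by (simp add: N_def)
    fix q q' assume q: "q \<in> M \<inter> N" "q' \<in> M \<inter> N"
    define d where "d = \<psi> q' - \<psi> q"
    define u where "u t = \<psi> q + t *\<^sub>R d" for t :: real
    have uB: "u t \<in> ball (\<psi> p) r" if "t \<in> {0..1}" for t
    proof -
      have "u t = (1 - t) *\<^sub>R \<psi> q + t *\<^sub>R \<psi> q'" by (simp add: u_def d_def algebra_simps)
      then show ?thesis
        using convexD[OF convex_ball, of "\<psi> q" "\<psi> p" r "\<psi> q'" "1 - t" t] q that by (auto simp: N_def)
    qed
    have uV: "u t \<in> V" "\<phi> (u t) \<in> Q" if "t \<in> {0..1}" for t using uB[OF that] r by auto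
    have du: "(u has_vector_derivative d) (at t within {0..1})" for t
      unfolding u_def by (auto intro!: derivative_eq_intros)
    have cu: "continuous_on {0..1} u" by (rule continuous_on_vector_derivative[OF du])
    have "continuous_on V (\<lambda>x. \<phi>' x d)"
      by (rule has_derivative_continuous_on[OF has_derivative_at_withinI[OF \<phi>(2)]])
    then have cont: "continuous_on {0..1} (\<lambda>t. \<phi>' (u t) d)"
      by (rule continuous_on_compose2[OF _ cu]) (use uV in auto)
    have all: "\<phi> (u t) \<in> M \<inter> N \<and> \<phi>' (u t) d \<in> tangent_space M (\<phi> (u t)) \<and>
        ((\<phi> \<circ> u) has_vector_derivative \<phi>' (u t) d) (at t within {0..1})" if t: "t \<in> {0..1}" for t
    proof (intro conjI)
      have "\<phi> (u t) \<in> M \<inter> W" using uV[OF t] c(4) by blast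
      then show "\<phi> (u t) \<in> M \<inter> N" using uB[OF t] uV[OF t] c(5) by (simp add: N_def)
      show "\<phi>' (u t) d \<in> tangent_space M (\<phi> (u t))" using T(1)[OF uV(1)[OF t]] by blast
      show "((\<phi> \<circ> u) has_vector_derivative \<phi>' (u t) d) (at t within {0..1})"
        by (rule vector_derivative_diff_chain_within[OF du has_derivative_at_withinI[OF \<phi>(1)[OF uV(1)[OF t]]]])
    qed
    have "(\<phi> \<circ> u) 0 = q" "(\<phi> \<circ> u) 1 = q'" using q ch by (auto simp: u_def d_def N_def)
    then show "\<exists>c c'. c 0 = q \<and> c 1 = q' \<and> continuous_on {0..1} c' \<and>
        (\<forall>t\<in>{0..1::real}. c t \<in> M \<inter> N \<and> c' t \<in> tangent_space M (c t) \<and>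
           (c has_vector_derivative c' t) (at t within {0..1}))"
      using cont all by (intro exI[of _ "\<phi> \<circ> u"] exI[of _ "\<lambda>t. \<phi>' (u t) d"]) simp
  qed
qed

section \<open>Alternating forms and the affine metric\<close>

lemma span_pair:
  assumes "t \<in> span {a, b}"
  obtains s u where "t = s *\<^sub>R a + u *\<^sub>R b"
proof -
  obtain s where "t - s *\<^sub>R a \<in> span {b}" using assms by (auto simp: span_breakdown_eq)
  then obtain u where "t - s *\<^sub>R a = u *\<^sub>R b" by (auto simp: span_singleton)
  then have "t = s *\<^sub>R a + u *\<^sub>R b" by (simp add: algebra_simps)
  then show ?thesis using that by blast
qed

lemma representation_pair:
  assumes "independent {a, b}" "a \<noteq> b"
  shows "representation {a, b} (s *\<^sub>R a + u *\<^sub>R b) a = s"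
    and "representation {a, b} (s *\<^sub>R a + u *\<^sub>R b) b = u"
proof -
  have "a \<in> span {a, b}" "b \<in> span {a, b}" by (auto intro: span_base)
  then show "representation {a, b} (s *\<^sub>R a + u *\<^sub>R b) a = s"
    "representation {a, b} (s *\<^sub>R a + u *\<^sub>R b) b = u"
    using assms by (auto simp: representation_add representation_scale span_scale representation_basis)
qed

locale alternating4 =
  fixes v :: "'a::real_vector \<Rightarrow> 'a \<Rightarrow> 'a \<Rightarrow> 'a \<Rightarrow> real"
  assumes lin: "linear (\<lambda>x. v x a b c)" "linear (\<lambda>x. v a x b c)"
      "linear (\<lambda>x. v a b x c)" "linear (\<lambda>x. v a b c x)"
    and alt: "v a a b c = 0" "v b a a c = 0" "v b c a a = 0"
begin

lemma add [simp]:
  "v (x + y) a b c = v x a b c + v y a b c" "v a (x + y) b c = v a x b c + v a y b c"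
  "v a b (x + y) c = v a b x c + v a b y c" "v a b c (x + y) = v a b c x + v a b c y"
  using lin[THEN linear_add] by auto

lemma scale [simp]:
  "v (r *\<^sub>R x) a b c = r * v x a b c" "v a (r *\<^sub>R x) b c = r * v a x b c"
  "v a b (r *\<^sub>R x) c = r * v a b x c" "v a b c (r *\<^sub>R x) = r * v a b c x"
  using lin[THEN linear_scale] by auto

lemma diff [simp]:
  "v (x - y) a b c = v x a b c - v y a b c" "v a (x - y) b c = v a x b c - v a y b c"
  "v a b (x - y) c = v a b x c - v a b y c" "v a b c (x - y) = v a b c x - v a b c y"
  using lin[THEN linear_diff] by auto

lemma minus [simp]:
  "v (- x) a b c = - v x a b c" "v a (- x) b c = - v a x b c"
  "v a b (- x) c = - v a b x c" "v a b c (- x) = - v a b c x"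
  using lin[THEN linear_neg] by auto

lemma zero [simp]: "v 0 a b c = 0" "v a 0 b c = 0" "v a b 0 c = 0" "v a b c 0 = 0"
  using lin[THEN linear_0] by auto

lemma swap: "v b a c d = - v a b c d" "v a c b d = - v a b c d" "v a b d c = - v a b c d"
proof -
  have "v (a + b) (a + b) c d = 0" "v a (b + c) (b + c) d = 0" "v a b (c + d) (c + d) = 0"
    by (rule alt)+
  then show "v b a c d = - v a b c d" "v a c b d = - v a b c d" "v a b d c = - v a b c d"
    unfolding add by (simp_all add: alt)
qed

lemma repeated [simp]: "v a a b c = 0" "v b a a c = 0" "v b c a a = 0"
  "v a b a c = 0" "v a b c a = 0" "v b a c a = 0"
proof -
  show "v a a b c = 0" "v b a a c = 0" "v b c a a = 0" by (rule alt)+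
  show "v a b a c = 0" "v b a c a = 0" using swap alt by (metis neg_equal_zero)+
  then show "v a b c a = 0" using swap(3) by (metis neg_equal_zero)
qed

text \<open>The bracket is antisymmetric in the pair \<open>(x\<^sub>1, x\<^sub>2)\<close> on top of the factor
  \<open>v x\<^sub>1 x\<^sub>2\<close>, so a change of the pair multiplies it by the square of the determinant.\<close>

lemma symmetrized_change_of_pair:
  assumes B: "bilinear B" and x: "x1' = a *\<^sub>R x1 + b *\<^sub>R x2" "x2' = c *\<^sub>R x1 + d *\<^sub>R x2"
  shows "v x1' x2' (B y x1') (B z x2') + v x1' x2' (B z x1') (B y x2')
    = (a * d - b * c)\<^sup>2 * (v x1 x2 (B y x1) (B z x2) + v x1 x2 (B z x1) (B y x2))"
proof -
  have top: "v x1' x2' p q = (a * d - b * c) * v x1 x2 p q" for p q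
    unfolding x by (simp add: swap(1)[of x2 x1] algebra_simps)
  have Bx: "B y (r *\<^sub>R x1 + s *\<^sub>R x2) = r *\<^sub>R B y x1 + s *\<^sub>R B y x2" for y r s
    using B by (simp add: bilinear_radd bilinear_rmul)
  show ?thesis
    unfolding top unfolding x Bx
    by (simp add: swap(3)[of x1 x2 "B z x1" "B y x1"] swap(3)[of x1 x2 "B z x2" "B y x2"]
        swap(3)[of x1 x2 "B z x1" "B y x2"] swap(3)[of x1 x2 "B y x1" "B z x2"]
        power2_eq_square algebra_simps)
qed

end

lemma has_derivative_4linear:
  fixes v :: "'a::euclidean_space \<Rightarrow> 'a \<Rightarrow> 'a \<Rightarrow> 'a \<Rightarrow> real"
  assumes v: "alternating4 v"
    and f: "(f1 has_derivative f1') (at p within M)" "(f2 has_derivative f2') (at p within M)"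
      "(f3 has_derivative f3') (at p within M)" "(f4 has_derivative f4') (at p within M)"
  shows "((\<lambda>q. v (f1 q) (f2 q) (f3 q) (f4 q)) has_derivative
    (\<lambda>w. v (f1' w) (f2 p) (f3 p) (f4 p) + v (f1 p) (f2' w) (f3 p) (f4 p)
       + v (f1 p) (f2 p) (f3' w) (f4 p) + v (f1 p) (f2 p) (f3 p) (f4' w))) (at p within M)"
proof -
  interpret alternating4 v by (rule v)
  have e1: "v x a b c = (\<Sum>i\<in>Basis. (x \<bullet> i) * v i a b c)" for x a b c
    using linear_Basis_expansion[OF lin(1), of x a b c] by simp
  have e2: "v a x b c = (\<Sum>i\<in>Basis. (x \<bullet> i) * v a i b c)" for x a b c
    using linear_Basis_expansion[OF lin(2), of a x b c] by simp
  have bil: "bounded_bilinear (\<lambda>c d. v a b c d)" for a b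
    using lin(3,4) by (simp add: bilinear_conv_bounded_bilinear[symmetric] bilinear_def)
  have e: "v a b c d = (\<Sum>i\<in>Basis. \<Sum>j\<in>Basis. ((a \<bullet> i) * (b \<bullet> j)) * v i j c d)" for a b c d
    by (subst e1, subst e2) (simp add: sum_distrib_left mult.assoc)
  have "((\<lambda>q. \<Sum>i\<in>Basis. \<Sum>j\<in>Basis. ((f1 q \<bullet> i) * (f2 q \<bullet> j)) * v i j (f3 q) (f4 q)) has_derivative
    (\<lambda>w. \<Sum>i\<in>Basis. \<Sum>j\<in>Basis. ((f1 p \<bullet> i) * (f2 p \<bullet> j)) * (v i j (f3 p) (f4' w) + v i j (f3' w) (f4 p))
        + ((f1 p \<bullet> i) * (f2' w \<bullet> j) + (f1' w \<bullet> i) * (f2 p \<bullet> j)) * v i j (f3 p) (f4 p))) (at p within M)"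
    by (rule has_derivative_sum, rule has_derivative_sum,
        rule has_derivative_mult[OF has_derivative_mult[OF has_derivative_inner_left[OF f(1)]
          has_derivative_inner_left[OF f(2)]] bounded_bilinear.FDERIV[OF bil f(3,4)]])
  moreover have "(\<lambda>w. \<Sum>i\<in>Basis. \<Sum>j\<in>Basis. ((f1 p \<bullet> i) * (f2 p \<bullet> j)) * (v i j (f3 p) (f4' w) + v i j (f3' w) (f4 p))
        + ((f1 p \<bullet> i) * (f2' w \<bullet> j) + (f1' w \<bullet> i) * (f2 p \<bullet> j)) * v i j (f3 p) (f4 p))
      = (\<lambda>w. v (f1' w) (f2 p) (f3 p) (f4 p) + v (f1 p) (f2' w) (f3 p) (f4 p)
       + v (f1 p) (f2 p) (f3' w) (f4 p) + v (f1 p) (f2 p) (f3 p) (f4' w))"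
    unfolding e[of "f1' _" "f2 p" "f3 p" "f4 p"] e[of "f1 p" "f2' _" "f3 p" "f4 p"]
      e[of "f1 p" "f2 p" "f3' _" "f4 p"] e[of "f1 p" "f2 p" "f3 p" "f4' _"]
    by (simp add: sum.distrib[symmetric] algebra_simps)
  ultimately show ?thesis
    by (simp only: e[of "f1 _" "f2 _" "f3 _" "f4 _", symmetric])
qed

lemma parallel_volume_form_const:
  assumes "parallel_volume_form vol"
  shows "vol p = vol 0"
proof (intro ext)
  fix a b c d
  have "\<And>p. ((\<lambda>q. vol q a b c d) has_derivative (\<lambda>_. 0)) (at p)"
    using assms unfolding parallel_volume_form_def by blast
  then show "vol p a b c d = vol 0 a b c d"
    using has_derivative_zero_unique[of UNIV "\<lambda>q. vol q a b c d" p 0] by simp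
qed

lemma parallel_volume_form_alternating:
  assumes "parallel_volume_form vol"
  shows "alternating4 (vol p)"
  using assms unfolding alternating4_def parallel_volume_form_def by simp

lemma tangent_frame_span:
  assumes M: "smooth_surface M" and X: "tangent_frame M U X" and p: "p \<in> U"
  shows "span {X 1 p, X 2 p} = tangent_space M p"
proof -
  have pM: "p \<in> M" using X p openin_surface_subset unfolding tangent_frame_def by blast
  have 1: "independent {X 1 p, X 2 p}" "X 1 p \<noteq> X 2 p" "{X 1 p, X 2 p} \<subseteq> tangent_space M p"
    using X p unfolding tangent_frame_def by auto
  show ?thesis
    using dim_eq_span[of "{X 1 p, X 2 p}" "tangent_space M p"] tangent_space_plane[OF M pM] 1
      dim_eq_card_independent[OF 1(1)] span_eq_iff[of "tangent_space M p"]
    by simp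
qed

lemma tangent_frame_field:
  assumes X: "tangent_frame M U X" and p: "p \<in> U"
  shows "X i p \<in> tangent_space M p" "X i differentiable (at p within M)" "p \<in> M"
    "openin (top_of_set M) U" "smooth_along U (X i)"
  using assms smooth_along_differentiable openin_surface_subset
  unfolding tangent_frame_def by blast+

lemma G_frame_second_fundamental:
  assumes vol: "parallel_volume_form vol" and M: "smooth_surface M" and pM: "p \<in> M"
  obtains B where "bilinear B" and "\<And>U X y z. tangent_frame M U X \<Longrightarrow> p \<in> U \<Longrightarrow>
    y \<in> tangent_space M p \<Longrightarrow> z \<in> tangent_space M p \<Longrightarrow>
    G_frame vol M X p y z = (vol p (X 1 p) (X 2 p) (B y (X 1 p)) (B z (X 2 p))
      + vol p (X 1 p) (X 2 p) (B z (X 1 p)) (B y (X 2 p))) / 2"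
proof -
  interpret alternating4 "vol p" by (rule parallel_volume_form_alternating[OF vol])
  show ?thesis
  proof (rule second_fundamental_form[OF M pM])
    fix B assume B: "bilinear B" "\<And>v w. B v w = B w v"
      and TB: "\<And>U Y v. openin (top_of_set M) U \<Longrightarrow> p \<in> U \<Longrightarrow> (\<And>q. q \<in> U \<Longrightarrow> Y q \<in> tangent_space M q) \<Longrightarrow>
        Y differentiable (at p within M) \<Longrightarrow> v \<in> tangent_space M p \<Longrightarrow>
        D M Y p v - B v (Y p) \<in> tangent_space M p"
    show thesis
    proof (rule that[OF B(1)])
      fix U X y z
      assume X: "tangent_frame M U X" and p: "p \<in> U"
        and yz: "y \<in> tangent_space M p" "z \<in> tangent_space M p"
      have k: "vol p (X 1 p) (X 2 p) t u = 0" "vol p (X 1 p) (X 2 p) u t = 0"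
        if t: "t \<in> tangent_space M p" for t u
      proof -
        obtain r s where "t = r *\<^sub>R X 1 p + s *\<^sub>R X 2 p"
          using t tangent_frame_span[OF M X p] span_pair by metis
        then show "vol p (X 1 p) (X 2 p) t u = 0" "vol p (X 1 p) (X 2 p) u t = 0" by simp_all
      qed
      have "D M (X i) p w - B w (X i p) \<in> tangent_space M p" if "w \<in> tangent_space M p" for i w
        by (rule TB[OF tangent_frame_field(4)[OF X p] p tangent_frame_field(1)[OF X]
              tangent_frame_field(2)[OF X p] that])
      then have "vol p (X 1 p) (X 2 p) (D M (X i) p w) u = vol p (X 1 p) (X 2 p) (B w (X i p)) u"
        "vol p (X 1 p) (X 2 p) u (D M (X i) p w) = vol p (X 1 p) (X 2 p) u (B w (X i p))"
        if "w \<in> tangent_space M p" for i w u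
        using k[of "D M (X i) p w - B w (X i p)" u] that by auto
      then show "G_frame vol M X p y z = (vol p (X 1 p) (X 2 p) (B y (X 1 p)) (B z (X 2 p))
        + vol p (X 1 p) (X 2 p) (B z (X 1 p)) (B y (X 2 p))) / 2"
        using yz by (simp add: G_frame_def)
    qed
  qed
qed

lemma G_frame_bilinear:
  assumes vol: "parallel_volume_form vol" and X: "tangent_frame M U X" and p: "p \<in> U"
  shows "bilinear (G_frame vol M X p)" and "G_frame vol M X p y z = G_frame vol M X p z y"
proof -
  interpret alternating4 "vol p" by (rule parallel_volume_form_alternating[OF vol])
  have "linear (D M (X i) p)" for i using D_linear tangent_frame_field(2)[OF X p] by blast
  note l = linear_add[OF this] linear_scale[OF this]
  show "bilinear (G_frame vol M X p)"
    unfolding bilinear_def G_frame_def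
    by (intro allI conjI linearI) (simp_all add: l algebra_simps add_divide_distrib)
  show "G_frame vol M X p y z = G_frame vol M X p z y" by (simp add: G_frame_def)
qed

lemma G_frame_change_of_frame:
  assumes vol: "parallel_volume_form vol" and M: "smooth_surface M"
    and X: "tangent_frame M U X" "p \<in> U" and X': "tangent_frame M U' X'" "p \<in> U'"
  obtains r where "r \<noteq> 0"
    "\<And>y z. y \<in> tangent_space M p \<Longrightarrow> z \<in> tangent_space M p \<Longrightarrow> G_frame vol M X' p y z = r\<^sup>2 * G_frame vol M X p y z"
    "Delta_frame vol M X' p = r ^ 6 * Delta_frame vol M X p"
proof -
  interpret alternating4 "vol p" by (rule parallel_volume_form_alternating[OF vol])
  have pM: "p \<in> M" by (rule tangent_frame_field(3)[OF X])
  obtain B where B: "bilinear B" and G: "\<And>U X y z. tangent_frame M U X \<Longrightarrow> p \<in> U \<Longrightarrow>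
    y \<in> tangent_space M p \<Longrightarrow> z \<in> tangent_space M p \<Longrightarrow>
    G_frame vol M X p y z = (vol p (X 1 p) (X 2 p) (B y (X 1 p)) (B z (X 2 p))
      + vol p (X 1 p) (X 2 p) (B z (X 1 p)) (B y (X 2 p))) / 2"
    by (rule G_frame_second_fundamental[OF vol M pM]) (rule that)
  have T': "X' i p \<in> span {X 1 p, X 2 p}" for i
    using tangent_frame_span[OF M X] tangent_frame_field(1)[OF X'] by simp
  obtain a b where ab: "X' 1 p = a *\<^sub>R X 1 p + b *\<^sub>R X 2 p" by (rule span_pair[OF T'])
  obtain c d where cd: "X' 2 p = c *\<^sub>R X 1 p + d *\<^sub>R X 2 p" by (rule span_pair[OF T'])
  define r where "r = a * d - b * c"
  have GX: "G_frame vol M X' p y z = r\<^sup>2 * G_frame vol M X p y z"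
    if "y \<in> tangent_space M p" "z \<in> tangent_space M p" for y z
    using symmetrized_change_of_pair[OF B ab cd, of y z]
    by (simp add: G[OF X that] G[OF X' that] r_def)
  have r: "r \<noteq> 0"
  proof
    assume "r = 0"
    have ind: "independent {X' 1 p, X' 2 p}" "X' 1 p \<noteq> X' 2 p" using X' unfolding tangent_frame_def by auto
    have 1: "d *\<^sub>R X' 1 p + (- b) *\<^sub>R X' 2 p = r *\<^sub>R X 1 p" "(- c) *\<^sub>R X' 1 p + a *\<^sub>R X' 2 p = r *\<^sub>R X 2 p"
      unfolding ab cd r_def by (simp_all add: algebra_simps)
    have z: "s = 0 \<and> u = 0" if "s *\<^sub>R X' 1 p + u *\<^sub>R X' 2 p = 0" for s u
      using representation_pair[OF ind, of s u] unfolding that by (simp add: representation_zero)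
    have "a = 0 \<and> b = 0" using z[of d "- b"] z[of "- c" a] 1 \<open>r = 0\<close> by simp
    then have "X' 1 p = 0" using ab by simp
    then show False using z[of 1 0] by simp
  qed
  have bl: "bilinear (G_frame vol M X p)" by (rule G_frame_bilinear[OF vol X])
  have sy: "G_frame vol M X p (X 2 p) (X 1 p) = G_frame vol M X p (X 1 p) (X 2 p)"
    by (rule G_frame_bilinear[OF vol X])
  have "Delta_frame vol M X' p = r ^ 6 * Delta_frame vol M X p"
    unfolding Delta_frame_def GX[OF tangent_frame_field(1)[OF X'] tangent_frame_field(1)[OF X']]
    unfolding ab cd bilinear_ladd[OF bl] bilinear_radd[OF bl] bilinear_lmul[OF bl] bilinear_rmul[OF bl] sy
    by (simp add: r_def algebra_simps power2_eq_square  eval_nat_numeral)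
  with r GX that show ?thesis by blast
qed

lemma affine_metric_eq:
  assumes vol: "parallel_volume_form vol" and M: "smooth_surface M"
    and X: "tangent_frame M U X" "p \<in> U"
    and yz: "y \<in> tangent_space M p" "z \<in> tangent_space M p"
  shows "affine_metric vol M p y z = G_frame vol M X p y z / root 3 (Delta_frame vol M X p)"
  unfolding affine_metric_def
proof (rule the_equality)
  show "\<forall>U' X'. tangent_frame M U' X' \<and> p \<in> U' \<longrightarrow>
    G_frame vol M X p y z / root 3 (Delta_frame vol M X p)
      = G_frame vol M X' p y z / root 3 (Delta_frame vol M X' p)"
  proof (intro allI impI)
    fix U' X' assume X': "tangent_frame M U' X' \<and> p \<in> U'"
    then obtain r where r: "r \<noteq> 0"
      "\<And>y z. y \<in> tangent_space M p \<Longrightarrow> z \<in> tangent_space M p \<Longrightarrow> G_frame vol M X' p y z = r\<^sup>2 * G_frame vol M X p y z"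
      "Delta_frame vol M X' p = r ^ 6 * Delta_frame vol M X p"
      using G_frame_change_of_frame[OF vol M X] by metis
    have "root 3 (r ^ 6) = r\<^sup>2"
      using real_root_power_cancel[of 3 "r\<^sup>2"] by (simp add: power_mult[symmetric])
    then show "G_frame vol M X p y z / root 3 (Delta_frame vol M X p)
      = G_frame vol M X' p y z / root 3 (Delta_frame vol M X' p)"
      using r(1) by (simp add: r(2)[OF yz] r(3) real_root_mult)
  qed
qed (use X in blast)

lemma affine_metric_linear:
  assumes vol: "parallel_volume_form vol" and M: "smooth_surface M"
    and X: "tangent_frame M U X" "p \<in> U"
  shows "affine_metric vol M p (a *\<^sub>R X 1 p + b *\<^sub>R X 2 p) (X i p)
      = a * affine_metric vol M p (X 1 p) (X i p) + b * affine_metric vol M p (X 2 p) (X i p)"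
    and "affine_metric vol M p (X i p) (a *\<^sub>R X 1 p + b *\<^sub>R X 2 p)
      = a * affine_metric vol M p (X i p) (X 1 p) + b * affine_metric vol M p (X i p) (X 2 p)"
    and "affine_metric vol M p (X 2 p) (X 1 p) = affine_metric vol M p (X 1 p) (X 2 p)"
proof -
  have T: "X i p \<in> tangent_space M p" for i by (rule tangent_frame_field[OF X])
  have T2: "a *\<^sub>R X 1 p + b *\<^sub>R X 2 p \<in> tangent_space M p"
    using tangent_space_plane(1)[OF M tangent_frame_field(3)[OF X]] T
    by (simp add: subspace_add subspace_scale)
  note e = affine_metric_eq[OF vol M X]
  have bl: "bilinear (G_frame vol M X p)" by (rule G_frame_bilinear[OF vol X])
  note l = bilinear_ladd[OF bl] bilinear_radd[OF bl] bilinear_lmul[OF bl] bilinear_rmul[OF bl]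
  show "affine_metric vol M p (a *\<^sub>R X 1 p + b *\<^sub>R X 2 p) (X i p)
      = a * affine_metric vol M p (X 1 p) (X i p) + b * affine_metric vol M p (X 2 p) (X i p)"
    "affine_metric vol M p (X i p) (a *\<^sub>R X 1 p + b *\<^sub>R X 2 p)
      = a * affine_metric vol M p (X i p) (X 1 p) + b * affine_metric vol M p (X i p) (X 2 p)"
    by (simp_all add: e[OF T2 T] e[OF T T2] e[OF T T] l add_divide_distrib)
  show "affine_metric vol M p (X 2 p) (X 1 p) = affine_metric vol M p (X 1 p) (X 2 p)"
    using G_frame_bilinear(2)[OF vol X] by (simp add: e[OF T T])
qed

section \<open>Structure equations of an adapted frame\<close>

locale adapted =
  fixes vol :: "r4 \<Rightarrow> r4 \<Rightarrow> r4 \<Rightarrow> r4 \<Rightarrow> r4 \<Rightarrow> real" and M :: "r4 set" and \<sigma> :: "r4 \<Rightarrow> r4 set"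
    and U :: "r4 set" and X \<xi> :: "2 \<Rightarrow> r4 \<Rightarrow> r4"
  assumes vol: "parallel_volume_form vol" and surface: "smooth_surface M"
    and normal: "affine_normal_bundle vol M \<sigma>" and frame: "adapted_frame vol M \<sigma> U X \<xi>"
begin

sublocale alternating4 "vol 0"
  by (rule parallel_volume_form_alternating[OF vol])

abbreviation \<epsilon> where "\<epsilon> p \<equiv> metric_sign vol M p"
abbreviation \<Gamma> where "\<Gamma> k j a p \<equiv> Gam M \<sigma> X k j a p"
abbreviation \<tau> where "\<tau> j b k p \<equiv> tau M \<sigma> \<xi> j b (X k) p"
abbreviation \<Lambda> where "\<Lambda> j k a p \<equiv> lam M \<sigma> X \<xi> j k a p"
abbreviation h where "h b k j p \<equiv> h_coeff M \<sigma> \<xi> b (X k) (X j) p"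
abbreviation T where "T p \<equiv> tangent_space M p"

text \<open>\<open>ca a p\<close> and \<open>cb b p\<close> are the coframe dual to \<open>X 1 p, X 2 p, \<xi> 1 p, \<xi> 2 p\<close>.\<close>

definition ca :: "2 \<Rightarrow> r4 \<Rightarrow> r4 \<Rightarrow> real" where
  "ca a p z = (if a = 1 then vol 0 z (X 2 p) (\<xi> 1 p) (\<xi> 2 p) else vol 0 (X 1 p) z (\<xi> 1 p) (\<xi> 2 p))"

definition cb :: "2 \<Rightarrow> r4 \<Rightarrow> r4 \<Rightarrow> real" where
  "cb b p z = (if b = 1 then vol 0 (X 1 p) (X 2 p) z (\<xi> 2 p) else vol 0 (X 1 p) (X 2 p) (\<xi> 1 p) z)"

lemma orthonormal: "orthonormal_frame vol M U X"
  and tangent: "tangent_frame M U X" and openU: "openin (top_of_set M) U"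
  and smoothX: "smooth_along U (X i)" and smooth\<xi>: "smooth_along U (\<xi> i)"
  using frame unfolding adapted_frame_def orthonormal_frame_def tangent_frame_def by blast+

lemma inM: "p \<in> U \<Longrightarrow> p \<in> M"
  using openU openin_surface_subset by blast

lemma X_in_T: "p \<in> U \<Longrightarrow> X i p \<in> T p"
  by (rule tangent_frame_field[OF tangent])

lemma diffX: "p \<in> U \<Longrightarrow> X i differentiable (at p within M)"
  and diff\<xi>: "p \<in> U \<Longrightarrow> \<xi> i differentiable (at p within M)"
  using smooth_along_differentiable[OF openU] smoothX smooth\<xi> by blast+

lemma spanX: "p \<in> U \<Longrightarrow> span {X 1 p, X 2 p} = T p"
  by (rule tangent_frame_span[OF surface tangent])

lemma indX: "p \<in> U \<Longrightarrow> independent {X 1 p, X 2 p}" "p \<in> U \<Longrightarrow> X 1 p \<noteq> X 2 p"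
  using tangent unfolding tangent_frame_def by auto

lemma span\<xi>: "p \<in> U \<Longrightarrow> span {\<xi> 1 p, \<xi> 2 p} = \<sigma> p"
  using frame unfolding adapted_frame_def by blast

lemma vol_frame [simp]: "p \<in> U \<Longrightarrow> vol 0 (X 1 p) (X 2 p) (\<xi> 1 p) (\<xi> 2 p) = 1"
  using frame parallel_volume_form_const[OF vol, of p] unfolding adapted_frame_def by metis

lemma transversal:
  assumes "p \<in> U"
  shows "subspace (\<sigma> p)" "dim (\<sigma> p) = 2" "T p \<inter> \<sigma> p = {0}"
  using normal inM[OF assms] unfolding affine_normal_bundle_def transversal_bundle_def by auto

lemma ind\<xi>:
  assumes p: "p \<in> U"
  shows "independent {\<xi> 1 p, \<xi> 2 p}" "\<xi> 1 p \<noteq> \<xi> 2 p"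
proof -
  show n: "\<xi> 1 p \<noteq> \<xi> 2 p" using vol_frame[OF p] by force
  show "independent {\<xi> 1 p, \<xi> 2 p}"
    by (rule card_le_dim_spanning[of _ "span {\<xi> 1 p, \<xi> 2 p}"])
      (use n span\<xi>[OF p] transversal[OF p] in \<open>auto intro: span_base\<close>)
qed

lemma coframe_linear [simp]:
  "ca a p (y + z) = ca a p y + ca a p z" "ca a p (y - z) = ca a p y - ca a p z"
  "ca a p (r *\<^sub>R z) = r * ca a p z" "ca a p 0 = 0" "ca a p (- z) = - ca a p z"
  "cb b p (y + z) = cb b p y + cb b p z" "cb b p (y - z) = cb b p y - cb b p z"
  "cb b p (r *\<^sub>R z) = r * cb b p z" "cb b p 0 = 0" "cb b p (- z) = - cb b p z"
proof -
  show "ca a p (y + z) = ca a p y + ca a p z" "ca a p (y - z) = ca a p y - ca a p z"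
    "ca a p (r *\<^sub>R z) = r * ca a p z" "ca a p 0 = 0"
    "cb b p (y + z) = cb b p y + cb b p z" "cb b p (y - z) = cb b p y - cb b p z"
    "cb b p (r *\<^sub>R z) = r * cb b p z" "cb b p 0 = 0" for r y z a b
    by (simp_all add: ca_def cb_def)
  from this(3)[where r="-1"] this(7)[where r="-1"]
  show "ca a p (- z) = - ca a p z" "cb b p (- z) = - cb b p z" by simp_all
qed

lemma coframe_frame [simp]:
  assumes "p \<in> U"
  shows "ca a p (X i p) = (if a = i then 1 else 0)" "ca a p (\<xi> i p) = 0"
    "cb b p (X i p) = 0" "cb b p (\<xi> i p) = (if b = i then 1 else 0)"
proof -
  have "a = 1 \<or> a = 2" "b = 1 \<or> b = 2" "i = 1 \<or> i = 2" by (rule exhaust_2)+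
  then show "ca a p (X i p) = (if a = i then 1 else 0)" "ca a p (\<xi> i p) = 0"
    "cb b p (X i p) = 0" "cb b p (\<xi> i p) = (if b = i then 1 else 0)"
    using assms by (auto simp: ca_def cb_def)
qed

lemma frame_expansion:
  assumes p: "p \<in> U"
  shows "z = ca 1 p z *\<^sub>R X 1 p + ca 2 p z *\<^sub>R X 2 p + cb 1 p z *\<^sub>R \<xi> 1 p + cb 2 p z *\<^sub>R \<xi> 2 p"
proof -
  have "dim {x + y | x y. x \<in> T p \<and> y \<in> \<sigma> p} + dim (T p \<inter> \<sigma> p) = dim (T p) + dim (\<sigma> p)"
    by (rule dim_sums_Int) (use tangent_space_plane[OF surface inM[OF p]] transversal[OF p] in auto)
  then have "dim {x + y | x y. x \<in> T p \<and> y \<in> \<sigma> p} = DIM(r4)"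
    using tangent_space_plane[OF surface inM[OF p]] transversal[OF p] by simp
  then have "span {x + y | x y. x \<in> T p \<and> y \<in> \<sigma> p} = UNIV"
    using dim_eq_full by blast
  moreover have "subspace {x + y | x y. x \<in> T p \<and> y \<in> \<sigma> p}"
    by (rule subspace_sums) (use tangent_space_plane[OF surface inM[OF p]] transversal[OF p] in auto)
  ultimately have "{x + y | x y. x \<in> T p \<and> y \<in> \<sigma> p} = UNIV" by (simp only: span_eq_iff[THEN iffD2])
  then have "z \<in> {x + y | x y. x \<in> T p \<and> y \<in> \<sigma> p}" by simp
  then obtain x y where xy: "x \<in> span {X 1 p, X 2 p}" "y \<in> span {\<xi> 1 p, \<xi> 2 p}" "z = x + y"
    using spanX[OF p] span\<xi>[OF p] by blast
  obtain a b where "x = a *\<^sub>R X 1 p + b *\<^sub>R X 2 p" by (rule span_pair[OF xy(1)])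
  moreover obtain c d where "y = c *\<^sub>R \<xi> 1 p + d *\<^sub>R \<xi> 2 p" by (rule span_pair[OF xy(2)])
  ultimately show ?thesis using p by (simp add: xy(3))
qed

lemma in_T: "p \<in> U \<Longrightarrow> a *\<^sub>R X 1 p + b *\<^sub>R X 2 p \<in> T p"
  using tangent_space_plane(1)[OF surface inM] X_in_T by (simp add: subspace_add subspace_scale)

lemma T_iff: "p \<in> U \<Longrightarrow> z \<in> T p \<longleftrightarrow> cb 1 p z = 0 \<and> cb 2 p z = 0"
proof
  assume p: "p \<in> U"
  {
    assume "z \<in> T p"
    then obtain a b where "z = a *\<^sub>R X 1 p + b *\<^sub>R X 2 p" using spanX[OF p] span_pair by metis
    then show "cb 1 p z = 0 \<and> cb 2 p z = 0" using p by simp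
  next
    assume "cb 1 p z = 0 \<and> cb 2 p z = 0"
    then show "z \<in> T p" using frame_expansion[OF p, of z] in_T[OF p, of "ca 1 p z" "ca 2 p z"] by simp
  }
qed

lemma tangent_part_eq:
  assumes p: "p \<in> U"
  shows "tangent_part M \<sigma> p z = ca 1 p z *\<^sub>R X 1 p + ca 2 p z *\<^sub>R X 2 p"
  unfolding tangent_part_def
proof (rule the_equality)
  let ?w = "ca 1 p z *\<^sub>R X 1 p + ca 2 p z *\<^sub>R X 2 p"
  have "z - ?w = cb 1 p z *\<^sub>R \<xi> 1 p + cb 2 p z *\<^sub>R \<xi> 2 p"
    using frame_expansion[OF p, of z] by (simp add: algebra_simps)
  then have "z - ?w \<in> \<sigma> p"
    unfolding span\<xi>[OF p, symmetric] by (simp add: span_add span_scale span_base)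
  then show *: "?w \<in> T p \<and> z - ?w \<in> \<sigma> p" using in_T[OF p] by blast
  fix w assume w: "w \<in> T p \<and> z - w \<in> \<sigma> p"
  have "w - ?w \<in> T p" using w * tangent_space_plane(1)[OF surface inM[OF p]] subspace_diff by blast
  moreover have "(z - ?w) - (z - w) \<in> \<sigma> p" using w * transversal(1)[OF p] subspace_diff by blast
  moreover have "(z - ?w) - (z - w) = w - ?w" by simp
  ultimately have "w - ?w \<in> T p \<inter> \<sigma> p" by (simp only: Int_iff)
  then have "w - ?w = 0" unfolding transversal(3)[OF p] by simp
  then show "w = ?w" by (simp only: right_minus_eq)
qed

lemma transversal_part_eq:
  assumes p: "p \<in> U"
  shows "transversal_part M \<sigma> p z = cb 1 p z *\<^sub>R \<xi> 1 p + cb 2 p z *\<^sub>R \<xi> 2 p"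
  unfolding transversal_part_def tangent_part_eq[OF p] using frame_expansion[OF p, of z]
  by (simp add: algebra_simps)

lemma coefficient_eqs:
  assumes p: "p \<in> U"
  shows "\<Gamma> k j a p = ca a p (D M (X j) p (X k p))"
    and "h_coeff M \<sigma> \<xi> b Y Z p = cb b p (D M Z p (Y p))"
    and "\<Lambda> j k a p = - ca a p (D M (\<xi> j) p (X k p))"
    and "\<tau> j b k p = cb b p (D M (\<xi> j) p (X k p))"
proof -
  have a: "a = 1 \<or> a = 2" and b: "b = 1 \<or> b = 2" by (rule exhaust_2)+
  note rX = representation_pair[OF indX[OF p]] and r\<xi> = representation_pair[OF ind\<xi>[OF p]]
  have neg: "- (s *\<^sub>R x + u *\<^sub>R y) = (- s) *\<^sub>R x + (- u) *\<^sub>R y" for s u and x y :: r4 by simp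
  show "\<Gamma> k j a p = ca a p (D M (X j) p (X k p))"
    using a by (elim disjE) (simp_all only: Gam_def conn_def tangent_part_eq[OF p] rX)
  show "h_coeff M \<sigma> \<xi> b Y Z p = cb b p (D M Z p (Y p))"
    using b by (elim disjE) (simp_all only: h_coeff_def h_form_def transversal_part_eq[OF p] r\<xi>)
  show "\<Lambda> j k a p = - ca a p (D M (\<xi> j) p (X k p))"
    using a by (elim disjE) (simp_all only: lam_def shape_def tangent_part_eq[OF p] neg rX)
  show "\<tau> j b k p = cb b p (D M (\<xi> j) p (X k p))"
    using b by (elim disjE) (simp_all only: tau_def transversal_part_eq[OF p] r\<xi>)
qed

lemma conn_eq:
  assumes p: "p \<in> U"
  shows "conn M \<sigma> (X k) (X j) p = \<Gamma> k j 1 p *\<^sub>R X 1 p + \<Gamma> k j 2 p *\<^sub>R X 2 p"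
  by (simp add: conn_def tangent_part_eq[OF p] coefficient_eqs[OF p])

lemma structure_X:
  assumes p: "p \<in> U"
  shows "D M (X j) p (X k p) = \<Gamma> k j 1 p *\<^sub>R X 1 p + \<Gamma> k j 2 p *\<^sub>R X 2 p + h 1 k j p *\<^sub>R \<xi> 1 p + h 2 k j p *\<^sub>R \<xi> 2 p"
  using frame_expansion[OF p, of "D M (X j) p (X k p)"] by (simp only: coefficient_eqs[OF p])

lemma structure_\<xi>:
  assumes p: "p \<in> U"
  shows "D M (\<xi> j) p (X k p) = (- \<Lambda> j k 1 p) *\<^sub>R X 1 p + (- \<Lambda> j k 2 p) *\<^sub>R X 2 p
    + \<tau> j 1 k p *\<^sub>R \<xi> 1 p + \<tau> j 2 k p *\<^sub>R \<xi> 2 p"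
  using frame_expansion[OF p, of "D M (\<xi> j) p (X k p)"] by (simp only: coefficient_eqs[OF p] minus_minus)

lemma bracket_tangent:
  assumes p: "p \<in> U"
  shows "D M (X 2) p (X 1 p) - D M (X 1) p (X 2 p) \<in> T p"
proof (rule second_fundamental_form[OF surface inM[OF p]])
  fix B assume B: "bilinear B" "\<And>v w. B v w = B w v"
    and TB: "\<And>U Y v. openin (top_of_set M) U \<Longrightarrow> p \<in> U \<Longrightarrow> (\<And>q. q \<in> U \<Longrightarrow> Y q \<in> tangent_space M q) \<Longrightarrow>
      Y differentiable (at p within M) \<Longrightarrow> v \<in> tangent_space M p \<Longrightarrow>
      D M Y p v - B v (Y p) \<in> tangent_space M p"
  have "D M (X j) p (X k p) - B (X k p) (X j p) \<in> T p" for j k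
    by (rule TB[OF openU p X_in_T diffX[OF p] X_in_T[OF p]])
  from subspace_diff[OF tangent_space_plane(1)[OF surface inM[OF p]] this[of 2 1] this[of 1 2]]
  show ?thesis using B(2)[of "X 1 p"] by simp
qed

lemma h_values [simp]:
  assumes p: "p \<in> U"
  shows "h 1 1 1 p = 1" "h 1 1 2 p = 0" "h 1 2 1 p = 0" "h 1 2 2 p = - \<epsilon> p"
    "h 2 1 1 p = 0" "h 2 1 2 p = 1" "h 2 2 1 p = 1" "h 2 2 2 p = 0"
proof -
  show v: "h 1 1 1 p = 1" "h 1 1 2 p = 0" "h 1 2 2 p = - \<epsilon> p" "h 2 1 1 p = 0" "h 2 1 2 p = 1" "h 2 2 2 p = 0"
    using frame p unfolding adapted_frame_def by auto
  have "cb 1 p (D M (X 2) p (X 1 p) - D M (X 1) p (X 2 p)) = 0"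
    "cb 2 p (D M (X 2) p (X 1 p) - D M (X 1) p (X 2 p)) = 0"
    using bracket_tangent[OF p] T_iff[OF p] by auto
  then show "h 1 2 1 p = 0" "h 2 2 1 p = 1" using v by (auto simp: coefficient_eqs[OF p])
qed

lemma \<epsilon>_cases: "\<epsilon> p = 1 \<or> \<epsilon> p = -1"
  by (simp add: metric_sign_def)

lemma \<epsilon>_sq [simp]: "\<epsilon> p * \<epsilon> p = 1" "\<epsilon> p * (\<epsilon> p * x) = x"
  using \<epsilon>_cases[of p] by auto

lemma diff_coframe:
  assumes p: "p \<in> U" and w: "w differentiable (at p within M)"
  shows "(\<lambda>q. ca a q (w q)) differentiable (at p within M)"
    "(\<lambda>q. cb b q (w q)) differentiable (at p within M)"
proof -
  note d = D_has_derivative[OF w] D_has_derivative[OF diffX[OF p]] D_has_derivative[OF diff\<xi>[OF p]]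
  note L = has_derivative_4linear[OF parallel_volume_form_alternating[OF vol, of 0]]
  have a: "a = 1 \<or> a = 2" and b: "b = 1 \<or> b = 2" by (rule exhaust_2)+
  show "(\<lambda>q. ca a q (w q)) differentiable (at p within M)"
    using a by (elim disjE) (simp_all add: ca_def differentiableI[OF L[OF d(1,2,3,3)]]
      differentiableI[OF L[OF d(2,1,3,3)]])
  show "(\<lambda>q. cb b q (w q)) differentiable (at p within M)"
    using b by (elim disjE) (simp_all add: cb_def differentiableI[OF L[OF d(2,2,1,3)]]
      differentiableI[OF L[OF d(2,2,3,1)]])
qed

lemma diff_DX:
  assumes p: "p \<in> U"
  shows "(\<lambda>q. D M (X j) q (X k q)) differentiable (at p within M)"
proof (rule D_along_field[OF openU smoothX p])
  fix A B
  assume "\<And>Y. (\<And>q. q \<in> U \<Longrightarrow> Y q \<in> T q) \<Longrightarrow> Y differentiable (at p within M) \<Longrightarrow>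
    ((\<lambda>q. D M (X j) q (Y q)) has_derivative (\<lambda>w. B (Y p) w + A (D M Y p w))) (at p within M)"
  from this[OF X_in_T diffX[OF p]] show ?thesis by (rule differentiableI)
qed

lemma diff_D\<xi>:
  assumes p: "p \<in> U"
  shows "(\<lambda>q. D M (\<xi> j) q (X k q)) differentiable (at p within M)"
proof (rule D_along_field[OF openU smooth\<xi> p])
  fix A B
  assume "\<And>Y. (\<And>q. q \<in> U \<Longrightarrow> Y q \<in> T q) \<Longrightarrow> Y differentiable (at p within M) \<Longrightarrow>
    ((\<lambda>q. D M (\<xi> j) q (Y q)) has_derivative (\<lambda>w. B (Y p) w + A (D M Y p w))) (at p within M)"
  from this[OF X_in_T diffX[OF p]] show ?thesis by (rule differentiableI)
qed

lemma nbhd: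
  assumes "p \<in> U"
  obtains W where "open W" "p \<in> W" "\<And>q. q \<in> M \<Longrightarrow> q \<in> W \<Longrightarrow> q \<in> U"
proof -
  obtain W where "open W" "U = M \<inter> W" using openU openin_open by blast
  with assms that[of W] show ?thesis by blast
qed

lemma differentiable_cong:
  fixes f g :: "r4 \<Rightarrow> 'b::euclidean_space"
  assumes p: "p \<in> U" and f: "f differentiable (at p within M)" and e: "\<And>q. q \<in> U \<Longrightarrow> f q = g q"
  shows "g differentiable (at p within M)"
proof -
  obtain W where W: "open W" "p \<in> W" "\<And>q. q \<in> M \<Longrightarrow> q \<in> W \<Longrightarrow> q \<in> U"
    by (rule nbhd[OF p]) (rule that)
  show ?thesis
    by (rule differentiableI, rule has_derivative_cong_within_open[OF D_has_derivative[OF f] W(1,2) inM[OF p]])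
      (simp add: e W(3))
qed

lemma diff_coefficients:
  assumes p: "p \<in> U"
  shows "(\<lambda>q. \<Gamma> k j a q) differentiable (at p within M)" "(\<lambda>q. \<tau> j b k q) differentiable (at p within M)"
    "(\<lambda>q. \<Lambda> j k a q) differentiable (at p within M)" "(\<lambda>q. h b k j q) differentiable (at p within M)"
proof -
  show "(\<lambda>q. \<Gamma> k j a q) differentiable (at p within M)"
    by (rule differentiable_cong[OF p diff_coframe(1)[OF p diff_DX[OF p]] coefficient_eqs(1)[symmetric]])
  show "(\<lambda>q. \<tau> j b k q) differentiable (at p within M)"
    by (rule differentiable_cong[OF p diff_coframe(2)[OF p diff_D\<xi>[OF p]] coefficient_eqs(4)[symmetric]])
  show "(\<lambda>q. \<Lambda> j k a q) differentiable (at p within M)"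
    by (rule differentiable_cong[OF p differentiable_minus[OF diff_coframe(1)[OF p diff_D\<xi>[OF p]]]
          coefficient_eqs(3)[symmetric]])
  show "(\<lambda>q. h b k j q) differentiable (at p within M)"
    by (rule differentiable_cong[OF p diff_coframe(2)[OF p diff_DX[OF p]]])
      (rule coefficient_eqs(2)[symmetric])
qed

lemma \<epsilon>_locally_constant:
  assumes p: "p \<in> U"
  obtains W where "open W" "p \<in> W" "\<And>q. q \<in> M \<Longrightarrow> q \<in> W \<Longrightarrow> q \<in> U \<and> \<epsilon> q = \<epsilon> p"
proof -
  obtain W where W: "open W" "p \<in> W" "\<And>q. q \<in> M \<Longrightarrow> q \<in> W \<Longrightarrow> q \<in> U"
    by (rule nbhd[OF p]) (rule that)
  have "continuous (at p within M) (\<lambda>q. h 1 2 2 q)"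
    by (rule differentiable_imp_continuous_within[OF diff_coefficients(4)[OF p]])
  then obtain d where d: "d > 0" "\<And>q. q \<in> M \<Longrightarrow> dist q p < d \<Longrightarrow> dist (h 1 2 2 q) (h 1 2 2 p) < 1"
    unfolding continuous_within_eps_delta by (metis zero_less_one)
  show ?thesis
  proof (rule that[of "W \<inter> ball p d"])
    fix q assume q: "q \<in> M" "q \<in> W \<inter> ball p d"
    then have "q \<in> U" using W(3) by blast
    moreover have "\<epsilon> q = \<epsilon> p"
      using d(2)[OF q(1)] q(2) \<epsilon>_cases[of p] \<epsilon>_cases[of q] p \<open>q \<in> U\<close> by (auto simp: dist_commute dist_real_def)
    ultimately show "q \<in> U \<and> \<epsilon> q = \<epsilon> p" by blast
  qed (use W d in auto)
qed

lemma D_locally_constant: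
  assumes p: "p \<in> U" and e: "\<And>q. q \<in> U \<Longrightarrow> \<epsilon> q = \<epsilon> p \<Longrightarrow> f q = c" and v: "v \<in> T p"
  shows "D M f p v = 0"
proof -
  obtain W where W: "open W" "p \<in> W" "\<And>q. q \<in> M \<Longrightarrow> q \<in> W \<Longrightarrow> q \<in> U \<and> \<epsilon> q = \<epsilon> p"
    by (rule \<epsilon>_locally_constant[OF p]) (rule that)
  have "(f has_derivative (\<lambda>_. 0)) (at p within M)"
    by (rule has_derivative_cong_within_open[OF has_derivative_const W(1,2) inM[OF p]]) (simp add: W(3) e)
  from D_eq[OF this v] show ?thesis .
qed

lemma D_coefficients:
  assumes p: "p \<in> U" and w: "w differentiable (at p within M)"
  shows "cb b p (D M w p (X l p)) = D M (\<lambda>q. cb b q (w q)) p (X l p)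
    + ca 1 p (w p) * h b l 1 p + ca 2 p (w p) * h b l 2 p
    + cb 1 p (w p) * \<tau> 1 b l p + cb 2 p (w p) * \<tau> 2 b l p"
proof -
  note a = D_has_derivative[OF diff_coframe(1)[OF p w]] and b = D_has_derivative[OF diff_coframe(2)[OF p w]]
  note dX = D_has_derivative[OF diffX[OF p]] and d\<xi> = D_has_derivative[OF diff\<xi>[OF p]]
  obtain W where W: "open W" "p \<in> W" "\<And>q. q \<in> M \<Longrightarrow> q \<in> W \<Longrightarrow> q \<in> U"
    by (rule nbhd[OF p]) (rule that)
  note d = has_derivative_add[OF has_derivative_add[OF has_derivative_add[OF
      has_derivative_scaleR[OF a[of 1] dX[of 1]] has_derivative_scaleR[OF a[of 2] dX[of 2]]]
      has_derivative_scaleR[OF b[of 1] d\<xi>[of 1]]] has_derivative_scaleR[OF b[of 2] d\<xi>[of 2]]]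
  note dw = has_derivative_cong_within_open[OF d W(1,2) inM[OF p], of w]
  have fe: "ca 1 q (w q) *\<^sub>R X 1 q + ca 2 q (w q) *\<^sub>R X 2 q + cb 1 q (w q) *\<^sub>R \<xi> 1 q + cb 2 q (w q) *\<^sub>R \<xi> 2 q = w q"
    if "q \<in> M" "q \<in> W" for q
    by (rule frame_expansion[OF W(3)[OF that], symmetric])
  show ?thesis
    using exhaust_2[of b] D_eq[OF dw[OF fe] X_in_T[OF p, of l]] p
    by (auto simp: structure_X structure_\<xi>)
qed

lemma trace:
  assumes p: "p \<in> U"
  shows "\<Gamma> k 1 1 p + \<Gamma> k 2 2 p + \<tau> 1 1 k p + \<tau> 2 2 k p = 0"
proof -
  note dX = D_has_derivative[OF diffX[OF p]] and d\<xi> = D_has_derivative[OF diff\<xi>[OF p]]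
  note d = has_derivative_4linear[OF parallel_volume_form_alternating[OF vol, of 0]
      dX[of 1] dX[of 2] d\<xi>[of 1] d\<xi>[of 2]]
  have "D M (\<lambda>q. vol 0 (X 1 q) (X 2 q) (\<xi> 1 q) (\<xi> 2 q)) p (X k p) = 0"
    by (rule D_locally_constant[OF p _ X_in_T[OF p]]) (rule vol_frame)
  then show ?thesis
    unfolding D_eq[OF d X_in_T[OF p]] using p by (simp add: structure_X structure_\<xi>)
qed

lemma metric_equations:
  assumes p: "p \<in> U"
  shows "\<Gamma> 1 1 1 p + \<Gamma> 1 2 2 p = 0" "\<Gamma> 2 1 1 p + \<Gamma> 2 2 2 p = 0"
    "2 * \<epsilon> p * \<Gamma> 2 1 1 p + \<Gamma> 1 1 2 p + \<epsilon> p * \<Gamma> 1 2 1 p = 0"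
    "2 * \<Gamma> 1 2 2 p + \<Gamma> 2 1 2 p + \<epsilon> p * \<Gamma> 2 2 1 p = 0"
proof -
  have g: "affine_metric vol M q (X 1 q) (X 1 q) = \<epsilon> q" "affine_metric vol M q (X 1 q) (X 2 q) = 0"
    "affine_metric vol M q (X 2 q) (X 1 q) = 0" "affine_metric vol M q (X 2 q) (X 2 q) = 1" if "q \<in> U" for q
    using orthonormal that affine_metric_linear(3)[OF vol surface tangent that]
    unfolding orthonormal_frame_def by auto
  have "D M (\<lambda>q. affine_metric vol M q (X j q) (X k q)) p (X i p) = 0" for i j k
    by (rule D_locally_constant[OF p _ X_in_T[OF p], of _ "affine_metric vol M p (X j p) (X k p)"])
      (use exhaust_2[of j] exhaust_2[of k] g p in auto)
  then have n: "nabla_g vol M \<sigma> (X i) (X j) (X k) p =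
      - (\<Gamma> i j 1 p * affine_metric vol M p (X 1 p) (X k p) + \<Gamma> i j 2 p * affine_metric vol M p (X 2 p) (X k p))
      - (\<Gamma> i k 1 p * affine_metric vol M p (X j p) (X 1 p) + \<Gamma> i k 2 p * affine_metric vol M p (X j p) (X 2 p))"
    for i j k
    by (simp add: nabla_g_def conn_eq[OF p] affine_metric_linear[OF vol surface tangent p])
  have "\<epsilon> p * nabla_g vol M \<sigma> (X 1) (X 1) (X 1) p + nabla_g vol M \<sigma> (X 1) (X 2) (X 2) p = 0 \<and>
    \<epsilon> p * nabla_g vol M \<sigma> (X 2) (X 1) (X 1) p + nabla_g vol M \<sigma> (X 2) (X 2) (X 2) p = 0 \<and>
    nabla_g vol M \<sigma> (X 2) (X 1) (X 1) p + nabla_g vol M \<sigma> (X 1) (X 2) (X 1) p = 0 \<and>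
    nabla_g vol M \<sigma> (X 1) (X 2) (X 2) p + nabla_g vol M \<sigma> (X 2) (X 1) (X 2) p = 0"
    using normal orthonormal p unfolding affine_normal_bundle_def Let_def by blast
  then show "\<Gamma> 1 1 1 p + \<Gamma> 1 2 2 p = 0" "\<Gamma> 2 1 1 p + \<Gamma> 2 2 2 p = 0"
    "2 * \<epsilon> p * \<Gamma> 2 1 1 p + \<Gamma> 1 1 2 p + \<epsilon> p * \<Gamma> 1 2 1 p = 0"
    "2 * \<Gamma> 1 2 2 p + \<Gamma> 2 1 2 p + \<epsilon> p * \<Gamma> 2 2 1 p = 0"
    unfolding n g[OF p] using \<epsilon>_cases[of p] by auto
qed

lemma second_derivative_transversal:
  assumes p: "p \<in> U"
  shows "cb b p (D M (\<lambda>q. D M (X j) q (X k q)) p (X l p))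
    = \<Gamma> k j 1 p * h b l 1 p + \<Gamma> k j 2 p * h b l 2 p + h 1 k j p * \<tau> 1 b l p + h 2 k j p * \<tau> 2 b l p"
proof -
  have "D M (\<lambda>q. cb b q (D M (X j) q (X k q))) p (X l p) = 0"
    by (rule D_locally_constant[OF p _ X_in_T[OF p], of _ "h b k j p"])
      (use exhaust_2[of b] exhaust_2[of j] exhaust_2[of k] p in \<open>auto simp: coefficient_eqs(2)[symmetric]\<close>)
  then show ?thesis
    using D_coefficients[OF p diff_DX[OF p]] by (simp add: coefficient_eqs[OF p])
qed

lemma D_commutator:
  assumes p: "p \<in> U"
  shows "D M (\<lambda>q. D M (X j) q (X 2 q)) p (X 1 p) - D M (\<lambda>q. D M (X j) q (X 1 q)) p (X 2 p)
    = (\<Gamma> 1 2 1 p - \<Gamma> 2 1 1 p) *\<^sub>R D M (X j) p (X 1 p) + (\<Gamma> 1 2 2 p - \<Gamma> 2 1 2 p) *\<^sub>R D M (X j) p (X 2 p)"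
proof (rule D_along_field[OF openU smoothX p])
  fix A B assume A: "linear A" and B: "bilinear B" "\<And>v w. B v w = B w v"
    and DA: "\<And>v. v \<in> T p \<Longrightarrow> D M (X j) p v = A v"
    and DB: "\<And>Y. (\<And>q. q \<in> U \<Longrightarrow> Y q \<in> T q) \<Longrightarrow> Y differentiable (at p within M) \<Longrightarrow>
        ((\<lambda>q. D M (X j) q (Y q)) has_derivative (\<lambda>w. B (Y p) w + A (D M Y p w))) (at p within M)"
  have "D M (\<lambda>q. D M (X j) q (X k q)) p (X l p) = B (X k p) (X l p) + A (D M (X k) p (X l p))" for k l
    by (rule D_eq[OF DB[OF X_in_T diffX[OF p]] X_in_T[OF p]])
  then have "D M (\<lambda>q. D M (X j) q (X 2 q)) p (X 1 p) - D M (\<lambda>q. D M (X j) q (X 1 q)) p (X 2 p)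
      = A (D M (X 2) p (X 1 p) - D M (X 1) p (X 2 p))"
    using B(2)[of "X 1 p" "X 2 p"] linear_diff[OF A] by simp
  also have "D M (X 2) p (X 1 p) - D M (X 1) p (X 2 p)
      = (\<Gamma> 1 2 1 p - \<Gamma> 2 1 1 p) *\<^sub>R X 1 p + (\<Gamma> 1 2 2 p - \<Gamma> 2 1 2 p) *\<^sub>R X 2 p"
    using p by (simp add: structure_X algebra_simps)
  finally show ?thesis using DA[OF X_in_T[OF p]] linear_add[OF A] linear_scale[OF A] by simp
qed

lemma codazzi:
  assumes p: "p \<in> U"
  shows "\<epsilon> p * \<tau> 1 2 1 p + \<tau> 2 1 1 p = 2 * \<tau> 1 1 2 p"
    and "\<tau> 1 1 2 p = \<tau> 2 1 1 p - 2 * \<Gamma> 1 2 1 p"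
    and "\<epsilon> p * \<tau> 1 2 2 p + \<tau> 2 1 2 p = - 2 * \<epsilon> p * \<tau> 1 1 1 p"
    and "\<tau> 2 1 2 p = 2 * \<Gamma> 2 2 1 p - 4 * \<epsilon> p * \<Gamma> 1 1 1 p - \<epsilon> p * \<tau> 1 1 1 p"
proof -
  have "cb b p (D M (\<lambda>q. D M (X j) q (X 2 q)) p (X 1 p)) - cb b p (D M (\<lambda>q. D M (X j) q (X 1 q)) p (X 2 p))
    = (\<Gamma> 1 2 1 p - \<Gamma> 2 1 1 p) * h b 1 j p + (\<Gamma> 1 2 2 p - \<Gamma> 2 1 2 p) * h b 2 j p" for b j
    using arg_cong[OF D_commutator[OF p, of j], of "cb b p"] by (simp add: coefficient_eqs[OF p])
  note c = this[unfolded second_derivative_transversal[OF p]]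
  have 11: "\<Gamma> 2 1 1 p + \<tau> 2 1 1 p - (- \<epsilon> p * \<Gamma> 1 1 2 p + \<tau> 1 1 2 p) = \<Gamma> 1 2 1 p - \<Gamma> 2 1 1 p"
    using c[where b=1 and j=1] p by (simp add: algebra_simps)
  have 12: "\<Gamma> 2 2 1 p - \<epsilon> p * \<tau> 1 1 1 p - (- \<epsilon> p * \<Gamma> 1 2 2 p + \<tau> 2 1 2 p)
      = - \<epsilon> p * (\<Gamma> 1 2 2 p - \<Gamma> 2 1 2 p)"
    using c[where b=1 and j=2] p by (simp add: algebra_simps)
  have 21: "\<Gamma> 2 1 2 p + \<tau> 2 2 1 p - (\<Gamma> 1 1 1 p + \<tau> 1 2 2 p) = \<Gamma> 1 2 2 p - \<Gamma> 2 1 2 p"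
    using c[where b=2 and j=1] p by (simp add: algebra_simps)
  have 22: "\<Gamma> 2 2 2 p - \<epsilon> p * \<tau> 1 2 1 p - (\<Gamma> 1 2 1 p + \<tau> 2 2 2 p) = \<Gamma> 1 2 1 p - \<Gamma> 2 1 1 p"
    using c[where b=2 and j=2] p by (simp add: algebra_simps)
  note all = 11 12 21 22 trace[OF p, of 1] trace[OF p, of 2] metric_equations[OF p]
  show "\<epsilon> p * \<tau> 1 2 1 p + \<tau> 2 1 1 p = 2 * \<tau> 1 1 2 p" "\<tau> 1 1 2 p = \<tau> 2 1 1 p - 2 * \<Gamma> 1 2 1 p"
    "\<epsilon> p * \<tau> 1 2 2 p + \<tau> 2 1 2 p = - 2 * \<epsilon> p * \<tau> 1 1 1 p"
    "\<tau> 2 1 2 p = 2 * \<Gamma> 2 2 1 p - 4 * \<epsilon> p * \<Gamma> 1 1 1 p - \<epsilon> p * \<tau> 1 1 1 p"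
    using \<epsilon>_cases[of p] all by (elim disjE; simp; linarith)+
qed

lemma cubic_eq:
  assumes p: "p \<in> U"
  shows "cubic M \<sigma> \<xi> b (X j) (X k) (X l) p
    = - (\<Gamma> j k 1 p * h b 1 l p + \<Gamma> j k 2 p * h b 2 l p) - (\<Gamma> j l 1 p * h b k 1 p + \<Gamma> j l 2 p * h b k 2 p)
      + \<tau> 1 b j p * h 1 k l p + \<tau> 2 b j p * h 2 k l p"
proof -
  have 0: "D M (h_coeff M \<sigma> \<xi> b (X k) (X l)) p (X j p) = 0"
    by (rule D_locally_constant[OF p _ X_in_T[OF p], of _ "h b k l p"])
      (use exhaust_2[of b] exhaust_2[of k] exhaust_2[of l] p in auto)
  have 1: "h_coeff M \<sigma> \<xi> b (conn M \<sigma> (X j) (X k)) (X l) p = \<Gamma> j k 1 p * h b 1 l p + \<Gamma> j k 2 p * h b 2 l p"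
    using D_linear[OF diffX[OF p], of l]
    by (simp add: coefficient_eqs(2)[OF p] conn_eq[OF p] linear_add linear_scale)
  have dZ: "conn M \<sigma> (X j) (X l) differentiable (at p within M)"
    by (rule differentiable_cong[OF p differentiable_add[OF
          differentiable_scaleR[OF diff_coefficients(1)[OF p] diffX[OF p]]
          differentiable_scaleR[OF diff_coefficients(1)[OF p] diffX[OF p]]]])
      (rule conn_eq[symmetric])
  have "D M (\<lambda>q. cb b q (conn M \<sigma> (X j) (X l) q)) p (X k p) = 0"
    by (rule D_locally_constant[OF p _ X_in_T[OF p], of _ 0]) (simp add: conn_eq)
  then have 2: "h_coeff M \<sigma> \<xi> b (X k) (conn M \<sigma> (X j) (X l)) p = \<Gamma> j l 1 p * h b k 1 p + \<Gamma> j l 2 p * h b k 2 p"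
    using D_coefficients[OF p dZ, of b k] p by (simp add: coefficient_eqs(2)[OF p] conn_eq[OF p])
  show ?thesis unfolding cubic_def nabla_h_def 0 1 2 by simp
qed

lemma F_entries:
  assumes p: "p \<in> U"
  shows "F_mat vol M \<sigma> X \<xi> p $ 1 $ 1 = 4 * (\<tau> 1 1 2 p - \<Gamma> 2 1 1 p)"
    "F_mat vol M \<sigma> X \<xi> p $ 1 $ 2 = 4 * \<epsilon> p * (\<tau> 1 1 1 p + \<Gamma> 1 1 1 p)"
    "F_mat vol M \<sigma> X \<xi> p $ 2 $ 1 = 4 * (\<Gamma> 1 1 1 p - \<tau> 1 1 1 p)"
    "F_mat vol M \<sigma> X \<xi> p $ 2 $ 2 = 4 * (\<Gamma> 2 1 1 p + \<tau> 1 1 2 p)"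
  using \<epsilon>_cases[of p] p trace[OF p, of 1] trace[OF p, of 2] metric_equations[OF p] codazzi[OF p]
  by (simp_all add: F_mat_def Let_def cubic_eq[OF p]) (elim disjE; simp; linarith)+

end

section \<open>Parallel forms vanishing on the surface\<close>

lemma vector_4 [simp]:
  "(vector [w, x, y, z] :: 'a::zero^4) $ 1 = w" "(vector [w, x, y, z] :: 'a^4) $ 2 = x"
  "(vector [w, x, y, z] :: 'a^4) $ 3 = y" "(vector [w, x, y, z] :: 'a^4) $ 4 = z"
  unfolding vector_def by simp_all

locale alternating2 =
  fixes \<omega> :: "'a::euclidean_space \<Rightarrow> 'a \<Rightarrow> real"
  assumes bil: "bilinear \<omega>" and alt: "\<omega> v v = 0"
begin

lemma form_linear [simp]:
  "\<omega> (x + y) z = \<omega> x z + \<omega> y z" "\<omega> z (x + y) = \<omega> z x + \<omega> z y"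
  "\<omega> (r *\<^sub>R x) z = r * \<omega> x z" "\<omega> z (r *\<^sub>R x) = r * \<omega> z x"
  "\<omega> (- x) z = - \<omega> x z" "\<omega> z (- x) = - \<omega> z x" "\<omega> 0 z = 0" "\<omega> z 0 = 0"
  "\<omega> (x - y) z = \<omega> x z - \<omega> y z" "\<omega> z (x - y) = \<omega> z x - \<omega> z y"
  using bil by (simp_all add: bilinear_ladd bilinear_radd bilinear_lmul bilinear_rmul
      bilinear_lneg bilinear_rneg bilinear_lzero bilinear_rzero bilinear_lsub bilinear_rsub)

lemma alt_simp [simp]: "\<omega> v v = 0" by (rule alt)

lemma swap: "\<omega> y x = - \<omega> x y"
proof -
  have "\<omega> (x + y) (x + y) = \<omega> x y + \<omega> y x" by (subst form_linear(1), subst (1 2) form_linear(2)) simp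
  then show ?thesis using alt[of "x + y"] by linarith
qed

lemma derivative:
  assumes "(f has_derivative f') (at p within M)" "(g has_derivative g') (at p within M)"
  shows "((\<lambda>q. \<omega> (f q) (g q)) has_derivative (\<lambda>v. \<omega> (f p) (g' v) + \<omega> (f' v) (g p))) (at p within M)"
  by (rule bounded_bilinear.FDERIV[OF bilinear_conv_bounded_bilinear[THEN iffD1, OF bil] assms])

end

definition lagrangian_near :: "r4 set \<Rightarrow> (r4 \<Rightarrow> r4 \<Rightarrow> real) \<Rightarrow> r4 \<Rightarrow> bool" where
  "lagrangian_near M \<omega> p \<longleftrightarrow>
    (\<exists>W. open W \<and> p \<in> W \<and> (\<forall>q\<in>M \<inter> W. \<forall>v\<in>tangent_space M q. \<forall>w\<in>tangent_space M q. \<omega> v w = 0))"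

context adapted
begin

text \<open>The volume, metric and Codazzi equations leave six free coefficients
  \<open>\<Gamma> 1 1 1, \<Gamma> 2 1 1, \<Gamma> 1 2 1, \<Gamma> 2 2 1, \<tau> 1 1 1, \<tau> 1 1 2\<close>, in terms of which the remaining ones are
  expressed.\<close>

lemma reduced:
  assumes p: "p \<in> U"
  shows "\<Gamma> 1 2 2 p = - \<Gamma> 1 1 1 p" "\<Gamma> 2 2 2 p = - \<Gamma> 2 1 1 p"
    "\<Gamma> 1 1 2 p = - 2 * \<epsilon> p * \<Gamma> 2 1 1 p - \<epsilon> p * \<Gamma> 1 2 1 p"
    "\<Gamma> 2 1 2 p = 2 * \<Gamma> 1 1 1 p - \<epsilon> p * \<Gamma> 2 2 1 p"
    "\<tau> 2 2 k p = - \<tau> 1 1 k p"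
    "\<tau> 2 1 1 p = \<tau> 1 1 2 p + 2 * \<Gamma> 1 2 1 p"
    "\<tau> 1 2 1 p = \<epsilon> p * \<tau> 1 1 2 p - 2 * \<epsilon> p * \<Gamma> 1 2 1 p"
    "\<tau> 2 1 2 p = 2 * \<Gamma> 2 2 1 p - 4 * \<epsilon> p * \<Gamma> 1 1 1 p - \<epsilon> p * \<tau> 1 1 1 p"
    "\<tau> 1 2 2 p = 4 * \<Gamma> 1 1 1 p - \<tau> 1 1 1 p - 2 * \<epsilon> p * \<Gamma> 2 2 1 p"
proof -
  note all = trace[OF p, of 1] trace[OF p, of 2] metric_equations[OF p] codazzi[OF p]
  have k: "k = 1 \<or> k = 2" by (rule exhaust_2)
  show "\<Gamma> 1 2 2 p = - \<Gamma> 1 1 1 p" "\<Gamma> 2 2 2 p = - \<Gamma> 2 1 1 p"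
    "\<Gamma> 1 1 2 p = - 2 * \<epsilon> p * \<Gamma> 2 1 1 p - \<epsilon> p * \<Gamma> 1 2 1 p"
    "\<Gamma> 2 1 2 p = 2 * \<Gamma> 1 1 1 p - \<epsilon> p * \<Gamma> 2 2 1 p"
    "\<tau> 2 1 1 p = \<tau> 1 1 2 p + 2 * \<Gamma> 1 2 1 p"
    "\<tau> 1 2 1 p = \<epsilon> p * \<tau> 1 1 2 p - 2 * \<epsilon> p * \<Gamma> 1 2 1 p"
    "\<tau> 2 1 2 p = 2 * \<Gamma> 2 2 1 p - 4 * \<epsilon> p * \<Gamma> 1 1 1 p - \<epsilon> p * \<tau> 1 1 1 p"
    "\<tau> 1 2 2 p = 4 * \<Gamma> 1 1 1 p - \<tau> 1 1 1 p - 2 * \<epsilon> p * \<Gamma> 2 2 1 p"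
    using \<epsilon>_cases[of p] all by (elim disjE; simp; linarith)+
  show "\<tau> 2 2 k p = - \<tau> 1 1 k p" using k all by (elim disjE; simp; linarith)
qed

lemma H_kernel:
  assumes p: "p \<in> U"
  shows "H_mat vol M \<sigma> X \<xi> p *v vector [a, b] = 0 \<longleftrightarrow>
    (\<Lambda> 1 1 1 p - \<Lambda> 2 1 2 p) * a + (- \<epsilon> p * \<Lambda> 1 1 2 p - \<Lambda> 2 1 1 p) * b = 0 \<and>
    (\<Lambda> 1 2 1 p - \<Lambda> 2 2 2 p) * a + (- \<epsilon> p * \<Lambda> 1 2 2 p - \<Lambda> 2 2 1 p) * b = 0 \<and>
    (\<tau> 1 1 2 p - \<Gamma> 2 1 1 p) * a + \<epsilon> p * (\<tau> 1 1 1 p + \<Gamma> 1 1 1 p) * b = 0 \<and>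
    (\<Gamma> 1 1 1 p - \<tau> 1 1 1 p) * a + (\<Gamma> 2 1 1 p + \<tau> 1 1 2 p) * b = 0"
proof -
  have 4: "4 * x * a + 4 * y * b = 0 \<longleftrightarrow> x * a + y * b = 0" for x y :: real
  proof -
    have "4 * x * a + 4 * y * b = 4 * (x * a + y * b)" by (simp add: algebra_simps)
    then show ?thesis by (simp only: mult_eq_0_iff) simp
  qed
  show ?thesis
    using 4[of "\<tau> 1 1 2 p - \<Gamma> 2 1 1 p" "\<epsilon> p * (\<tau> 1 1 1 p + \<Gamma> 1 1 1 p)"]
      4[of "\<Gamma> 1 1 1 p - \<tau> 1 1 1 p" "\<Gamma> 2 1 1 p + \<tau> 1 1 2 p"]
    by (simp add: vec_eq_iff forall_4 matrix_vector_mult_def sum_2 H_mat_def F_entries[OF p] mult.assoc)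
      (simp add: L_mat_def Let_def)
qed

text \<open>The conditions at \<open>p\<close> forced on a constant form that vanishes on the tangent planes near
  \<open>p\<close>; \<open>[a, b]\<close> is the kernel vector \<open>[A, B]\<close> of the paper.\<close>

definition solution :: "(r4 \<Rightarrow> r4 \<Rightarrow> real) \<Rightarrow> r4 \<Rightarrow> real \<Rightarrow> real \<Rightarrow> bool" where
  "solution \<omega> p a b \<longleftrightarrow> \<omega> (X 1 p) (X 2 p) = 0 \<and> \<omega> (X 1 p) (\<xi> 1 p) = b \<and> \<omega> (X 2 p) (\<xi> 1 p) = a \<and>
     \<omega> (X 1 p) (\<xi> 2 p) = a \<and> \<omega> (X 2 p) (\<xi> 2 p) = - \<epsilon> p * b \<and> \<omega> (\<xi> 1 p) (\<xi> 2 p) = 0 \<and>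
     H_mat vol M \<sigma> X \<xi> p *v vector [a, b] = 0"

lemma D_vanishing_near:
  assumes p: "p \<in> U" and L: "lagrangian_near M \<omega> p"
    and f: "\<And>q. q \<in> U \<Longrightarrow> lagrangian_near M \<omega> q \<Longrightarrow> \<epsilon> q = \<epsilon> p \<Longrightarrow> f q = 0" and v: "v \<in> T p"
  shows "D M f p v = 0"
proof -
  obtain W where W: "open W" "p \<in> W" "\<And>q. q \<in> M \<Longrightarrow> q \<in> W \<Longrightarrow> q \<in> U \<and> \<epsilon> q = \<epsilon> p"
    by (rule \<epsilon>_locally_constant[OF p]) (rule that)
  obtain W' where W': "open W'" "p \<in> W'" "\<forall>q\<in>M \<inter> W'. \<forall>v\<in>T q. \<forall>w\<in>T q. \<omega> v w = 0"
    using L unfolding lagrangian_near_def by blast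
  have Lq: "lagrangian_near M \<omega> q" if "q \<in> W'" for q
    unfolding lagrangian_near_def using W' that by blast
  have "(f has_derivative (\<lambda>_. 0)) (at p within M)"
    by (rule has_derivative_cong_within_open[OF has_derivative_const open_Int[OF W(1) W'(1)] _ inM[OF p]])
      (use W W' Lq f in auto)
  from D_eq[OF this v] show ?thesis .
qed

end

locale lagrangian_form = adapted vol M \<sigma> U X \<xi> + form: alternating2 \<omega>
  for vol M \<sigma> U X \<xi> and \<omega> :: "r4 \<Rightarrow> r4 \<Rightarrow> real"
begin

lemma D_form:
  assumes p: "p \<in> U"
  shows "D M (\<lambda>q. \<omega> (X i q) (X j q)) p (X k p) = \<omega> (X i p) (D M (X j) p (X k p)) + \<omega> (D M (X i) p (X k p)) (X j p)"
    and "D M (\<lambda>q. \<omega> (X i q) (\<xi> j q)) p (X k p) = \<omega> (X i p) (D M (\<xi> j) p (X k p)) + \<omega> (D M (X i) p (X k p)) (\<xi> j p)"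
    and "D M (\<lambda>q. \<omega> (\<xi> i q) (\<xi> j q)) p (X k p) = \<omega> (\<xi> i p) (D M (\<xi> j) p (X k p)) + \<omega> (D M (\<xi> i) p (X k p)) (\<xi> j p)"
    and "(\<lambda>q. \<omega> (X i q) (\<xi> j q)) differentiable (at p within M)"
  using form.derivative[OF D_has_derivative[OF diffX[OF p]] D_has_derivative[OF diffX[OF p]]]
    form.derivative[OF D_has_derivative[OF diffX[OF p]] D_has_derivative[OF diff\<xi>[OF p]]]
    form.derivative[OF D_has_derivative[OF diff\<xi>[OF p]] D_has_derivative[OF diff\<xi>[OF p]]]
    D_eq[OF _ X_in_T[OF p]] differentiableI by blast+

lemma swaps:
  "\<omega> (X 2 p) (X 1 p) = - \<omega> (X 1 p) (X 2 p)" "\<omega> (\<xi> i p) (X j p) = - \<omega> (X j p) (\<xi> i p)"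
  "\<omega> (\<xi> 2 p) (\<xi> 1 p) = - \<omega> (\<xi> 1 p) (\<xi> 2 p)"
  by (rule form.swap)+

lemma lagrangian_first_order:
  assumes p: "p \<in> U" and L: "lagrangian_near M \<omega> p"
  shows "\<omega> (X 1 p) (X 2 p) = 0" "\<omega> (X 1 p) (\<xi> 2 p) = \<omega> (X 2 p) (\<xi> 1 p)"
    "\<omega> (X 2 p) (\<xi> 2 p) = - \<epsilon> p * \<omega> (X 1 p) (\<xi> 1 p)"
proof -
  have XX: "\<omega> (X 1 q) (X 2 q) = 0" if "q \<in> U" "lagrangian_near M \<omega> q" for q
    using that X_in_T inM unfolding lagrangian_near_def by blast
  have "D M (\<lambda>q. \<omega> (X 1 q) (X 2 q)) p (X k p) = 0" for k
    by (rule D_vanishing_near[OF p L XX X_in_T[OF p]])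
  then have "\<omega> (X 1 p) (D M (X 2) p (X k p)) + \<omega> (D M (X 1) p (X k p)) (X 2 p) = 0" for k
    by (simp only: D_form[OF p])
  from this[of 1] this[of 2] show "\<omega> (X 1 p) (\<xi> 2 p) = \<omega> (X 2 p) (\<xi> 1 p)"
    "\<omega> (X 2 p) (\<xi> 2 p) = - \<epsilon> p * \<omega> (X 1 p) (\<xi> 1 p)"
    using p XX[OF p L] by (simp_all add: structure_X swaps)
  show "\<omega> (X 1 p) (X 2 p) = 0" by (rule XX[OF p L])
qed

lemma lagrangian_second_order:
  assumes p: "p \<in> U" and L: "lagrangian_near M \<omega> p"
  shows "\<omega> (\<xi> 1 p) (\<xi> 2 p) = 0"
    and "(\<tau> 1 1 2 p - \<Gamma> 2 1 1 p) * \<omega> (X 2 p) (\<xi> 1 p) + \<epsilon> p * (\<tau> 1 1 1 p + \<Gamma> 1 1 1 p) * \<omega> (X 1 p) (\<xi> 1 p) = 0"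
    and "(\<Gamma> 1 1 1 p - \<tau> 1 1 1 p) * \<omega> (X 2 p) (\<xi> 1 p) + (\<Gamma> 2 1 1 p + \<tau> 1 1 2 p) * \<omega> (X 1 p) (\<xi> 1 p) = 0"
proof -
  note dd = D_has_derivative[OF D_form(4)[OF p]]
  have z1: "D M (\<lambda>q. \<omega> (X 1 q) (\<xi> 2 q) - \<omega> (X 2 q) (\<xi> 1 q)) p (X k p) = 0" for k
    by (rule D_vanishing_near[OF p L _ X_in_T[OF p]]) (simp add: lagrangian_first_order)
  have z2: "D M (\<lambda>q. \<omega> (X 2 q) (\<xi> 2 q) + \<epsilon> p * \<omega> (X 1 q) (\<xi> 1 q)) p (X k p) = 0" for k
    by (rule D_vanishing_near[OF p L _ X_in_T[OF p]]) (metis add.left_inverse lagrangian_first_order(3) minus_mult_left)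
  note e1 = z1[unfolded D_eq[OF has_derivative_diff[OF dd dd] X_in_T[OF p]], unfolded D_form[OF p]]
  note e2 = z2[unfolded D_eq[OF has_derivative_add[OF dd has_derivative_mult_right[OF dd]] X_in_T[OF p]], unfolded D_form[OF p]]
  note first = lagrangian_first_order[OF p L]
  define A B C where "A = \<omega> (X 2 p) (\<xi> 1 p)" and "B = \<omega> (X 1 p) (\<xi> 1 p)" and "C = \<omega> (\<xi> 1 p) (\<xi> 2 p)"
  note rules = structure_X[OF p] structure_\<xi>[OF p] h_values[OF p] swaps first reduced[OF p]
    A_def[symmetric] B_def[symmetric] C_def[symmetric] algebra_simps
  have e: "\<epsilon> p = 1 \<or> \<epsilon> p = -1" by (rule \<epsilon>_cases)
  have "C = 0 \<and> (\<tau> 1 1 2 p - \<Gamma> 2 1 1 p) * A + \<epsilon> p * (\<tau> 1 1 1 p + \<Gamma> 1 1 1 p) * B = 0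
    \<and> (\<Gamma> 1 1 1 p - \<tau> 1 1 1 p) * A + (\<Gamma> 2 1 1 p + \<tau> 1 1 2 p) * B = 0"
    using e e1[of 1] e1[of 2] e2[of 1] e2[of 2] by (elim disjE) (simp_all add: rules)
  then show "\<omega> (\<xi> 1 p) (\<xi> 2 p) = 0"
    "(\<tau> 1 1 2 p - \<Gamma> 2 1 1 p) * \<omega> (X 2 p) (\<xi> 1 p) + \<epsilon> p * (\<tau> 1 1 1 p + \<Gamma> 1 1 1 p) * \<omega> (X 1 p) (\<xi> 1 p) = 0"
    "(\<Gamma> 1 1 1 p - \<tau> 1 1 1 p) * \<omega> (X 2 p) (\<xi> 1 p) + (\<Gamma> 2 1 1 p + \<tau> 1 1 2 p) * \<omega> (X 1 p) (\<xi> 1 p) = 0"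
    by (simp_all add: A_def B_def C_def)
qed

lemma lagrangian_imp_solution:
  assumes p: "p \<in> U" and L: "lagrangian_near M \<omega> p"
  shows "solution \<omega> p (\<omega> (X 2 p) (\<xi> 1 p)) (\<omega> (X 1 p) (\<xi> 1 p))"
proof -
  note first = lagrangian_first_order[OF p L]
  have "D M (\<lambda>q. \<omega> (\<xi> 1 q) (\<xi> 2 q)) p (X k p) = 0" for k
    by (rule D_vanishing_near[OF p L lagrangian_second_order(1) X_in_T[OF p]])
  then have z: "\<omega> (\<xi> 1 p) (D M (\<xi> 2) p (X k p)) + \<omega> (D M (\<xi> 1) p (X k p)) (\<xi> 2 p) = 0" for k
    by (simp only: D_form[OF p])
  have "(\<Lambda> 1 k 1 p - \<Lambda> 2 k 2 p) * \<omega> (X 2 p) (\<xi> 1 p) + (- \<epsilon> p * \<Lambda> 1 k 2 p - \<Lambda> 2 k 1 p) * \<omega> (X 1 p) (\<xi> 1 p) = 0" for k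
    using z[of k] lagrangian_second_order(1)[OF p L]
    by (simp add: structure_\<xi>[OF p] swaps first algebra_simps)
  then show ?thesis
    using lagrangian_first_order[OF p L] lagrangian_second_order[OF p L]
    by (simp add: solution_def H_kernel[OF p])
qed

lemma D_solution:
  assumes p: "p \<in> U" and s: "solution \<omega> p a b"
  shows "a * D M (\<lambda>q. \<omega> (X 1 q) (\<xi> 1 q)) p (X 1 p) - b * D M (\<lambda>q. \<omega> (X 2 q) (\<xi> 1 q)) p (X 1 p)
      = - \<epsilon> p * G1 vol M \<sigma> X \<xi> p * (a * a + \<epsilon> p * (b * b))"
    and "a * D M (\<lambda>q. \<omega> (X 1 q) (\<xi> 1 q)) p (X 2 p) - b * D M (\<lambda>q. \<omega> (X 2 q) (\<xi> 1 q)) p (X 2 p)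
      = G2 vol M \<sigma> X \<xi> p * (a * a + \<epsilon> p * (b * b))"
proof -
  have v: "\<omega> (X 1 p) (X 2 p) = 0" "\<omega> (X 1 p) (\<xi> 1 p) = b" "\<omega> (X 2 p) (\<xi> 1 p) = a"
     "\<omega> (X 1 p) (\<xi> 2 p) = a" "\<omega> (X 2 p) (\<xi> 2 p) = - \<epsilon> p * b" "\<omega> (\<xi> 1 p) (\<xi> 2 p) = 0"
    and F: "(\<tau> 1 1 2 p - \<Gamma> 2 1 1 p) * a + \<epsilon> p * (\<tau> 1 1 1 p + \<Gamma> 1 1 1 p) * b = 0"
     "(\<Gamma> 1 1 1 p - \<tau> 1 1 1 p) * a + (\<Gamma> 2 1 1 p + \<tau> 1 1 2 p) * b = 0"
    using s by (simp_all only: solution_def H_kernel[OF p])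
  note rules = D_form[OF p] structure_X[OF p] structure_\<xi>[OF p] h_values[OF p] swaps v reduced[OF p]
    G1_def G2_def
  have e2: "\<epsilon> p * \<epsilon> p = 1" by simp
  show "a * D M (\<lambda>q. \<omega> (X 1 q) (\<xi> 1 q)) p (X 1 p) - b * D M (\<lambda>q. \<omega> (X 2 q) (\<xi> 1 q)) p (X 1 p)
      = - \<epsilon> p * G1 vol M \<sigma> X \<xi> p * (a * a + \<epsilon> p * (b * b))"
    apply (simp add: rules)
    using F e2 by algebra
  show "a * D M (\<lambda>q. \<omega> (X 1 q) (\<xi> 1 q)) p (X 2 p) - b * D M (\<lambda>q. \<omega> (X 2 q) (\<xi> 1 q)) p (X 2 p)
      = G2 vol M \<sigma> X \<xi> p * (a * a + \<epsilon> p * (b * b))"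
    apply (simp add: rules)
    using F e2 by algebra
qed

end

lemma positive_near:
  fixes f :: "r4 \<Rightarrow> real"
  assumes "continuous (at p within M) f" "f p > 0"
  obtains W where "open W" "p \<in> W" "\<And>q. q \<in> M \<Longrightarrow> q \<in> W \<Longrightarrow> f q > 0"
proof -
  obtain d where d: "d > 0" "\<And>q. q \<in> M \<Longrightarrow> dist q p < d \<Longrightarrow> dist (f q) (f p) < f p"
    using assms unfolding continuous_within_eps_delta by blast
  show ?thesis
  proof (rule that[of "ball p d"])
    fix q assume q: "q \<in> M" "q \<in> ball p d"
    then have "dist q p < d" by (simp add: dist_commute)
    then have "dist (f q) (f p) < f p" by (rule d(2)[OF q(1)])
    then show "f q > 0" by (simp add: dist_real_def)
  qed (use d in auto)
qed

lemma is_eta_arctan: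
  shows "a \<noteq> 0 \<Longrightarrow> is_eta 1 a b (arctan (b / a))"
    and "b \<noteq> 0 \<Longrightarrow> is_eta 1 a b (pi / 2 - arctan (a / b))"
proof -
  have *: "s * sin (arctan (r / s)) = r * cos (arctan (r / s))" if "s \<noteq> 0" for r s :: real
  proof -
    have "sin (arctan (r / s)) = (r / s) * cos (arctan (r / s))"
      by (metis cos_arctan_not_zero nonzero_eq_divide_eq tan_arctan tan_def)
    then show ?thesis using that by (metis mult.assoc nonzero_mult_div_cancel_left times_divide_eq_right)
  qed
  show "a \<noteq> 0 \<Longrightarrow> is_eta 1 a b (arctan (b / a))" using *[of a b] by (simp add: is_eta_def)
  show "b \<noteq> 0 \<Longrightarrow> is_eta 1 a b (pi / 2 - arctan (a / b))"
    using *[of b a] by (simp add: is_eta_def sin_diff cos_diff)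
qed

lemma tanh_artanh_real:
  fixes x :: real
  assumes "\<bar>x\<bar> < 1"
  shows "tanh (artanh x) = x"
proof -
  have pos: "1 + x > 0" "1 - x > 0" using assms by linarith+
  have "exp (- 2 * artanh x) = inverse (exp (ln ((1 + x) / (1 - x))))"
    by (simp add: artanh_def exp_minus)
  also have "\<dots> = (1 - x) / (1 + x)" using pos by simp
  finally have "tanh (artanh x) = (1 - (1 - x) / (1 + x)) / (1 + (1 - x) / (1 + x))"
    by (simp only: tanh_real_altdef)
  also have "\<dots> = x" using pos by (simp add: field_simps)
  finally show ?thesis .
qed

lemma is_eta_artanh:
  shows "\<bar>b\<bar> < \<bar>a\<bar> \<Longrightarrow> is_eta (-1) a b (artanh (b / a))"
    and "\<bar>a\<bar> < \<bar>b\<bar> \<Longrightarrow> is_eta (-1) a b (artanh (a / b))"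
proof -
  have *: "s * sinh (artanh (r / s)) = r * cosh (artanh (r / s))" if "\<bar>r\<bar> < \<bar>s\<bar>" for r s :: real
  proof -
    have s: "s \<noteq> 0" using that by auto
    have x: "\<bar>r / s\<bar> < 1" using that by simp
    have "tanh (artanh (r / s)) = r / s" by (rule tanh_artanh_real[OF x])
    then have "sinh (artanh (r / s)) = (r / s) * cosh (artanh (r / s))"
      by (metis cosh_real_nonzero nonzero_eq_divide_eq tanh_def)
    then show ?thesis using s by simp
  qed
  show "\<bar>b\<bar> < \<bar>a\<bar> \<Longrightarrow> is_eta (-1) a b (artanh (b / a))" using *[of b a] by (simp add: is_eta_def)
  show "\<bar>a\<bar> < \<bar>b\<bar> \<Longrightarrow> is_eta (-1) a b (artanh (a / b))" using *[of a b] by (simp add: is_eta_def)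
qed

section \<open>The function \<open>\<eta>\<close> and the kernel of \<open>H\<close>\<close>

lemma eta_derivative_algebra:
  fixes a b x y :: real
  shows "a \<noteq> 0 \<Longrightarrow> (y * a - b * x) / (a * a) * inverse (1 + (b / a)\<^sup>2) = (a * y - b * x) / (a * a + b * b)"
    and "\<bar>b\<bar> < \<bar>a\<bar> \<Longrightarrow> (y * a - b * x) / (a * a) * (1 / (1 - (b / a)\<^sup>2)) = (a * y - b * x) / (a * a - b * b)"
proof -
  show "(y * a - b * x) / (a * a) * inverse (1 + (b / a)\<^sup>2) = (a * y - b * x) / (a * a + b * b)" if a: "a \<noteq> 0"
  proof -
    have n: "a * a + b * b \<noteq> 0" using a by (simp add: sum_squares_eq_zero_iff)
    have "1 + (b / a)\<^sup>2 = (a * a + b * b) / (a * a)" using a by (simp add: field_simps power2_eq_square)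
    then show ?thesis using a n by (simp add: mult.commute)
  qed
  show "(y * a - b * x) / (a * a) * (1 / (1 - (b / a)\<^sup>2)) = (a * y - b * x) / (a * a - b * b)" if ab: "\<bar>b\<bar> < \<bar>a\<bar>"
  proof -
    have a: "a \<noteq> 0" using ab by auto
    have "b * b \<noteq> a * a" using ab by (metis abs_mult_less abs_mult_self_eq less_irrefl)
    then have n: "a * a - b * b \<noteq> 0" by simp
    have "1 - (b / a)\<^sup>2 = (a * a - b * b) / (a * a)" using a by (simp add: field_simps power2_eq_square)
    then show ?thesis using a n by (simp add: mult.commute)
  qed
qed

lemma local_eta:
  fixes A B :: "r4 \<Rightarrow> real"
  assumes e: "e = 1 \<or> e = -1" and W0: "open W0" "p \<in> W0" "p \<in> M"
    and A: "\<And>q. q \<in> M \<Longrightarrow> q \<in> W0 \<Longrightarrow> A differentiable (at q within M)"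
    and B: "\<And>q. q \<in> M \<Longrightarrow> q \<in> W0 \<Longrightarrow> B differentiable (at q within M)"
    and n: "A p * A p + e * (B p * B p) \<noteq> 0"
  obtains W \<eta> where "open W" "p \<in> W" "W \<subseteq> W0"
    and "\<And>q. q \<in> M \<Longrightarrow> q \<in> W \<Longrightarrow> is_eta e (A q) (B q) (\<eta> q)"
    and "\<And>q. q \<in> M \<Longrightarrow> q \<in> W \<Longrightarrow> (\<eta> has_derivative
      (\<lambda>v. (A q * D M B q v - B q * D M A q v) / (A q * A q + e * (B q * B q)))) (at q within M)"
proof -
  have cA: "continuous (at p within M) A" and cB: "continuous (at p within M) B"
    using A B W0 differentiable_imp_continuous_within by blast+
  note result = that
  note dA = D_has_derivative[OF A] and dB = D_has_derivative[OF B]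
  have main: thesis if f: "continuous (at p within M) f" "f p > 0"
    and eta: "\<And>q. f q > 0 \<Longrightarrow> is_eta e (A q) (B q) (\<eta> q)"
    and der: "\<And>q. q \<in> M \<Longrightarrow> q \<in> W0 \<Longrightarrow> f q > 0 \<Longrightarrow> (\<eta> has_derivative
      (\<lambda>v. (A q * D M B q v - B q * D M A q v) / (A q * A q + e * (B q * B q)))) (at q within M)" for f \<eta> :: "r4 \<Rightarrow> real"
  proof (rule positive_near[OF f])
    fix W assume W: "open W" "p \<in> W" "\<And>q. q \<in> M \<Longrightarrow> q \<in> W \<Longrightarrow> f q > 0"
    show thesis
      by (rule result[of "W \<inter> W0" \<eta>]) (use W W0 eta der in auto)
  qed
  consider (1) "e = 1" "A p \<noteq> 0" | (2) "e = 1" "B p \<noteq> 0" | (3) "e = -1" "\<bar>B p\<bar> < \<bar>A p\<bar>" | (4) "e = -1" "\<bar>A p\<bar> < \<bar>B p\<bar>"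
  proof -
    have "\<bar>A p\<bar> \<noteq> \<bar>B p\<bar>" if "e = -1" using n that by (auto simp: abs_eq_iff)
    then show ?thesis using that e n by (cases "A p = 0"; cases "e = 1") (auto simp: neq_iff)
  qed
  then show thesis
  proof cases
    case 1
    show thesis
    proof (rule main[of "\<lambda>q. A q * A q" "\<lambda>q. arctan (B q / A q)"])
      show "continuous (at p within M) (\<lambda>q. A q * A q)" by (intro continuous_mult cA)
      show "A p * A p > 0" using 1 by (metis not_real_square_gt_zero)
      show "is_eta e (A q) (B q) (arctan (B q / A q))" if "A q * A q > 0" for q
        using is_eta_arctan(1)[of "A q" "B q"] that 1 by (cases "A q = 0") auto
      fix q assume q: "q \<in> M" "q \<in> W0" "A q * A q > 0"
      then have a: "A q \<noteq> 0" by auto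
      have "((\<lambda>q. arctan (B q / A q)) has_derivative
        (\<lambda>v. (D M B q v * A q - B q * D M A q v) / (A q * A q) * inverse (1 + (B q / A q)\<^sup>2))) (at q within M)"
        by (rule has_derivative_arctan[OF has_derivative_divide'[OF dB[OF q(1,2)] dA[OF q(1,2)] a]])
      then show "((\<lambda>q. arctan (B q / A q)) has_derivative
        (\<lambda>v. (A q * D M B q v - B q * D M A q v) / (A q * A q + e * (B q * B q)))) (at q within M)"
        unfolding eta_derivative_algebra(1)[OF a] using 1 by simp
    qed
  next
    case 2
    show thesis
    proof (rule main[of "\<lambda>q. B q * B q" "\<lambda>q. pi / 2 - arctan (A q / B q)"])
      show "continuous (at p within M) (\<lambda>q. B q * B q)" by (intro continuous_mult cB)
      show "B p * B p > 0" using 2 by (metis not_real_square_gt_zero)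
      show "is_eta e (A q) (B q) (pi / 2 - arctan (A q / B q))" if "B q * B q > 0" for q
        using is_eta_arctan(2)[of "B q" "A q"] that 2 by (cases "B q = 0") auto
      fix q assume q: "q \<in> M" "q \<in> W0" "B q * B q > 0"
      then have b: "B q \<noteq> 0" by auto
      have "((\<lambda>q. pi / 2 - arctan (A q / B q)) has_derivative
        (\<lambda>v. 0 - (D M A q v * B q - A q * D M B q v) / (B q * B q) * inverse (1 + (A q / B q)\<^sup>2))) (at q within M)"
        by (rule has_derivative_diff[OF has_derivative_const
            has_derivative_arctan[OF has_derivative_divide'[OF dA[OF q(1,2)] dB[OF q(1,2)] b]]])
      moreover have "0 - (B q * x - A q * y) / (B q * B q + A q * A q)
          = (A q * y - B q * x) / (A q * A q + e * (B q * B q))" for x y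
        using 2 by (simp add: minus_divide_left add.commute)
      ultimately show "((\<lambda>q. pi / 2 - arctan (A q / B q)) has_derivative
        (\<lambda>v. (A q * D M B q v - B q * D M A q v) / (A q * A q + e * (B q * B q)))) (at q within M)"
        unfolding eta_derivative_algebra(1)[OF b] by simp
    qed
  next
    case 3
    show thesis
    proof (rule main[of "\<lambda>q. \<bar>A q\<bar> - \<bar>B q\<bar>" "\<lambda>q. artanh (B q / A q)"])
      show "continuous (at p within M) (\<lambda>q. \<bar>A q\<bar> - \<bar>B q\<bar>)"
        by (intro continuous_diff continuous_rabs cA cB)
      show "\<bar>A p\<bar> - \<bar>B p\<bar> > 0" using 3 by simp
      show "is_eta e (A q) (B q) (artanh (B q / A q))" if "\<bar>A q\<bar> - \<bar>B q\<bar> > 0" for q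
        using is_eta_artanh(1)[of "B q" "A q"] that 3 by auto
      fix q assume q: "q \<in> M" "q \<in> W0" "\<bar>A q\<bar> - \<bar>B q\<bar> > 0"
      then have ab: "\<bar>B q\<bar> < \<bar>A q\<bar>" and a: "A q \<noteq> 0" by auto
      have "\<bar>B q / A q\<bar> < 1" using ab by simp
      then have "((\<lambda>q. artanh (B q / A q)) has_derivative
        (\<lambda>v. (D M B q v * A q - B q * D M A q v) / (A q * A q) * (1 / (1 - (B q / A q)\<^sup>2)))) (at q within M)"
        by (intro DERIV_compose_FDERIV[OF artanh_real_has_field_derivative]
            has_derivative_divide'[OF dB[OF q(1,2)] dA[OF q(1,2)] a])
      then show "((\<lambda>q. artanh (B q / A q)) has_derivative
        (\<lambda>v. (A q * D M B q v - B q * D M A q v) / (A q * A q + e * (B q * B q)))) (at q within M)"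
        unfolding eta_derivative_algebra(2)[OF ab] using 3 by simp
    qed
  next
    case 4
    show thesis
    proof (rule main[of "\<lambda>q. \<bar>B q\<bar> - \<bar>A q\<bar>" "\<lambda>q. artanh (A q / B q)"])
      show "continuous (at p within M) (\<lambda>q. \<bar>B q\<bar> - \<bar>A q\<bar>)"
        by (intro continuous_diff continuous_rabs cA cB)
      show "\<bar>B p\<bar> - \<bar>A p\<bar> > 0" using 4 by simp
      show "is_eta e (A q) (B q) (artanh (A q / B q))" if "\<bar>B q\<bar> - \<bar>A q\<bar> > 0" for q
        using is_eta_artanh(2)[of "A q" "B q"] that 4 by auto
      fix q assume q: "q \<in> M" "q \<in> W0" "\<bar>B q\<bar> - \<bar>A q\<bar> > 0"
      then have ab: "\<bar>A q\<bar> < \<bar>B q\<bar>" and b: "B q \<noteq> 0" by auto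
      have "\<bar>A q / B q\<bar> < 1" using ab by simp
      then have "((\<lambda>q. artanh (A q / B q)) has_derivative
        (\<lambda>v. (D M A q v * B q - A q * D M B q v) / (B q * B q) * (1 / (1 - (A q / B q)\<^sup>2)))) (at q within M)"
        by (intro DERIV_compose_FDERIV[OF artanh_real_has_field_derivative]
            has_derivative_divide'[OF dA[OF q(1,2)] dB[OF q(1,2)] b])
      moreover have "(B q * x - A q * y) / (B q * B q - A q * A q)
          = (A q * y - B q * x) / (A q * A q + e * (B q * B q))" for x y
        using 4 minus_divide_divide[of "B q * x - A q * y" "B q * B q - A q * A q"] by simp
      ultimately show "((\<lambda>q. artanh (A q / B q)) has_derivative
        (\<lambda>v. (A q * D M B q v - B q * D M A q v) / (A q * A q + e * (B q * B q)))) (at q within M)"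
        unfolding eta_derivative_algebra(2)[OF ab] by simp
    qed
  qed
qed

lemma kernel_rank_le_1:
  fixes H :: "real^2^4"
  assumes "H *v vector [a, b] = 0" "(a, b) \<noteq> (0, 0)"
  shows "rank H \<le> 1"
proof -
  have "(vector [a, b] :: real^2) \<noteq> 0" using assms(2) by (simp add: vec_eq_iff forall_2)
  then have "rank H \<noteq> CARD(2)" using assms(1) matrix_nonfull_linear_equations_eq by blast
  moreover have "rank H \<le> 2" using rank_bound[of H] by simp
  ultimately show ?thesis by simp
qed

lemma kernel_proportional:
  fixes H :: "real^2^4"
  assumes H: "rank H = 1" and 1: "H *v vector [a, b] = 0" and 2: "H *v vector [x, y] = 0"
  shows "a * y = b * x"
proof (rule ccontr)
  assume n: "a * y \<noteq> b * x"
  have "H $ i $ 1 = 0 \<and> H $ i $ 2 = 0" for i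
  proof -
    have e: "H $ i $ 1 * a + H $ i $ 2 * b = 0" "H $ i $ 1 * x + H $ i $ 2 * y = 0"
      using 1 2 by (simp_all add: vec_eq_iff matrix_vector_mult_def sum_2)
    have "H $ i $ 1 * (a * y - b * x) = 0" "H $ i $ 2 * (a * y - b * x) = 0" using e by algebra+
    then show ?thesis using n by simp
  qed
  then have "H = 0" by (simp add: vec_eq_iff forall_2)
  then show False using H by simp
qed

lemma proportional_kernel:
  fixes H :: "real^2^4"
  assumes 1: "H *v vector [a, b] = 0" and n: "(a, b) \<noteq> (0, 0)" and p: "a * y = b * x"
  shows "H *v vector [x, y] = 0"
proof -
  have "H $ i $ 1 * x + H $ i $ 2 * y = 0" for i
  proof -
    have e: "H $ i $ 1 * a + H $ i $ 2 * b = 0"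
      using 1 by (simp add: vec_eq_iff matrix_vector_mult_def sum_2)
    have "a * (H $ i $ 1 * x + H $ i $ 2 * y) = 0" "b * (H $ i $ 1 * x + H $ i $ 2 * y) = 0"
      using e p by algebra+
    then show ?thesis using n by auto
  qed
  then show ?thesis by (simp add: vec_eq_iff matrix_vector_mult_def sum_2)
qed

context lagrangian_form
begin

lemma solution_nondegenerate:
  assumes p: "p \<in> U" and s: "solution \<omega> p a b" and nd: "\<And>v. v \<noteq> 0 \<Longrightarrow> \<exists>w. \<omega> v w \<noteq> 0"
  shows "a * a + \<epsilon> p * (b * b) \<noteq> 0"
proof
  assume k: "a * a + \<epsilon> p * (b * b) = 0"
  have v: "\<omega> (X 1 p) (X 2 p) = 0" "\<omega> (X 1 p) (\<xi> 1 p) = b" "\<omega> (X 2 p) (\<xi> 1 p) = a"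
     "\<omega> (X 1 p) (\<xi> 2 p) = a" "\<omega> (X 2 p) (\<xi> 2 p) = - \<epsilon> p * b"
    using s by (simp_all only: solution_def)
  have zero: "y = 0" if "\<omega> y (X 1 p) = 0" "\<omega> y (X 2 p) = 0" "\<omega> y (\<xi> 1 p) = 0" "\<omega> y (\<xi> 2 p) = 0" for y
  proof (rule ccontr)
    assume "y \<noteq> 0"
    then obtain w where "\<omega> y w \<noteq> 0" using nd by blast
    moreover have "\<omega> y w = 0"
      by (subst frame_expansion[OF p, of w]) (simp add: that)
    ultimately show False by simp
  qed
  have z1: "a *\<^sub>R X 1 p - b *\<^sub>R X 2 p = 0"
    by (rule zero) (use k in \<open>simp_all add: v swaps algebra_simps\<close>)
  have a: "a = 0" using arg_cong[OF z1, of "ca 1 p"] p by simp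
  have b: "b = 0" using arg_cong[OF z1, of "ca 2 p"] p by simp
  have "X 1 p = 0" by (rule zero) (use a b v in simp_all)
  then have "ca 1 p (X 1 p) = ca 1 p 0" by (rule arg_cong)
  then show False using p by simp
qed

lemma eta_equations_necessary:
  assumes L: "\<And>q. q \<in> U \<Longrightarrow> lagrangian_near M \<omega> q" and nd: "\<And>v. v \<noteq> 0 \<Longrightarrow> \<exists>w. \<omega> v w \<noteq> 0"
  shows "eta_equations vol M \<sigma> U X \<xi>"
  unfolding eta_equations_def
proof
  fix p assume p: "p \<in> U"
  define A where "A q = \<omega> (X 2 q) (\<xi> 1 q)" for q
  define B where "B q = \<omega> (X 1 q) (\<xi> 1 q)" for q
  have sol: "solution \<omega> q (A q) (B q)" if "q \<in> U" for q
    using lagrangian_imp_solution[OF that L[OF that]] by (simp add: A_def B_def)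
  have k: "A q * A q + \<epsilon> q * (B q * B q) \<noteq> 0" if "q \<in> U" for q
    by (rule solution_nondegenerate[OF that sol[OF that] nd])
  have dif: "A differentiable (at q within M)" "B differentiable (at q within M)" if "q \<in> U" for q
    using D_form(4)[OF that] by (simp_all add: A_def[abs_def] B_def[abs_def])
  obtain W0 where W0: "open W0" "p \<in> W0" "\<And>q. q \<in> M \<Longrightarrow> q \<in> W0 \<Longrightarrow> q \<in> U \<and> \<epsilon> q = \<epsilon> p"
    by (rule \<epsilon>_locally_constant[OF p]) (rule that)
  have difA: "A differentiable (at q within M)" and difB: "B differentiable (at q within M)"
    if "q \<in> M" "q \<in> W0" for q
    using dif W0(3)[OF that] by blast+
  obtain W \<eta> where W: "open W" "p \<in> W" "W \<subseteq> W0"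
    and eta: "\<And>q. q \<in> M \<Longrightarrow> q \<in> W \<Longrightarrow> is_eta (\<epsilon> p) (A q) (B q) (\<eta> q)"
    and d: "\<And>q. q \<in> M \<Longrightarrow> q \<in> W \<Longrightarrow> (\<eta> has_derivative
      (\<lambda>v. (A q * D M B q v - B q * D M A q v) / (A q * A q + \<epsilon> p * (B q * B q)))) (at q within M)"
    by (rule local_eta[OF \<epsilon>_cases W0(1,2) inM[OF p] difA difB k[OF p]], assumption+) (rule that)
  show "\<exists>V A B \<eta>. openin (top_of_set M) V \<and> p \<in> V \<and> V \<subseteq> U \<and>
        (\<forall>q\<in>V. (A q, B q) \<noteq> (0, 0) \<and>
           H_mat vol M \<sigma> X \<xi> q *v vector [A q, B q] = 0 \<and>
           is_eta (metric_sign vol M q) (A q) (B q) (\<eta> q) \<and>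
           \<eta> differentiable (at q within M) \<and>
           D M \<eta> q (X 1 q) + metric_sign vol M q * G1 vol M \<sigma> X \<xi> q = 0 \<and>
           D M \<eta> q (X 2 q) - G2 vol M \<sigma> X \<xi> q = 0)"
  proof (rule exI[of _ "M \<inter> W"], rule exI[of _ A], rule exI[of _ B], rule exI[of _ \<eta>], intro conjI ballI)
    show "openin (top_of_set M) (M \<inter> W)" using W(1) by (rule openin_open_Int)
    show "p \<in> M \<inter> W" using inM[OF p] W(2) by blast
    show "M \<inter> W \<subseteq> U" using W(3) W0(3) by blast
    fix q assume "q \<in> M \<inter> W"
    then have q: "q \<in> M" "q \<in> W" "q \<in> U" "\<epsilon> q = \<epsilon> p" using W(3) W0(3) by auto
    show "(A q, B q) \<noteq> (0, 0)" using k[OF q(3)] by auto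
    show "H_mat vol M \<sigma> X \<xi> q *v vector [A q, B q] = 0" using sol[OF q(3)] by (simp only: solution_def)
    show "is_eta (\<epsilon> q) (A q) (B q) (\<eta> q)" using eta[OF q(1,2)] q(4) by simp
    show "\<eta> differentiable (at q within M)" by (rule differentiableI[OF d[OF q(1,2)]])
    show "D M \<eta> q (X 1 q) + \<epsilon> q * G1 vol M \<sigma> X \<xi> q = 0" "D M \<eta> q (X 2 q) - G2 vol M \<sigma> X \<xi> q = 0"
      unfolding D_eq[OF d[OF q(1,2)] X_in_T[OF q(3)]] A_def[abs_def] B_def[abs_def]
      using D_solution[OF q(3) sol[OF q(3)]] k[OF q(3)]
      by (simp_all add: A_def[abs_def] B_def[abs_def] q(4)[symmetric])
  qed
qed

end

context adapted
begin

lemma initial_form: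
  assumes p: "p \<in> U" and k: "a * a + \<epsilon> p * (b * b) \<noteq> 0" and H: "H_mat vol M \<sigma> X \<xi> p *v vector [a, b] = 0"
  obtains \<omega> where "alternating2 \<omega>" "solution \<omega> p a b" "\<And>v. v \<noteq> 0 \<Longrightarrow> \<exists>w. \<omega> v w \<noteq> 0"
proof -
  define \<omega> where "\<omega> v w = b * (ca 1 p v * cb 1 p w - cb 1 p v * ca 1 p w) + a * (ca 2 p v * cb 1 p w - cb 1 p v * ca 2 p w)
    + a * (ca 1 p v * cb 2 p w - cb 2 p v * ca 1 p w) - \<epsilon> p * b * (ca 2 p v * cb 2 p w - cb 2 p v * ca 2 p w)" for v w
  show ?thesis
  proof (rule that[of \<omega>])
    show "alternating2 \<omega>"
      by unfold_locales (auto simp: bilinear_def \<omega>_def intro!: linearI; simp add: algebra_simps)+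
    show "solution \<omega> p a b" using p H by (simp add: solution_def \<omega>_def)
    fix v :: r4 assume v: "v \<noteq> 0"
    show "\<exists>w. \<omega> v w \<noteq> 0"
    proof (rule ccontr)
      assume "\<not> (\<exists>w. \<omega> v w \<noteq> 0)"
      then have z: "\<omega> v (X 1 p) = 0" "\<omega> v (X 2 p) = 0" "\<omega> v (\<xi> 1 p) = 0" "\<omega> v (\<xi> 2 p) = 0" by auto
      define x y s t where "x = ca 1 p v" "y = ca 2 p v" "s = cb 1 p v" "t = cb 2 p v"
      note xyst = this
      have e: "b * s + a * t = 0" "a * s - \<epsilon> p * b * t = 0" "b * x + a * y = 0" "a * x - \<epsilon> p * b * y = 0"
        using z p by (simp_all add: \<omega>_def xyst algebra_simps)
      have "(a * a + \<epsilon> p * (b * b)) * s = 0" "(a * a + \<epsilon> p * (b * b)) * t = 0"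
        "(a * a + \<epsilon> p * (b * b)) * x = 0" "(a * a + \<epsilon> p * (b * b)) * y = 0"
        using e by algebra+
      then have "x = 0" "y = 0" "s = 0" "t = 0" using k by simp_all
      then have "v = 0" using frame_expansion[OF p, of v] by (simp add: xyst)
      then show False using v by simp
    qed
  qed
qed

end

section \<open>Transport along curves\<close>

lemma linear_system_zero:
  fixes y y' :: "'i::finite \<Rightarrow> real \<Rightarrow> real"
  assumes der: "\<And>i t. t \<in> {0..1} \<Longrightarrow> (y i has_vector_derivative y' i t) (at t within {0..1})"
    and K: "K \<ge> 0" "\<And>i t. t \<in> {0..1} \<Longrightarrow> \<bar>y' i t\<bar> \<le> K * (\<Sum>j\<in>UNIV. \<bar>y j t\<bar>)"
    and y0: "\<And>i. y i 0 = 0" and t: "t \<in> {0..1}"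
  shows "y i t = 0"
proof -
  define n where "n = real CARD('i)"
  define Y where "Y t = (\<Sum>i\<in>UNIV. y i t *\<^sub>R (axis i 1 :: real^'i))" for t
  define Y' where "Y' t = (\<Sum>i\<in>UNIV. y' i t *\<^sub>R (axis i 1 :: real^'i))" for t
  have comp: "Y t $ i = y i t" "Y' t $ i = y' i t" for t i
    by (simp_all add: Y_def Y'_def axis_def if_distrib[of "(*) _"] cong: if_cong)
  have "Y t = 0"
  proof (rule linear_growth_zero[OF _ _ _ t])
    fix t :: real assume t: "t \<in> {0..1}"
    show "(Y has_vector_derivative Y' t) (at t within {0..1})"
      unfolding Y_def[abs_def] Y'_def
      by (rule has_vector_derivative_sum, rule bounded_linear.has_vector_derivative[OF bounded_linear_scaleR_left der[OF t]])
    have "(\<Sum>j\<in>UNIV. \<bar>y j t\<bar>) \<le> (\<Sum>j\<in>(UNIV::'i set). norm (Y t))"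
      by (rule sum_mono) (metis comp(1) component_le_norm_cart)
    then have s: "(\<Sum>j\<in>UNIV. \<bar>y j t\<bar>) \<le> n * norm (Y t)" by (simp add: n_def)
    have "norm (Y' t) \<le> (\<Sum>i\<in>UNIV. \<bar>y' i t\<bar>)"
      using norm_le_l1_cart[of "Y' t"] by (simp add: comp)
    also have "\<dots> \<le> (\<Sum>i\<in>(UNIV::'i set). K * (n * norm (Y t)))"
      by (intro sum_mono order_trans[OF K(2)[OF t]] mult_left_mono[OF s K(1)])
    finally show "norm (Y' t) \<le> (n * (K * n)) * norm (Y t)" by (simp add: n_def mult_ac)
  next
    show "Y 0 = 0" by (simp add: Y_def y0)
  qed
  then show ?thesis using comp(1)[of t i] by simp
qed

text \<open>The matrix in the frame \<open>X\<^sub>1, X\<^sub>2, \<xi>\<^sub>1, \<xi>\<^sub>2\<close> of a form that satisfies \<open>solution\<close> with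
  coefficients \<open>a\<close> and \<open>b\<close>.\<close>

definition form_matrix :: "real \<Rightarrow> real \<Rightarrow> real \<Rightarrow> real^4^4" where
  "form_matrix e a b = vector [vector [0, 0, b, a], vector [0, 0, a, - e * b],
     vector [- b, - a, 0, 0], vector [- a, e * b, 0, 0]]"

lemma form_matrix_linear:
  "form_matrix e a b $ i $ j = a * form_matrix e 1 0 $ i $ j + b * form_matrix e 0 1 $ i $ j"
  using exhaust_4[of i] exhaust_4[of j] by (auto simp: form_matrix_def)

context adapted
begin

definition fr :: "4 \<Rightarrow> r4 \<Rightarrow> r4" where
  "fr i = (if i = 1 then X 1 else if i = 2 then X 2 else if i = 3 then \<xi> 1 else \<xi> 2)"

text \<open>Row \<open>i\<close> of \<open>cn k\<close> holds the components of \<open>D\<close> of \<open>fr i\<close> along \<open>X k\<close>; \<open>dg k\<close> is the value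
  that the equations in (a) prescribe for \<open>d\<eta>(X k)\<close>.\<close>

definition cn :: "2 \<Rightarrow> r4 \<Rightarrow> real^4^4" where
  "cn k p = vector [vector [\<Gamma> k 1 1 p, \<Gamma> k 1 2 p, h 1 k 1 p, h 2 k 1 p],
     vector [\<Gamma> k 2 1 p, \<Gamma> k 2 2 p, h 1 k 2 p, h 2 k 2 p],
     vector [- \<Lambda> 1 k 1 p, - \<Lambda> 1 k 2 p, \<tau> 1 1 k p, \<tau> 1 2 k p],
     vector [- \<Lambda> 2 k 1 p, - \<Lambda> 2 k 2 p, \<tau> 2 1 k p, \<tau> 2 2 k p]]"

definition dg :: "2 \<Rightarrow> r4 \<Rightarrow> real" where
  "dg k p = (if k = 1 then - \<epsilon> p * G1 vol M \<sigma> X \<xi> p else G2 vol M \<sigma> X \<xi> p)"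

lemma diff_fr: "p \<in> U \<Longrightarrow> fr i differentiable (at p within M)"
  by (simp add: fr_def diffX diff\<xi>)

lemma structure_fr: "p \<in> U \<Longrightarrow> D M (fr i) p (X k p) = (\<Sum>l\<in>UNIV. cn k p $ i $ l *\<^sub>R fr l p)"
  using exhaust_4[of i] by (auto simp: fr_def cn_def sum_4 structure_X structure_\<xi>)

lemma diff_cn: "p \<in> U \<Longrightarrow> (\<lambda>q. cn k q $ i $ j) differentiable (at p within M)"
  using exhaust_4[of i] exhaust_4[of j] diff_coefficients
  by (elim disjE) (simp_all add: cn_def diff_coefficients)

lemma model_form:
  assumes p: "p \<in> U" and H: "H_mat vol M \<sigma> X \<xi> p *v vector [a, b] = 0"
  shows "(\<Sum>l\<in>UNIV. cn k p $ i $ l * form_matrix (\<epsilon> p) a b $ l $ j) + (\<Sum>l\<in>UNIV. cn k p $ j $ l * form_matrix (\<epsilon> p) a b $ i $ l)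
    = form_matrix (\<epsilon> p) (- \<epsilon> p * dg k p * b) (dg k p * a) $ i $ j"
proof -
  have F: "(\<tau> 1 1 2 p - \<Gamma> 2 1 1 p) * a + \<epsilon> p * (\<tau> 1 1 1 p + \<Gamma> 1 1 1 p) * b = 0"
     "(\<Gamma> 1 1 1 p - \<tau> 1 1 1 p) * a + (\<Gamma> 2 1 1 p + \<tau> 1 1 2 p) * b = 0"
    and L: "(\<Lambda> 1 1 1 p - \<Lambda> 2 1 2 p) * a + (- \<epsilon> p * \<Lambda> 1 1 2 p - \<Lambda> 2 1 1 p) * b = 0"
     "(\<Lambda> 1 2 1 p - \<Lambda> 2 2 2 p) * a + (- \<epsilon> p * \<Lambda> 1 2 2 p - \<Lambda> 2 2 1 p) * b = 0"
    using H by (simp_all only: H_kernel[OF p])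
  have e2: "\<epsilon> p * \<epsilon> p = 1" by simp
  have "\<forall>k i j. (\<Sum>l\<in>UNIV. cn k p $ i $ l * form_matrix (\<epsilon> p) a b $ l $ j) + (\<Sum>l\<in>UNIV. cn k p $ j $ l * form_matrix (\<epsilon> p) a b $ i $ l)
    = form_matrix (\<epsilon> p) (- \<epsilon> p * dg k p * b) (dg k p * a) $ i $ j"
    unfolding forall_2 forall_4
    apply (simp add: sum_4 cn_def form_matrix_def dg_def h_values[OF p] reduced[OF p] G1_def G2_def)
    apply (intro conjI; (use F L e2 in algebra)?)
    done
  then show ?thesis by blast
qed

lemma continuous_along:
  fixes f :: "r4 \<Rightarrow> 'b::euclidean_space"
  assumes f: "\<And>q. q \<in> U \<Longrightarrow> f differentiable (at q within M)"
    and c: "continuous_on S c" "\<And>t. t \<in> S \<Longrightarrow> c t \<in> U"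
  shows "continuous_on S (\<lambda>t. f (c t))"
proof (rule continuous_on_compose2[OF _ c(1)])
  show "continuous_on U f"
    unfolding continuous_on_eq_continuous_within
    using continuous_within_subset[OF differentiable_imp_continuous_within[OF f]] inM by blast
qed (use c(2) in blast)

lemma continuous_speed:
  assumes c: "continuous_on S c" "\<And>t. t \<in> S \<Longrightarrow> c t \<in> U" and c': "continuous_on S c'"
  shows "continuous_on S (\<lambda>t. ca k (c t) (c' t))"
proof -
  have "linear (ca k q)" for q by (intro linearI) simp_all
  note e = linear_Basis_expansion[OF this]
  have "continuous_on S (\<lambda>t. \<Sum>b\<in>Basis. (c' t \<bullet> b) *\<^sub>R ca k (c t) b)"
    by (intro continuous_on_sum continuous_on_scaleR continuous_on_inner c' continuous_on_const
        continuous_along[OF _ c] diff_coframe) auto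
  then show ?thesis by (subst e)
qed

lemma derivative_along:
  fixes f :: "r4 \<Rightarrow> 'b::euclidean_space"
  assumes c: "\<And>t. t \<in> S \<Longrightarrow> c t \<in> U" and t: "t \<in> S" and c': "(c has_vector_derivative c') (at t within S)"
    "c' \<in> T (c t)" and f: "(f has_derivative f') (at (c t) within M)"
  shows "((\<lambda>t. f (c t)) has_vector_derivative
    (ca 1 (c t) c' *\<^sub>R f' (X 1 (c t)) + ca 2 (c t) c' *\<^sub>R f' (X 2 (c t)))) (at t within S)"
proof -
  have "(f has_derivative f') (at (c t) within c ` S)"
    by (rule has_derivative_subset[OF f]) (use c inM in blast)
  then have d: "((f \<circ> c) has_vector_derivative f' c') (at t within S)"
    by (rule vector_derivative_diff_chain_within[OF c'(1)])
  have l: "linear f'" using f by (rule has_derivative_linear)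
  have "c' = ca 1 (c t) c' *\<^sub>R X 1 (c t) + ca 2 (c t) c' *\<^sub>R X 2 (c t)"
    using frame_expansion[OF c[OF t], of c'] c'(2) by (simp add: T_iff[OF c[OF t]])
  then have "f' c' = f' (ca 1 (c t) c' *\<^sub>R X 1 (c t) + ca 2 (c t) c' *\<^sub>R X 2 (c t))"
    by (rule arg_cong)
  also have "\<dots> = ca 1 (c t) c' *\<^sub>R f' (X 1 (c t)) + ca 2 (c t) c' *\<^sub>R f' (X 2 (c t))"
    by (simp only: linear_add[OF l] linear_scale[OF l])
  finally show ?thesis using d by (simp only: comp_def)
qed

end

locale curve = adapted vol M \<sigma> U X \<xi> for vol M \<sigma> U X \<xi> +
  fixes c c' :: "real \<Rightarrow> r4" and e :: real
  assumes cU: "\<And>t. t \<in> {0..1} \<Longrightarrow> c t \<in> U" and ce: "\<And>t. t \<in> {0..1} \<Longrightarrow> \<epsilon> (c t) = e"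
    and c'T: "\<And>t. t \<in> {0..1} \<Longrightarrow> c' t \<in> T (c t)"
    and dc: "\<And>t. t \<in> {0..1} \<Longrightarrow> (c has_vector_derivative c' t) (at t within {0..1})"
    and contc': "continuous_on {0..1} c'"
begin

lemma contc: "continuous_on {0..1} c"
  by (rule continuous_on_vector_derivative[OF dc])

definition g :: "real \<Rightarrow> real" where
  "g t = ca 1 (c t) (c' t) * dg 1 (c t) + ca 2 (c t) (c' t) * dg 2 (c t)"

lemma continuous_g: "continuous_on {0..1} g"
proof -
  have e: "g t = ca 1 (c t) (c' t) * (- e * (\<Gamma> 2 2 2 (c t) - e * \<Gamma> 1 1 2 (c t) + \<tau> 1 1 2 (c t) - e * \<tau> 1 2 1 (c t)))
    + ca 2 (c t) (c' t) * (\<Gamma> 1 1 1 (c t) - e * \<Gamma> 2 2 1 (c t) - \<tau> 2 2 1 (c t) + \<tau> 1 2 2 (c t))" if "t \<in> {0..1}" for t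
    using ce[OF that] by (simp add: g_def dg_def G1_def G2_def)
  have "continuous_on {0..1} (\<lambda>t. ca 1 (c t) (c' t) * (- e * (\<Gamma> 2 2 2 (c t) - e * \<Gamma> 1 1 2 (c t) + \<tau> 1 1 2 (c t) - e * \<tau> 1 2 1 (c t)))
    + ca 2 (c t) (c' t) * (\<Gamma> 1 1 1 (c t) - e * \<Gamma> 2 2 1 (c t) - \<tau> 2 2 1 (c t) + \<tau> 1 2 2 (c t)))"
    by (intro continuous_on_add continuous_on_mult continuous_on_diff continuous_on_const
        continuous_speed[OF contc cU contc'] continuous_along[OF _ contc cU] diff_coefficients) auto
  then show ?thesis by (subst continuous_on_cong[OF refl e])
qed

theorem transport:
  assumes form: "alternating2 \<omega>"
    and da: "\<And>t. t \<in> {0..1} \<Longrightarrow> (a has_vector_derivative (- e * g t * b t)) (at t within {0..1})"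
    and db: "\<And>t. t \<in> {0..1} \<Longrightarrow> (b has_vector_derivative (g t * a t)) (at t within {0..1})"
    and H: "\<And>t. t \<in> {0..1} \<Longrightarrow> H_mat vol M \<sigma> X \<xi> (c t) *v vector [a t, b t] = 0"
    and init: "solution \<omega> (c 0) (a 0) (b 0)"
    and vw: "v \<in> T (c 1)" "w \<in> T (c 1)"
  shows "\<omega> v w = 0"
proof -
  interpret alternating2 \<omega> by (rule form)
  define N where "N t = ca 1 (c t) (c' t) *\<^sub>R cn 1 (c t) + ca 2 (c t) (c' t) *\<^sub>R cn 2 (c t)" for t
  have contN: "continuous_on {0..1} (\<lambda>t. N t $ i $ j)" for i j
    unfolding N_def vector_add_component vector_scaleR_component
    by (intro continuous_on_add continuous_on_scaleR
        continuous_speed[OF contc cU contc'] continuous_along[OF _ contc cU] diff_cn) auto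
  have "continuous_on {0..1} (\<lambda>t. \<Sum>i\<in>UNIV. \<Sum>j\<in>UNIV. \<bar>N t $ i $ j\<bar>)"
    by (intro continuous_on_sum continuous_on_rabs contN)
  then have "bounded ((\<lambda>t. \<Sum>i\<in>UNIV. \<Sum>j\<in>UNIV. \<bar>N t $ i $ j\<bar>) ` {0..1})"
    by (intro compact_imp_bounded compact_continuous_image) auto
  then obtain C where C: "C > 0" "\<And>t. t \<in> {0..1} \<Longrightarrow> \<bar>\<Sum>i\<in>UNIV. \<Sum>j\<in>UNIV. \<bar>N t $ i $ j\<bar>\<bar> \<le> C"
    unfolding bounded_pos by auto
  have NC: "\<bar>N t $ i $ j\<bar> \<le> C" if "t \<in> {0..1}" for t i j
  proof -
    have "\<bar>N t $ i $ j\<bar> \<le> (\<Sum>j\<in>UNIV. \<bar>N t $ i $ j\<bar>)" by (rule member_le_sum) auto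
    also have "\<dots> \<le> (\<Sum>i\<in>UNIV. \<Sum>j\<in>UNIV. \<bar>N t $ i $ j\<bar>)"
      by (rule member_le_sum[where f = "\<lambda>i. \<Sum>j\<in>UNIV. \<bar>N t $ i $ j\<bar>"]) (auto intro: sum_nonneg)
    also have "\<dots> \<le> C" using C(2)[OF that] by linarith
    finally show ?thesis .
  qed
  have dfr: "((\<lambda>t. fr i (c t)) has_vector_derivative (\<Sum>l\<in>UNIV. N t $ i $ l *\<^sub>R fr l (c t))) (at t within {0..1})"
    if t: "t \<in> {0..1}" for i t
  proof -
    note d = derivative_along[OF cU t dc[OF t] c'T[OF t] D_has_derivative[OF diff_fr[OF cU[OF t]]], of i]
    show ?thesis
      by (rule has_vector_derivative_eq_rhs[OF d])
        (simp_all add: structure_fr[OF cU[OF t]] N_def scaleR_add_left sum.distrib scaleR_sum_right)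
  qed
  define Z where "Z t = form_matrix e (a t) (b t)" for t
  have dZ: "((\<lambda>t. Z t $ i $ j) has_vector_derivative
      ((\<Sum>l\<in>UNIV. N t $ i $ l * Z t $ l $ j) + (\<Sum>l\<in>UNIV. N t $ j $ l * Z t $ i $ l))) (at t within {0..1})"
    if t: "t \<in> {0..1}" for i j t
  proof -
    note m = model_form[OF cU[OF t] H[OF t], unfolded ce[OF t]]
    have "(\<Sum>l\<in>UNIV. N t $ i $ l * Z t $ l $ j) + (\<Sum>l\<in>UNIV. N t $ j $ l * Z t $ i $ l)
      = ca 1 (c t) (c' t) * ((\<Sum>l\<in>UNIV. cn 1 (c t) $ i $ l * Z t $ l $ j) + (\<Sum>l\<in>UNIV. cn 1 (c t) $ j $ l * Z t $ i $ l))
      + ca 2 (c t) (c' t) * ((\<Sum>l\<in>UNIV. cn 2 (c t) $ i $ l * Z t $ l $ j) + (\<Sum>l\<in>UNIV. cn 2 (c t) $ j $ l * Z t $ i $ l))"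
      by (simp add: N_def distrib_left distrib_right sum.distrib sum_distrib_left mult.assoc)
    also have "\<dots> = ca 1 (c t) (c' t) * form_matrix e (- e * dg 1 (c t) * b t) (dg 1 (c t) * a t) $ i $ j
      + ca 2 (c t) (c' t) * form_matrix e (- e * dg 2 (c t) * b t) (dg 2 (c t) * a t) $ i $ j"
      by (simp only: Z_def m)
    also have "\<dots> = (- e * g t * b t) * form_matrix e 1 0 $ i $ j + (g t * a t) * form_matrix e 0 1 $ i $ j"
      unfolding form_matrix_linear[of e "- e * dg 1 (c t) * b t" "dg 1 (c t) * a t"]
        form_matrix_linear[of e "- e * dg 2 (c t) * b t" "dg 2 (c t) * a t"] g_def
      by (simp add: algebra_simps)
    finally show ?thesis
      unfolding Z_def form_matrix_linear[of e "a _" "b _"]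
      using has_vector_derivative_add[OF has_vector_derivative_mult_left[OF da[OF t]] has_vector_derivative_mult_left[OF db[OF t]]]
      by simp
  qed
  define y where "y ij t = (case ij of (i, j) \<Rightarrow> \<omega> (fr i (c t)) (fr j (c t)) - Z t $ i $ j)" for ij t
  define y' where "y' ij t = (case ij of (i, j) \<Rightarrow>
    (\<Sum>l\<in>UNIV. N t $ i $ l * y (l, j) t) + (\<Sum>l\<in>UNIV. N t $ j $ l * y (i, l) t))" for ij t
  have "y (1, 2) 1 = 0"
  proof (rule linear_system_zero[where K = "2 * C" and y = y and y' = y'])
    fix ij :: "4 \<times> 4" and t :: real assume t: "t \<in> {0..1}"
    obtain i j where ij: "ij = (i, j)" by force
    have bb: "bounded_bilinear \<omega>" using bil by (simp add: bilinear_conv_bounded_bilinear)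
    have s: "\<omega> (\<Sum>l\<in>UNIV. f l *\<^sub>R u l) x = (\<Sum>l\<in>UNIV. f l * \<omega> (u l) x)"
      "\<omega> x (\<Sum>l\<in>UNIV. f l *\<^sub>R u l) = (\<Sum>l\<in>UNIV. f l * \<omega> x (u l))" for f :: "4 \<Rightarrow> real" and u x
      by (simp_all add: bounded_bilinear.sum_left[OF bb] bounded_bilinear.sum_right[OF bb])
    have "(y ij has_vector_derivative
      (\<omega> (fr i (c t)) (\<Sum>l\<in>UNIV. N t $ j $ l *\<^sub>R fr l (c t)) + \<omega> (\<Sum>l\<in>UNIV. N t $ i $ l *\<^sub>R fr l (c t)) (fr j (c t)))
      - ((\<Sum>l\<in>UNIV. N t $ i $ l * Z t $ l $ j) + (\<Sum>l\<in>UNIV. N t $ j $ l * Z t $ i $ l))) (at t within {0..1})"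
      unfolding y_def[abs_def] ij prod.case
      by (rule has_vector_derivative_diff[OF bounded_bilinear.has_vector_derivative[OF bb dfr[OF t] dfr[OF t]] dZ[OF t]])
    then show "(y ij has_vector_derivative y' ij t) (at t within {0..1})"
      by (rule has_vector_derivative_eq_rhs)
        (simp add: y'_def y_def ij s right_diff_distrib sum_subtractf)
    have "\<bar>y' ij t\<bar> \<le> (\<Sum>l\<in>UNIV. \<bar>N t $ i $ l * y (l, j) t\<bar>) + (\<Sum>l\<in>UNIV. \<bar>N t $ j $ l * y (i, l) t\<bar>)"
      unfolding y'_def ij prod.case by (rule order_trans[OF abs_triangle_ineq add_mono[OF sum_abs sum_abs]])
    also have "\<dots> \<le> (\<Sum>l\<in>UNIV. C * \<bar>y (l, j) t\<bar>) + (\<Sum>l\<in>UNIV. C * \<bar>y (i, l) t\<bar>)"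
      unfolding abs_mult by (intro add_mono sum_mono mult_right_mono NC[OF t]) auto
    also have "\<dots> = C * (\<Sum>l\<in>UNIV. \<bar>y (l, j) t\<bar>) + C * (\<Sum>l\<in>UNIV. \<bar>y (i, l) t\<bar>)"
      by (simp add: sum_distrib_left)
    also have "(\<Sum>l\<in>UNIV. \<bar>y (l, j) t\<bar>) = (\<Sum>kl\<in>range (\<lambda>l. (l, j)). \<bar>y kl t\<bar>)"
      by (subst sum.reindex) (auto simp: inj_on_def)
    also have "(\<Sum>l\<in>UNIV. \<bar>y (i, l) t\<bar>) = (\<Sum>kl\<in>range (\<lambda>l. (i, l)). \<bar>y kl t\<bar>)"
      by (subst sum.reindex) (auto simp: inj_on_def)
    also have "C * (\<Sum>kl\<in>range (\<lambda>l. (l, j)). \<bar>y kl t\<bar>) + C * (\<Sum>kl\<in>range (\<lambda>l. (i, l)). \<bar>y kl t\<bar>)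
        \<le> C * (\<Sum>kl\<in>UNIV. \<bar>y kl t\<bar>) + C * (\<Sum>kl\<in>UNIV. \<bar>y kl t\<bar>)"
      using C(1) by (intro add_mono mult_left_mono sum_mono2) auto
    finally show "\<bar>y' ij t\<bar> \<le> 2 * C * (\<Sum>kl\<in>UNIV. \<bar>y kl t\<bar>)" by simp
  next
    fix ij :: "4 \<times> 4"
    obtain i j where ij: "ij = (i, j)" by force
    have "\<forall>i j. \<omega> (fr i (c 0)) (fr j (c 0)) = Z 0 $ i $ j"
      using init ce[of 0] swap[of "X 2 (c 0)" "X 1 (c 0)"] swap[of "\<xi> _ (c 0)" "X _ (c 0)"]
        swap[of "\<xi> 2 (c 0)" "\<xi> 1 (c 0)"]
      unfolding forall_4 by (simp add: fr_def Z_def form_matrix_def solution_def)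
    then show "y ij 0 = 0" by (simp add: y_def ij)
  qed (use C in auto)
  then have z: "\<omega> (X 1 (c 1)) (X 2 (c 1)) = 0"
    by (simp add: y_def fr_def Z_def form_matrix_def)
  have "v \<in> span {X 1 (c 1), X 2 (c 1)}" "w \<in> span {X 1 (c 1), X 2 (c 1)}"
    using vw spanX[OF cU, of 1] by auto
  then obtain r s r' s' where "v = r *\<^sub>R X 1 (c 1) + s *\<^sub>R X 2 (c 1)" "w = r' *\<^sub>R X 1 (c 1) + s' *\<^sub>R X 2 (c 1)"
    using span_pair by metis
  then show ?thesis using z swap[of "X 2 (c 1)" "X 1 (c 1)"] by simp
qed

end

lemma is_eta_nondegenerate:
  assumes e: "e = 1 \<or> e = -1" and n: "(a, b) \<noteq> (0, 0)" and eta: "is_eta e a b t"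
  shows "a * a + e * (b * b) \<noteq> 0"
proof (cases "e = 1")
  case True
  then show ?thesis using n by (auto simp: sum_squares_eq_zero_iff)
next
  case False
  then have e: "e = -1" using e by blast
  have cs: "cosh t * cosh t - sinh t * sinh t = 1"
    using hyperbolic_pythagoras[of t] by (simp add: power2_eq_square)
  have "a * sinh t = b * cosh t \<or> a * cosh t = b * sinh t" using eta e by (simp add: is_eta_def)
  then have z: "a * a = b * b \<Longrightarrow> a * a = 0 \<and> b * b = 0" using cs by (elim disjE; (intro conjI; algebra))
  show ?thesis
  proof
    assume "a * a + e * (b * b) = 0"
    then have "a * a = b * b" unfolding e by linarith
    from z[OF this] n show False by simp
  qed
qed

context curve
begin

lemma e_cases: "e = 1 \<or> e = -1"
  using ce[of 0] \<epsilon>_cases[of "c 0"] by simp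

lemma rank_0_transport:
  assumes form: "alternating2 \<omega>" and H: "\<And>t. t \<in> {0..1} \<Longrightarrow> H_mat vol M \<sigma> X \<xi> (c t) = 0"
    and init: "solution \<omega> (c 0) a0 b0" and vw: "v \<in> T (c 1)" "w \<in> T (c 1)"
  shows "\<omega> v w = 0"
proof -
  define \<theta> where "\<theta> t = integral {0..t} g" for t
  have d\<theta>: "(\<theta> has_real_derivative g t) (at t within {0..1})" if "t \<in> {0..1}" for t
    unfolding \<theta>_def[abs_def] has_real_derivative_iff_has_vector_derivative
    by (rule integral_has_vector_derivative[OF continuous_g that])
  have \<theta>0: "\<theta> 0 = 0" by (simp add: \<theta>_def)
  define a b where "a t = (if e = 1 then a0 * cos (\<theta> t) - b0 * sin (\<theta> t) else a0 * cosh (\<theta> t) + b0 * sinh (\<theta> t))"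
    and "b t = (if e = 1 then b0 * cos (\<theta> t) + a0 * sin (\<theta> t) else b0 * cosh (\<theta> t) + a0 * sinh (\<theta> t))" for t
  show ?thesis
  proof (rule transport[OF form, of a b])
    fix t :: real assume t: "t \<in> {0..1}"
    show "(a has_vector_derivative (- e * g t * b t)) (at t within {0..1})"
      "(b has_vector_derivative (g t * a t)) (at t within {0..1})"
      unfolding has_real_derivative_iff_has_vector_derivative[symmetric]
      using e_cases
      by (auto simp: a_def[abs_def] b_def[abs_def] algebra_simps intro!: derivative_eq_intros d\<theta>[OF t])
    show "H_mat vol M \<sigma> X \<xi> (c t) *v vector [a t, b t] = 0" by (simp add: H[OF t])
  qed (use init vw in \<open>simp_all add: a_def b_def \<theta>0\<close>)
qed

lemma continuous_H: "continuous_on {0..1} (\<lambda>t. H_mat vol M \<sigma> X \<xi> (c t) $ i $ j)"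
proof -
  define K :: "real \<Rightarrow> real^2^4" where "K t = vector
    [vector [\<Lambda> 1 1 1 (c t) - \<Lambda> 2 1 2 (c t), - e * \<Lambda> 1 1 2 (c t) - \<Lambda> 2 1 1 (c t)],
     vector [\<Lambda> 1 2 1 (c t) - \<Lambda> 2 2 2 (c t), - e * \<Lambda> 1 2 2 (c t) - \<Lambda> 2 2 1 (c t)],
     vector [4 * (\<tau> 1 1 2 (c t) - \<Gamma> 2 1 1 (c t)), 4 * e * (\<tau> 1 1 1 (c t) + \<Gamma> 1 1 1 (c t))],
     vector [4 * (\<Gamma> 1 1 1 (c t) - \<tau> 1 1 1 (c t)), 4 * (\<Gamma> 2 1 1 (c t) + \<tau> 1 1 2 (c t))]]" for t
  have eq: "H_mat vol M \<sigma> X \<xi> (c t) $ i $ j = K t $ i $ j" if t: "t \<in> {0..1}" for t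
  proof -
    have "H_mat vol M \<sigma> X \<xi> (c t) = K t"
      using ce[OF t]
      by (simp add: vec_eq_iff forall_4 forall_2 K_def H_mat_def F_entries[OF cU[OF t]])
        (simp add: L_mat_def Let_def)
    then show ?thesis by simp
  qed
  have c: "continuous_on {0..1} (\<lambda>t. \<Gamma> k l m (c t))" "continuous_on {0..1} (\<lambda>t. \<tau> k l m (c t))"
    "continuous_on {0..1} (\<lambda>t. \<Lambda> k l m (c t))" for k l m
    using continuous_along[OF diff_coefficients(1) contc cU] continuous_along[OF diff_coefficients(2) contc cU]
      continuous_along[OF diff_coefficients(3) contc cU] by auto
  have "continuous_on {0..1} (\<lambda>t. K t $ i $ j)"
    using exhaust_4[of i] exhaust_2[of j]
    by (elim disjE; simp add: K_def; intro continuous_intros c)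
  then show ?thesis by (subst continuous_on_cong[OF refl eq])
qed

text \<open>The two branches of \<open>is_eta\<close> define disjoint closed subsets of the parameter interval,
  since the kernel is a line; so one of them holds along the whole curve.\<close>

lemma kernel_along_curve:
  assumes rank: "\<And>t. t \<in> {0..1} \<Longrightarrow> rank (H_mat vol M \<sigma> X \<xi> (c t)) = 1"
    and AB: "\<And>t. t \<in> {0..1} \<Longrightarrow> (A t, B t) \<noteq> (0, 0)"
    and H: "\<And>t. t \<in> {0..1} \<Longrightarrow> H_mat vol M \<sigma> X \<xi> (c t) *v vector [A t, B t] = 0"
    and eta: "\<And>t. t \<in> {0..1} \<Longrightarrow> is_eta e (A t) (B t) (\<eta> t)"
    and d\<eta>: "\<And>t. t \<in> {0..1} \<Longrightarrow> (\<eta> has_real_derivative g t) (at t within {0..1})"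
  obtains x y where
    "\<And>t. t \<in> {0..1} \<Longrightarrow> (x has_real_derivative (- e * g t * y t)) (at t within {0..1})"
    "\<And>t. t \<in> {0..1} \<Longrightarrow> (y has_real_derivative (g t * x t)) (at t within {0..1})"
    "\<And>t. t \<in> {0..1} \<Longrightarrow> H_mat vol M \<sigma> X \<xi> (c t) *v vector [x t, y t] = 0"
    "(x 0, y 0) \<noteq> (0, 0)"
proof (cases "e = 1")
  case True
  show ?thesis
  proof (rule that[of "\<lambda>t. cos (\<eta> t)" "\<lambda>t. sin (\<eta> t)"])
    fix t :: real assume t: "t \<in> {0..1}"
    show "((\<lambda>t. cos (\<eta> t)) has_real_derivative (- e * g t * sin (\<eta> t))) (at t within {0..1})"
      "((\<lambda>t. sin (\<eta> t)) has_real_derivative (g t * cos (\<eta> t))) (at t within {0..1})"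
      using True by (auto intro!: derivative_eq_intros d\<eta>[OF t])
    show "H_mat vol M \<sigma> X \<xi> (c t) *v vector [cos (\<eta> t), sin (\<eta> t)] = 0"
      by (rule proportional_kernel[OF H[OF t] AB[OF t]]) (use eta[OF t] True in \<open>simp add: is_eta_def\<close>)
  next
    show "(cos (\<eta> 0), sin (\<eta> 0)) \<noteq> (0, 0)" using sin_zero_abs_cos_one[of "\<eta> 0"] by auto
  qed
next
  case False
  then have e: "e = -1" using e_cases by blast
  define K1 where "K1 = {t \<in> {0..1}. H_mat vol M \<sigma> X \<xi> (c t) *v vector [cosh (\<eta> t), sinh (\<eta> t)] = 0}"
  define K2 where "K2 = {t \<in> {0..1}. H_mat vol M \<sigma> X \<xi> (c t) *v vector [sinh (\<eta> t), cosh (\<eta> t)] = 0}"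
  have cont\<eta>: "continuous_on {0..1} \<eta>" using DERIV_continuous_on[OF d\<eta>] .
  have closed: "closedin (top_of_set {0..1}) {t \<in> {0..1}. H_mat vol M \<sigma> X \<xi> (c t) *v vector [x t, y t] = 0}"
    if xy: "continuous_on {0..1} x" "continuous_on {0..1} y" for x y :: "real \<Rightarrow> real"
  proof -
    let ?f = "\<lambda>t. \<Sum>i\<in>UNIV. \<bar>H_mat vol M \<sigma> X \<xi> (c t) $ i $ 1 * x t + H_mat vol M \<sigma> X \<xi> (c t) $ i $ 2 * y t\<bar>"
    have "continuous_on {0..1} ?f"
      by (intro continuous_on_sum continuous_on_rabs continuous_on_add continuous_on_mult continuous_H xy)
    then have "closedin (top_of_set {0..1}) {t \<in> {0..1}. ?f t = 0}"
      by (rule continuous_closedin_preimage_constant)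
    moreover have "?f t = 0 \<longleftrightarrow> H_mat vol M \<sigma> X \<xi> (c t) *v vector [x t, y t] = 0" for t
      by (subst sum_nonneg_eq_0_iff) (auto simp: vec_eq_iff matrix_vector_mult_def sum_2)
    ultimately show ?thesis by simp
  qed
  have "K1 \<inter> K2 = {}"
  proof (rule ccontr)
    assume "K1 \<inter> K2 \<noteq> {}"
    then obtain t where t: "t \<in> K1" "t \<in> K2" by blast
    then have t01: "t \<in> {0..1}" and "H_mat vol M \<sigma> X \<xi> (c t) *v vector [cosh (\<eta> t), sinh (\<eta> t)] = 0"
      "H_mat vol M \<sigma> X \<xi> (c t) *v vector [sinh (\<eta> t), cosh (\<eta> t)] = 0"
      unfolding K1_def K2_def by blast+
    then have "cosh (\<eta> t) * cosh (\<eta> t) = sinh (\<eta> t) * sinh (\<eta> t)"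
      by (intro kernel_proportional[OF rank[OF t01]])
    then show False using hyperbolic_pythagoras[of "\<eta> t"] by (simp add: power2_eq_square)
  qed
  moreover have "{0..1} \<subseteq> K1 \<union> K2"
  proof
    fix t :: real assume t: "t \<in> {0..1}"
    show "t \<in> K1 \<union> K2"
    proof -
      have "A t * sinh (\<eta> t) = B t * cosh (\<eta> t) \<or> A t * cosh (\<eta> t) = B t * sinh (\<eta> t)"
        using eta[OF t] e by (simp add: is_eta_def)
      then show ?thesis
        using proportional_kernel[OF H[OF t] AB[OF t]] t unfolding K1_def K2_def by blast
    qed
  qed
  moreover have "closedin (top_of_set {0..1}) K1" "closedin (top_of_set {0..1}) K2"
    unfolding K1_def K2_def by (intro closed continuous_on_cosh continuous_on_sinh cont\<eta>)+
  moreover have "connected {0..1::real}" by simp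
  ultimately have "K1 = {} \<or> K2 = {}" unfolding connected_closedin by blast
  with \<open>{0..1} \<subseteq> K1 \<union> K2\<close> consider "{0..1} \<subseteq> K1" | "{0..1} \<subseteq> K2" by blast
  then show ?thesis
  proof cases
    case 1
    show ?thesis
    proof (rule that[of "\<lambda>t. cosh (\<eta> t)" "\<lambda>t. sinh (\<eta> t)"])
      fix t :: real assume t: "t \<in> {0..1}"
      show "((\<lambda>t. cosh (\<eta> t)) has_real_derivative (- e * g t * sinh (\<eta> t))) (at t within {0..1})"
        "((\<lambda>t. sinh (\<eta> t)) has_real_derivative (g t * cosh (\<eta> t))) (at t within {0..1})"
        using e by (auto intro!: derivative_eq_intros d\<eta>[OF t])
      show "H_mat vol M \<sigma> X \<xi> (c t) *v vector [cosh (\<eta> t), sinh (\<eta> t)] = 0"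
        using 1 t by (auto simp: K1_def)
    qed simp
  next
    case 2
    show ?thesis
    proof (rule that[of "\<lambda>t. sinh (\<eta> t)" "\<lambda>t. cosh (\<eta> t)"])
      fix t :: real assume t: "t \<in> {0..1}"
      show "((\<lambda>t. sinh (\<eta> t)) has_real_derivative (- e * g t * cosh (\<eta> t))) (at t within {0..1})"
        "((\<lambda>t. cosh (\<eta> t)) has_real_derivative (g t * sinh (\<eta> t))) (at t within {0..1})"
        using e by (auto intro!: derivative_eq_intros d\<eta>[OF t])
      show "H_mat vol M \<sigma> X \<xi> (c t) *v vector [sinh (\<eta> t), cosh (\<eta> t)] = 0"
        using 2 t by (auto simp: K2_def)
    qed simp
  qed
qed

lemma rank_1_transport:
  assumes form: "alternating2 \<omega>"
    and rank: "\<And>t. t \<in> {0..1} \<Longrightarrow> rank (H_mat vol M \<sigma> X \<xi> (c t)) = 1"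
    and AB: "\<And>t. t \<in> {0..1} \<Longrightarrow> (A t, B t) \<noteq> (0, 0)"
    and H: "\<And>t. t \<in> {0..1} \<Longrightarrow> H_mat vol M \<sigma> X \<xi> (c t) *v vector [A t, B t] = 0"
    and eta: "\<And>t. t \<in> {0..1} \<Longrightarrow> is_eta e (A t) (B t) (\<eta> t)"
    and d\<eta>: "\<And>t. t \<in> {0..1} \<Longrightarrow> (\<eta> has_real_derivative g t) (at t within {0..1})"
    and init: "solution \<omega> (c 0) a0 b0" and vw: "v \<in> T (c 1)" "w \<in> T (c 1)"
  shows "\<omega> v w = 0"
proof (rule kernel_along_curve[OF rank AB H eta d\<eta>])
  fix x y
  assume dx: "\<And>t. t \<in> {0..1} \<Longrightarrow> (x has_real_derivative (- e * g t * y t)) (at t within {0..1})"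
    and dy: "\<And>t. t \<in> {0..1} \<Longrightarrow> (y has_real_derivative (g t * x t)) (at t within {0..1})"
    and Hxy: "\<And>t. t \<in> {0..1} \<Longrightarrow> H_mat vol M \<sigma> X \<xi> (c t) *v vector [x t, y t] = 0"
    and n: "(x 0, y 0) \<noteq> (0, 0)"
  have "H_mat vol M \<sigma> X \<xi> (c 0) *v vector [a0, b0] = 0" using init by (simp only: solution_def)
  then have pr: "a0 * y 0 = b0 * x 0" by (intro kernel_proportional[OF rank _ Hxy]) auto
  obtain s where s: "a0 = s * x 0" "b0 = s * y 0"
  proof (cases "x 0 = 0")
    case True
    then have "y 0 \<noteq> 0" using n by simp
    then show ?thesis using that[of "b0 / y 0"] True pr by simp
  next
    case False
    then show ?thesis using that[of "a0 / x 0"] pr by (simp add: field_simps)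
  qed
  show ?thesis
  proof (rule transport[OF form, of "\<lambda>t. s * x t" "\<lambda>t. s * y t"])
    fix t :: real assume t: "t \<in> {0..1}"
    show "((\<lambda>t. s * x t) has_vector_derivative (- e * g t * (s * y t))) (at t within {0..1})"
      "((\<lambda>t. s * y t) has_vector_derivative (g t * (s * x t))) (at t within {0..1})"
      unfolding has_real_derivative_iff_has_vector_derivative[symmetric]
      by (rule derivative_eq_intros dx[OF t] dy[OF t] refl | simp)+
    show "H_mat vol M \<sigma> X \<xi> (c t) *v vector [s * x t, s * y t] = 0"
    proof -
      have "(vector [s * x t, s * y t] :: real^2) = s *\<^sub>R vector [x t, y t]"
        by (simp add: vec_eq_iff forall_2)
      then show ?thesis using Hxy[OF t] by (simp add: matrix_vector_mult_scaleR)
    qed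
  qed (use init vw s in simp_all)
qed (assumption | simp)+

end

context adapted
begin

lemma propagation:
  assumes cond: "(\<forall>q\<in>U. rank (H_mat vol M \<sigma> X \<xi> q) = 0) \<or>
      (\<forall>q\<in>U. rank (H_mat vol M \<sigma> X \<xi> q) = 1) \<and> eta_equations vol M \<sigma> U X \<xi>"
    and p: "p \<in> U"
  obtains N where "open N" "p \<in> N" "M \<inter> N \<subseteq> U"
    and "\<And>\<omega> q a b q' v w. alternating2 \<omega> \<Longrightarrow> q \<in> M \<inter> N \<Longrightarrow> solution \<omega> q a b \<Longrightarrow> q' \<in> M \<inter> N \<Longrightarrow>
      v \<in> T q' \<Longrightarrow> w \<in> T q' \<Longrightarrow> \<omega> v w = 0"
proof -
  obtain W where W: "open W" "p \<in> W" "\<And>q. q \<in> M \<Longrightarrow> q \<in> W \<Longrightarrow> q \<in> U \<and> \<epsilon> q = \<epsilon> p"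
    by (rule \<epsilon>_locally_constant[OF p]) (rule that)
  obtain Q where Q: "open Q" "p \<in> Q" "Q \<subseteq> W"
    and main: "\<And>\<omega> a b v w c c'. curve vol M \<sigma> U X \<xi> c c' (\<epsilon> p) \<Longrightarrow> (\<And>t. t \<in> {0..1} \<Longrightarrow> c t \<in> Q) \<Longrightarrow>
      alternating2 \<omega> \<Longrightarrow> solution \<omega> (c 0) a b \<Longrightarrow> v \<in> T (c 1) \<Longrightarrow> w \<in> T (c 1) \<Longrightarrow> \<omega> v w = 0"
  proof (cases "\<forall>q\<in>U. rank (H_mat vol M \<sigma> X \<xi> q) = 0")
    case True
    show ?thesis
    proof (rule that[OF W(1,2) order_refl])
      fix \<omega> a b v w c c'
      assume cur: "curve vol M \<sigma> U X \<xi> c c' (\<epsilon> p)" and *: "alternating2 \<omega>" "solution \<omega> (c 0) a b" "v \<in> T (c 1)" "w \<in> T (c 1)"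
      interpret curve vol M \<sigma> U X \<xi> c c' "\<epsilon> p" by (rule cur)
      show "\<omega> v w = 0"
        by (rule rank_0_transport[OF *(1) _ *(2-4)]) (use True cU rank_eq_0 in blast)
    qed
  next
    case False
    then have rank: "\<And>q. q \<in> U \<Longrightarrow> rank (H_mat vol M \<sigma> X \<xi> q) = 1" and "eta_equations vol M \<sigma> U X \<xi>"
      using cond by blast+
    then obtain V A B \<eta> where V: "openin (top_of_set M) V" "p \<in> V" "V \<subseteq> U"
      and q: "\<And>q. q \<in> V \<Longrightarrow> (A q, B q) \<noteq> (0, 0) \<and>
           H_mat vol M \<sigma> X \<xi> q *v vector [A q, B q] = 0 \<and>
           is_eta (metric_sign vol M q) (A q) (B q) (\<eta> q) \<and>
           \<eta> differentiable (at q within M) \<and>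
           D M \<eta> q (X 1 q) + metric_sign vol M q * G1 vol M \<sigma> X \<xi> q = 0 \<and>
           D M \<eta> q (X 2 q) - G2 vol M \<sigma> X \<xi> q = 0"
      using p unfolding eta_equations_def by meson
    obtain V' where V': "open V'" "V = M \<inter> V'" using V(1) openin_open by blast
    show ?thesis
    proof (rule that[of "V' \<inter> W"])
      fix \<omega> a b v w c c'
      assume cur: "curve vol M \<sigma> U X \<xi> c c' (\<epsilon> p)" and cQ: "\<And>t. t \<in> {0..1} \<Longrightarrow> c t \<in> V' \<inter> W"
        and *: "alternating2 \<omega>" "solution \<omega> (c 0) a b" "v \<in> T (c 1)" "w \<in> T (c 1)"
      interpret curve vol M \<sigma> U X \<xi> c c' "\<epsilon> p" by (rule cur)
      have cV: "c t \<in> V" if "t \<in> {0..1}" for t using cQ[OF that] cU[OF that] inM V' by blast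
      show "\<omega> v w = 0"
      proof (rule rank_1_transport[OF *(1) rank[OF cU] _ _ _ _ *(2-4), of "\<lambda>t. A (c t)" "\<lambda>t. B (c t)" "\<lambda>t. \<eta> (c t)"])
        fix t :: real assume t: "t \<in> {0..1}"
        note qt = q[OF cV[OF t]]
        show "(A (c t), B (c t)) \<noteq> (0, 0)" "H_mat vol M \<sigma> X \<xi> (c t) *v vector [A (c t), B (c t)] = 0"
          "is_eta (\<epsilon> p) (A (c t)) (B (c t)) (\<eta> (c t))"
          using qt ce[OF t] by auto
        have d\<eta>: "\<eta> differentiable (at (c t) within M)" using qt by blast
        have De: "D M \<eta> (c t) (X 1 (c t)) = dg 1 (c t)" "D M \<eta> (c t) (X 2 (c t)) = dg 2 (c t)"
          using qt by (simp_all add: dg_def eq_neg_iff_add_eq_0)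
        show "((\<lambda>t. \<eta> (c t)) has_real_derivative g t) (at t within {0..1})"
          using derivative_along[OF cU t dc[OF t] c'T[OF t] D_has_derivative[OF d\<eta>]]
          unfolding De by (simp add: has_real_derivative_iff_has_vector_derivative g_def)
      qed
    qed (use V V' W in auto)
  qed
  show ?thesis
  proof (rule surface_local_curves[OF surface inM[OF p] Q(1,2)])
    fix N assume N: "open N" "p \<in> N" "N \<subseteq> Q"
      and cur: "\<And>q q'. q \<in> M \<inter> N \<Longrightarrow> q' \<in> M \<inter> N \<Longrightarrow>
      \<exists>c c'. c 0 = q \<and> c 1 = q' \<and> continuous_on {0..1} c' \<and>
        (\<forall>t\<in>{0..1::real}. c t \<in> M \<inter> N \<and> c' t \<in> T (c t) \<and>
           (c has_vector_derivative c' t) (at t within {0..1}))"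
    show ?thesis
    proof (rule that[OF N(1,2)])
      show "M \<inter> N \<subseteq> U" using N(3) Q(3) W(3) by blast
      fix \<omega> q a b q' v w
      assume *: "alternating2 \<omega>" "q \<in> M \<inter> N" "solution \<omega> q a b" "q' \<in> M \<inter> N" "v \<in> T q'" "w \<in> T q'"
      obtain c c' where c: "c 0 = q" "c 1 = q'" "continuous_on {0..1} c'"
        "\<forall>t\<in>{0..1::real}. c t \<in> M \<inter> N \<and> c' t \<in> T (c t) \<and> (c has_vector_derivative c' t) (at t within {0..1})"
        using cur[OF *(2,4)] by blast
      have cW: "c t \<in> U \<and> \<epsilon> (c t) = \<epsilon> p" if "t \<in> {0..1}" for t
        by (rule W(3)) (use c(4) that N(3) Q(3) in blast)+
      have "curve vol M \<sigma> U X \<xi> c c' (\<epsilon> p)"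
        by unfold_locales (use c(3,4) cW in blast)+
      then show "\<omega> v w = 0"
        by (rule main[of c c' \<omega> a b]) (use c N(3) * in auto)
    qed
  qed
qed

end

section \<open>The characterization of Lagrangian surfaces\<close>

lemma standard_form:
  obtains \<omega> :: "r4 \<Rightarrow> r4 \<Rightarrow> real" where "alternating2 \<omega>" "\<And>v. v \<noteq> 0 \<Longrightarrow> \<exists>w. \<omega> v w \<noteq> 0"
proof -
  define \<omega> :: "r4 \<Rightarrow> r4 \<Rightarrow> real"
    where "\<omega> v w = v $ 1 * w $ 2 - v $ 2 * w $ 1 + (v $ 3 * w $ 4 - v $ 4 * w $ 3)" for v w
  show ?thesis
  proof (rule that[of \<omega>])
    show "alternating2 \<omega>"
      by unfold_locales (auto simp: bilinear_def \<omega>_def intro!: linearI; simp add: algebra_simps)+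
    fix v :: r4 assume v: "v \<noteq> 0"
    show "\<exists>w. \<omega> v w \<noteq> 0"
    proof (rule ccontr)
      assume "\<not> (\<exists>w. \<omega> v w \<noteq> 0)"
      then have "\<omega> v (axis i 1) = 0" for i by blast
      from this[of 1] this[of 2] this[of 3] this[of 4] have "v = 0"
        by (simp add: \<omega>_def axis_def vec_eq_iff forall_4)
      then show False using v by simp
    qed
  qed
qed

lemma parallel_symplectic_form_iff:
  "parallel_symplectic_form \<Omega> \<longleftrightarrow>
    (\<exists>\<omega>. \<Omega> = (\<lambda>_. \<omega>) \<and> alternating2 \<omega> \<and> (\<forall>v. v \<noteq> 0 \<longrightarrow> (\<exists>w. \<omega> v w \<noteq> 0)))"
proof
  assume \<Omega>: "parallel_symplectic_form \<Omega>"
  have "\<Omega> p v w = \<Omega> 0 v w" for p v w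
  proof -
    have "\<And>p. ((\<lambda>q. \<Omega> q v w) has_derivative (\<lambda>_. 0)) (at p)"
      using \<Omega> unfolding parallel_symplectic_form_def by blast
    then show ?thesis using has_derivative_zero_unique[of UNIV "\<lambda>q. \<Omega> q v w" p 0] by simp
  qed
  then have "\<Omega> = (\<lambda>_. \<Omega> 0)" by (intro ext)
  moreover have "alternating2 (\<Omega> 0)" "\<forall>v. v \<noteq> 0 \<longrightarrow> (\<exists>w. \<Omega> 0 v w \<noteq> 0)"
    using \<Omega> unfolding parallel_symplectic_form_def alternating2_def by blast+
  ultimately show "\<exists>\<omega>. \<Omega> = (\<lambda>_. \<omega>) \<and> alternating2 \<omega> \<and> (\<forall>v. v \<noteq> 0 \<longrightarrow> (\<exists>w. \<omega> v w \<noteq> 0))" by blast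
next
  assume "\<exists>\<omega>. \<Omega> = (\<lambda>_. \<omega>) \<and> alternating2 \<omega> \<and> (\<forall>v. v \<noteq> 0 \<longrightarrow> (\<exists>w. \<omega> v w \<noteq> 0))"
  then show "parallel_symplectic_form \<Omega>"
    unfolding parallel_symplectic_form_def alternating2_def by auto
qed

theorem corollary1p2:
  fixes vol :: "r4 \<Rightarrow> r4 \<Rightarrow> r4 \<Rightarrow> r4 \<Rightarrow> r4 \<Rightarrow> real"
    and M :: "r4 set"
    and \<sigma> :: "r4 \<Rightarrow> r4 set"
    and U :: "'i \<Rightarrow> r4 set"
    and X \<xi> :: "'i \<Rightarrow> 2 \<Rightarrow> r4 \<Rightarrow> r4"
  assumes "parallel_volume_form vol"
    and "smooth_surface M" and "connected M"
    and "nondegenerate vol M"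
    and "affine_normal_bundle vol M \<sigma>"
    and "\<And>i. adapted_frame vol M \<sigma> (U i) (X i) (\<xi> i)"
    and "(\<Union>i. U i) = M"
    and "\<exists>r. \<forall>i. \<forall>p\<in>U i. rank (H_mat vol M \<sigma> (X i) (\<xi> i) p) = r"
  shows "(\<exists>\<Omega>. parallel_symplectic_form \<Omega> \<and> lagrangian M \<Omega>) \<longleftrightarrow>
    (\<forall>i. \<forall>p\<in>U i. rank (H_mat vol M \<sigma> (X i) (\<xi> i) p) = 1) \<and>
      (\<forall>i. eta_equations vol M \<sigma> (U i) (X i) (\<xi> i)) \<or>
    (\<forall>i. \<forall>p\<in>U i. rank (H_mat vol M \<sigma> (X i) (\<xi> i) p) = 0)"
proof
  have ad: "adapted vol M \<sigma> (U i) (X i) (\<xi> i)" for i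
    using assms(1,2,5,6) by (intro adapted.intro)
  {
    assume "\<exists>\<Omega>. parallel_symplectic_form \<Omega> \<and> lagrangian M \<Omega>"
    then obtain \<omega> where form: "alternating2 \<omega>" and nd: "\<And>v. v \<noteq> 0 \<Longrightarrow> \<exists>w. \<omega> v w \<noteq> 0"
      and lag: "lagrangian M (\<lambda>_. \<omega>)"
      unfolding parallel_symplectic_form_iff by blast
    have near: "lagrangian_near M \<omega> p" for p
      using lag open_UNIV unfolding lagrangian_near_def lagrangian_def by blast
    have lf: "lagrangian_form vol M \<sigma> (U i) (X i) (\<xi> i) \<omega>" for i
      using ad form by (intro lagrangian_form.intro)
    obtain r where r: "\<And>i p. p \<in> U i \<Longrightarrow> rank (H_mat vol M \<sigma> (X i) (\<xi> i) p) = r" using assms(8) by blast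
    have le1: "rank (H_mat vol M \<sigma> (X i) (\<xi> i) p) \<le> 1" if p: "p \<in> U i" for i p
    proof -
      interpret lagrangian_form vol M \<sigma> "U i" "X i" "\<xi> i" \<omega> by (rule lf)
      have s: "solution \<omega> p (\<omega> (X i 2 p) (\<xi> i 1 p)) (\<omega> (X i 1 p) (\<xi> i 1 p))"
        by (rule lagrangian_imp_solution[OF p near])
      show ?thesis
        by (rule kernel_rank_le_1) (use s solution_nondegenerate[OF p s nd] in \<open>auto simp: solution_def\<close>)
    qed
    have eta: "eta_equations vol M \<sigma> (U i) (X i) (\<xi> i)" for i
      by (rule lagrangian_form.eta_equations_necessary[OF lf near nd])
    consider "r = 0" | "r = 1" | "\<forall>i. U i = {}" using r le1 by (metis all_not_in_conv le_neq_implies_less less_one)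
    then show "(\<forall>i. \<forall>p\<in>U i. rank (H_mat vol M \<sigma> (X i) (\<xi> i) p) = 1) \<and>
        (\<forall>i. eta_equations vol M \<sigma> (U i) (X i) (\<xi> i)) \<or>
      (\<forall>i. \<forall>p\<in>U i. rank (H_mat vol M \<sigma> (X i) (\<xi> i) p) = 0)"
      using r eta by cases auto
  next
    assume R: "(\<forall>i. \<forall>p\<in>U i. rank (H_mat vol M \<sigma> (X i) (\<xi> i) p) = 1) \<and>
        (\<forall>i. eta_equations vol M \<sigma> (U i) (X i) (\<xi> i)) \<or>
      (\<forall>i. \<forall>p\<in>U i. rank (H_mat vol M \<sigma> (X i) (\<xi> i) p) = 0)"
    then have cond: "(\<forall>q\<in>U i. rank (H_mat vol M \<sigma> (X i) (\<xi> i) q) = 0) \<or>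
      (\<forall>q\<in>U i. rank (H_mat vol M \<sigma> (X i) (\<xi> i) q) = 1) \<and> eta_equations vol M \<sigma> (U i) (X i) (\<xi> i)" for i
      by blast
    have "\<exists>\<omega>. alternating2 \<omega> \<and> (\<forall>v. v \<noteq> 0 \<longrightarrow> (\<exists>w. \<omega> v w \<noteq> 0)) \<and> (\<forall>p\<in>M. lagrangian_near M \<omega> p)"
    proof (cases "M = {}")
      case True
      then show ?thesis using standard_form by (metis all_not_in_conv)
    next
      case False
      then obtain i0 p0 where p0: "p0 \<in> U i0" using assms(7) by blast
      interpret i0: adapted vol M \<sigma> "U i0" "X i0" "\<xi> i0" by (rule ad)
      obtain a b where ab: "a * a + i0.\<epsilon> p0 * (b * b) \<noteq> 0" "H_mat vol M \<sigma> (X i0) (\<xi> i0) p0 *v vector [a, b] = 0"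
      proof (cases "rank (H_mat vol M \<sigma> (X i0) (\<xi> i0) p0) = 0")
        case True
        then show ?thesis using that[of 1 0] by (simp add: rank_eq_0)
      next
        case False
        have "eta_equations vol M \<sigma> (U i0) (X i0) (\<xi> i0)"
          using cond[of i0]
        proof
          assume "\<forall>q\<in>U i0. rank (H_mat vol M \<sigma> (X i0) (\<xi> i0) q) = 0"
          then show ?thesis using False p0 by simp
        qed simp
        then obtain A B \<eta> where "(A p0, B p0) \<noteq> (0, 0)" "H_mat vol M \<sigma> (X i0) (\<xi> i0) p0 *v vector [A p0, B p0] = 0"
          "is_eta (i0.\<epsilon> p0) (A p0) (B p0) (\<eta> p0)"
          using p0 unfolding eta_equations_def by meson
        then show ?thesis using that is_eta_nondegenerate[OF i0.\<epsilon>_cases] by blast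
      qed
      obtain \<omega> where form: "alternating2 \<omega>" and s0: "i0.solution \<omega> p0 a b" and nd: "\<And>v. v \<noteq> 0 \<Longrightarrow> \<exists>w. \<omega> v w \<noteq> 0"
        by (rule i0.initial_form[OF p0 ab]) (rule that)
      define S where "S = {p \<in> M. lagrangian_near M \<omega> p}"
      have loc: "\<exists>N. open N \<and> p \<in> N \<and> (S \<inter> N \<noteq> {} \<longrightarrow> M \<inter> N \<subseteq> S)" if p: "p \<in> U i" for i p
      proof -
        interpret lagrangian_form vol M \<sigma> "U i" "X i" "\<xi> i" \<omega> using ad form by (intro lagrangian_form.intro)
        show ?thesis
        proof (rule propagation[OF cond p])
          fix N assume N: "open N" "p \<in> N" "M \<inter> N \<subseteq> U i"
            and pr: "\<And>\<omega> q a b q' v w. alternating2 \<omega> \<Longrightarrow> q \<in> M \<inter> N \<Longrightarrow> solution \<omega> q a b \<Longrightarrow> q' \<in> M \<inter> N \<Longrightarrow>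
              v \<in> T q' \<Longrightarrow> w \<in> T q' \<Longrightarrow> \<omega> v w = 0"
          have "M \<inter> N \<subseteq> S" if q: "q \<in> S \<inter> N" for q
          proof -
            have q': "q \<in> M \<inter> N" "q \<in> U i" "lagrangian_near M \<omega> q" using q N(3) by (auto simp: S_def)
            have "\<omega> v w = 0" if "q' \<in> M \<inter> N" "v \<in> T q'" "w \<in> T q'" for q' v w
              by (rule pr[OF form q'(1) lagrangian_imp_solution[OF q'(2,3)] that])
            then show ?thesis using N(1) unfolding S_def lagrangian_near_def by blast
          qed
          then show ?thesis using N(1,2) by blast
        qed
      qed
      have p0S: "p0 \<in> S"
      proof (rule i0.propagation[OF cond p0])
        fix N assume N: "open N" "p0 \<in> N" "M \<inter> N \<subseteq> U i0"
            and pr: "\<And>\<omega> q a b q' v w. alternating2 \<omega> \<Longrightarrow> q \<in> M \<inter> N \<Longrightarrow> i0.solution \<omega> q a b \<Longrightarrow> q' \<in> M \<inter> N \<Longrightarrow>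
              v \<in> i0.T q' \<Longrightarrow> w \<in> i0.T q' \<Longrightarrow> \<omega> v w = 0"
        have "p0 \<in> M \<inter> N" using N(2) i0.inM[OF p0] by blast
        then show ?thesis using pr[OF form _ s0] N(1) unfolding S_def lagrangian_near_def by blast
      qed
      have opn: "openin (top_of_set M) R" if "R \<subseteq> M" "\<And>p. p \<in> R \<Longrightarrow> \<exists>N. open N \<and> p \<in> N \<and> M \<inter> N \<subseteq> R" for R
        using that by (subst openin_subopen) (metis IntI openin_open_Int subsetD)
      have "openin (top_of_set M) S"
      proof (rule opn)
        fix p assume p: "p \<in> S"
        then obtain i where i: "p \<in> U i" using assms(7) unfolding S_def by blast
        then obtain N where "open N" "p \<in> N" "S \<inter> N \<noteq> {} \<longrightarrow> M \<inter> N \<subseteq> S" using loc[OF i] by blast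
        then show "\<exists>N. open N \<and> p \<in> N \<and> M \<inter> N \<subseteq> S" using p by blast
      qed (simp add: S_def)
      moreover have "openin (top_of_set M) (M - S)"
      proof (rule opn)
        fix p assume p: "p \<in> M - S"
        then obtain i where i: "p \<in> U i" using assms(7) by blast
        then obtain N where "open N" "p \<in> N" "S \<inter> N \<noteq> {} \<longrightarrow> M \<inter> N \<subseteq> S" using loc[OF i] by blast
        then show "\<exists>N. open N \<and> p \<in> N \<and> M \<inter> N \<subseteq> M - S" using p by blast
      qed blast
      moreover have "S \<subseteq> M" by (simp add: S_def)
      ultimately have "openin (top_of_set M) S \<and> closedin (top_of_set M) S" by (simp add: closedin_def)
      then have "S = M" using assms(3) p0S unfolding connected_clopen by blast
      then show ?thesis using form nd by (auto simp: S_def)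
    qed
    then obtain \<omega> where "alternating2 \<omega>" "\<forall>v. v \<noteq> 0 \<longrightarrow> (\<exists>w. \<omega> v w \<noteq> 0)" "\<forall>p\<in>M. lagrangian_near M \<omega> p" by blast
    then have "parallel_symplectic_form (\<lambda>_. \<omega>)" "lagrangian M (\<lambda>_. \<omega>)"
      unfolding parallel_symplectic_form_iff lagrangian_def lagrangian_near_def by blast+
    then show "\<exists>\<Omega>. parallel_symplectic_form \<Omega> \<and> lagrangian M \<Omega>" by blast
  }
qed

end
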